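(* Let $\rho_0\in L^\infty$ be supported in $\overline{B_1}$ and satisfy $\int_{\partial B_r}\rho_0\,dS_r=0$ for almost every $r>0$, and let $\rho$ be the solution of the continuity equation with velocity $u$ and initial datum $\rho_0$. Then, for every accuracy parameter $\kappa\in(0,1)$, $$\mathcal G(\rho(t,\cdot))\to 0\quad\text{and}\quad \|\rho(t,\cdot)\|_{\dot H^{-1}(B_1)}\to0\qquad\text{as } t\to\infty.$$
   Context: $B_1\subset\mathbb R^2$ is the open unit disk, $B_r(x)$ the open disk of radius $r$ centered at $x$, $B_r=B_r(0)$, $(r,\theta)$ polar coordinates, $dS_r$ arc-length measure on $\partial B_r$. The velocity field is $u(r,\theta)=2\pi r^2(\sin\theta,-\cos\theta)$ (smooth, divergence free, tangent to $\partial B_1$). For $\rho_0\in L^\infty$ supported in $\overline{B_1}$ (extended by zero outside), $\rho(t,\cdot)$ denotes the solution of $\partial_t\rho+\operatorname{div}(u\rho)=0$ on $[0,\infty)\times B_1$, $\rho(0,\cdot)=\rho_0$; explicitly, each circle of radius $r$ is rigidly rotated, $\rho(t,r,\theta)=\rho_0(r,\theta+2\pi tr)$, so $\|\rho(t,\cdot)\|_{L^\infty}=\|\rho_0\|_{L^\infty}$. Geometric mixing scale: for fixed $\kappa\in(0,1)$ and a bounded $f$ supported in $\overline{B_1}$ (extended by zero), $\mathcal G(f)$ is the infimum of all $\varepsilon>0$ such that $\big|\frac1{|B_\varepsilon|}\int_{B_\varepsilon(x)}f\big|\le\kappa\|f\|_{L^\infty(B_1)}$ for every $x\in\mathbb R^2$.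 Functional mixing scale: $\|f\|_{\dot H^{-1}(B_1)}=\sup\{\int_{B_1}f\xi\,dx:\ \xi\in H^1(B_1),\ \|\nabla\xi\|_{L^2(B_1)}\le1\}$. *)

theory Defs
  imports "HOL-Analysis.Analysis" "HOL-Probability.Essential_Supremum"
begin

text \<open>Points of the plane are pairs of reals; the norm on real \<times> real is Euclidean.\<close>

definition rot :: "real \<Rightarrow> real \<times> real \<Rightarrow> real \<times> real" where
  "rot a x = (cos a * fst x - sin a * snd x, sin a * fst x + cos a * snd x)"

text \<open>The solution of the continuity equation with velocity u:
  rho(t, r, theta) = rho0(r, theta + 2 pi t r).\<close>
definition transport :: "(real \<times> real \<Rightarrow> real) \<Rightarrow> real \<Rightarrow> real \<times> real \<Rightarrow> real" where
  "transport rho0 t x = rho0 (rot (2 * pi * t * norm x) x)"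

definition circle_int :: "(real \<times> real \<Rightarrow> real) \<Rightarrow> real \<Rightarrow> real" where
  "circle_int f r = (\<integral>\<theta>\<in>{0..2*pi}. f (r * cos \<theta>, r * sin \<theta>) * r \<partial>lborel)"

definition Linf_norm :: "(real \<times> real \<Rightarrow> real) \<Rightarrow> ereal" where
  "Linf_norm f = esssup lborel (\<lambda>x. ereal \<bar>f x\<bar>)"

definition mix_geo :: "real \<Rightarrow> (real \<times> real \<Rightarrow> real) \<Rightarrow> real" where
  "mix_geo \<kappa> f = Inf {\<epsilon>. \<epsilon> > 0 \<and> (\<forall>x. ereal \<bar>(\<integral>y\<in>ball x \<epsilon>. f y \<partial>lborel) / measure lborel (ball x \<epsilon>)\<bar>
        \<le> ereal \<kappa> * Linf_norm f)}"

coinductive smooth2 :: "(real \<times> real \<Rightarrow> real) \<Rightarrow> bool" where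
  "\<lbrakk>\<forall>x. f differentiable (at x);
    smooth2 (\<lambda>x. frechet_derivative f (at x) (1, 0));
    smooth2 (\<lambda>x. frechet_derivative f (at x) (0, 1))\<rbrakk> \<Longrightarrow> smooth2 f"

definition test_fun :: "(real \<times> real) set \<Rightarrow> (real \<times> real \<Rightarrow> real) \<Rightarrow> bool" where
  "test_fun U \<phi> \<longleftrightarrow> smooth2 \<phi> \<and> compact (closure {x. \<phi> x \<noteq> 0}) \<and> closure {x. \<phi> x \<noteq> 0} \<subseteq> U"

definition weak_grad :: "(real \<times> real) set \<Rightarrow> (real \<times> real \<Rightarrow> real) \<Rightarrow> (real \<times> real \<Rightarrow> real \<times> real) \<Rightarrow> bool" where
  "weak_grad U \<xi> g \<longleftrightarrow>
     (\<forall>K. compact K \<and> K \<subseteq> U \<longrightarrow> set_integrable lborel K \<xi> \<and> set_integrable lborel K g) \<and>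
     (\<forall>\<phi>. test_fun U \<phi> \<longrightarrow>
        (\<integral>x\<in>U. \<xi> x * frechet_derivative \<phi> (at x) (1, 0) \<partial>lborel) = - (\<integral>x\<in>U. fst (g x) * \<phi> x \<partial>lborel) \<and>
        (\<integral>x\<in>U. \<xi> x * frechet_derivative \<phi> (at x) (0, 1) \<partial>lborel) = - (\<integral>x\<in>U. snd (g x) * \<phi> x \<partial>lborel))"

definition H1_unit :: "(real \<times> real) set \<Rightarrow> (real \<times> real \<Rightarrow> real) set" where
  "H1_unit U = {\<xi>. \<xi> \<in> borel_measurable lborel \<and> set_integrable lborel U (\<lambda>x. (\<xi> x)\<^sup>2) \<and>
     (\<exists>g. g \<in> borel_measurable lborel \<and> weak_grad U \<xi> g \<and>
          set_integrable lborel U (\<lambda>x. (norm (g x))\<^sup>2) \<and>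
          (\<integral>x\<in>U. (norm (g x))\<^sup>2 \<partial>lborel) \<le> 1)}"

definition Hneg1_norm :: "(real \<times> real \<Rightarrow> real) \<Rightarrow> ereal" where
  "Hneg1_norm f = (SUP \<xi>\<in>H1_unit (ball 0 1). ereal (\<integral>x\<in>ball 0 1. f x * \<xi> x \<partial>lborel))"

end

theory Submission
  imports Defs
begin

text \<open>
  Write \<open>I(t) = \<integral> \<rho>(t, x) \<zeta>(x) dx\<close> with \<open>\<rho>(t, \<cdot>) = \<rho>0 \<circ> twist t\<close>. The dilation \<open>x \<mapsto> (1 - s/t) x\<close>
  conjugates \<open>twist t\<close> to \<open>twist (t - s)\<close>. Hence, if \<open>\<zeta>\<close> is bounded in \<open>L\<^sup>2\<close> and Lipschitz in \<open>L\<^sup>1\<close>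
  under dilations, then \<open>I(t) - I(t - s)\<close> tends to 0 as \<open>t\<close> grows, uniformly in \<open>s \<le> S\<close> and in
  \<open>\<zeta>\<close>, by continuity of dilations in \<open>L\<^sup>1\<close>. On the other hand the average of \<open>I(t - s)\<close> over
  \<open>s \<le> S\<close> is small for large \<open>S\<close>, because at a point \<open>x\<close> it averages \<open>\<rho>0\<close> over about \<open>S |x|\<close> full
  turns of a circle on which \<open>\<rho>0\<close> has mean zero. So \<open>I(t) \<rightarrow> 0\<close> uniformly over such \<open>\<zeta>\<close>.

  Indicators of disks of a fixed radius form such a class, which gives geometric mixing. For
  functional mixing, a function \<open>\<xi>\<close> with \<open>\<parallel>\<nabla>\<xi>\<parallel> \<le> 1\<close> may be replaced by \<open>\<xi>\<close> minus its mean over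
  circles, since \<open>\<rho>(t, \<cdot>)\<close> has mean zero on circles. Integrating the gradient of a mollification
  along circular arcs bounds this difference in \<open>L\<^sup>2\<close>, and integrating it along rays gives the
  Lipschitz bound under dilations.
\<close>

section \<open>Measure preserving rotations\<close>

text \<open>Both limits contain a supremum, over centres of disks or over \<open>H1_unit\<close>, so
  weak convergence against one test function at a time is too little: the time threshold has to come
  before the test function. This is why every estimate depends on the test function through one
  constant \<open>K\<close> only. No rate results, since \<open>\<rho>0\<close> is merely bounded
  and the \<open>L^1\<close> continuity of its dilations is qualitative. The unit circle is delicate
  twice. A test function cut off there may jump, so dilations are compared inside the disk only and
  the ring that crosses the circle is estimated separately. A weak gradient is tested only by
  functions supported inside the open disk, so the mollification of \<open>\<xi>\<close> is read at
  the contracted point \<open>(1 - \<delta>) x\<close>, where the kernel does not reach the circle.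
  \<open>H1_unit\<close> contains all constants and is therefore unbounded in \<open>L^2\<close>.
  Subtracting circle means cures this, and it replaces a Poincare inequality on the disk by a
  one-dimensional one on circles.\<close>

lemma rot_rot: "rot a (rot b x) = rot (a + b) x"
  by (simp add: rot_def cos_add sin_add algebra_simps)

lemma rot_0 [simp]: "rot 0 x = x"
  by (simp add: rot_def)

lemma rot_periodic: "rot (a + 2 * pi) x = rot a x"
  by (simp add: rot_def)

lemma norm_rot [simp]: "norm (rot a x) = norm x"
proof -
  have "(cos a * fst x - sin a * snd x)\<^sup>2 + (sin a * fst x + cos a * snd x)\<^sup>2
      = ((sin a)\<^sup>2 + (cos a)\<^sup>2) * ((fst x)\<^sup>2 + (snd x)\<^sup>2)"
    by algebra
  then show ?thesis
    by (simp add: rot_def norm_prod_def)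
qed

lemma rot_scaleR: "rot a (c *\<^sub>R x) = c *\<^sub>R rot a x"
  by (simp add: rot_def algebra_simps)

lemma continuous_on_rot [continuous_intros]:
  fixes S :: "'a::t2_space set"
  shows "continuous_on S f \<Longrightarrow> continuous_on S g \<Longrightarrow> continuous_on S (\<lambda>x. rot (f x) (g x))"
  unfolding rot_def by (auto intro!: continuous_intros)

lemma borel_measurable_fst_snd [measurable (raw)]:
  fixes f :: "'a \<Rightarrow> real \<times> real"
  assumes "f \<in> borel_measurable M"
  shows "(\<lambda>x. fst (f x)) \<in> borel_measurable M" "(\<lambda>x. snd (f x)) \<in> borel_measurable M"
  using assms by (auto intro!: borel_measurable_continuous_on[where g=f] continuous_intros)

lemma measurable_rot [measurable (raw)]:
  assumes "f \<in> borel_measurable M" "g \<in> borel_measurable M"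
  shows "(\<lambda>x. rot (f x) (g x)) \<in> borel_measurable M"
proof -
  have "continuous_on UNIV (\<lambda>p::real \<times> real \<times> real. rot (fst p) (snd p))"
    by (intro continuous_intros)
  from borel_measurable_continuous_on[OF this, of "\<lambda>x. (f x, g x)"] assms show ?thesis by simp
qed

section \<open>Invariance of planar Lebesgue measure under shears, rotations and twists\<close>

lemma nn_integral_lborel_fst:
  fixes f :: "'a::euclidean_space \<times> 'b::euclidean_space \<Rightarrow> ennreal"
  assumes "f \<in> borel_measurable borel"
  shows "(\<integral>\<^sup>+ z. f z \<partial>lborel) = (\<integral>\<^sup>+ x. (\<integral>\<^sup>+ y. f (x, y) \<partial>lborel) \<partial>lborel)"
  using lborel.nn_integral_fst[of f "lborel::'a measure"] assms by (simp add: lborel_prod)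

lemma nn_integral_lborel_snd:
  fixes f :: "'a::euclidean_space \<times> 'b::euclidean_space \<Rightarrow> ennreal"
  assumes "f \<in> borel_measurable borel"
  shows "(\<integral>\<^sup>+ z. f z \<partial>lborel) = (\<integral>\<^sup>+ y. (\<integral>\<^sup>+ x. f (x, y) \<partial>lborel) \<partial>lborel)"
  using lborel_pair.nn_integral_snd[of f] assms by (simp add: lborel_prod)

lemma nn_integral_translate:
  assumes [measurable]: "f \<in> borel_measurable borel"
  shows "(\<integral>\<^sup>+ x. f (c + x) \<partial>lborel) = (\<integral>\<^sup>+ x. f x \<partial>(lborel :: 'a::euclidean_space measure))"
  by (subst (2) lborel_distr_plus[of c, symmetric]) (simp add: nn_integral_distr)

text \<open>On each horizontal line a shear is a translation, so slicing reduces it to translation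
  invariance.\<close>

lemma nn_integral_shear_fst:
  fixes f :: "real \<times> real \<Rightarrow> ennreal"
  assumes [measurable]: "f \<in> borel_measurable borel"
  shows "(\<integral>\<^sup>+ z. f (fst z + a * snd z, snd z) \<partial>lborel) = (\<integral>\<^sup>+ z. f z \<partial>lborel)"
proof -
  have m: "(\<lambda>z::real \<times> real. f (fst z + a * snd z, snd z)) \<in> borel_measurable borel"
    by measurable
  show ?thesis
    unfolding nn_integral_lborel_snd[OF m] nn_integral_lborel_snd[OF assms]
    using nn_integral_translate[of "\<lambda>x. f (x, y)" "a * y" for y] by (simp add: add.commute)
qed

lemma nn_integral_shear_snd:
  fixes f :: "real \<times> real \<Rightarrow> ennreal"
  assumes [measurable]: "f \<in> borel_measurable borel"
  shows "(\<integral>\<^sup>+ z. f (fst z, snd z + a * fst z) \<partial>lborel) = (\<integral>\<^sup>+ z. f z \<partial>lborel)"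
proof -
  have m: "(\<lambda>z::real \<times> real. f (fst z, snd z + a * fst z)) \<in> borel_measurable borel"
    by measurable
  show ?thesis
    unfolding nn_integral_lborel_fst[OF m] nn_integral_lborel_fst[OF assms]
    using nn_integral_translate[of "\<lambda>y. f (x, y)" "a * x" for x] by (simp add: add.commute)
qed

lemma nn_integral_rot:
  fixes f :: "real \<times> real \<Rightarrow> ennreal"
  assumes [measurable]: "f \<in> borel_measurable borel"
  shows "(\<integral>\<^sup>+ z. f (rot a z) \<partial>lborel) = (\<integral>\<^sup>+ z. f z \<partial>lborel)"
proof -
  \<comment> \<open>A rotation by an angle \<open>a\<close> with \<open>cos (a/2) \<noteq> 0\<close> is a product of three shears.\<close>
  have *: "(\<integral>\<^sup>+ z. f (rot a z) \<partial>lborel) = (\<integral>\<^sup>+ z. f z \<partial>lborel)"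
    if [measurable]: "f \<in> borel_measurable borel" and c: "cos (a / 2) \<noteq> 0"
    for f :: "real \<times> real \<Rightarrow> ennreal" and a
  proof -
    let ?t = "tan (a / 2)"
    let ?X = "\<lambda>z::real \<times> real. (fst z + (- ?t) * snd z, snd z)"
    let ?Y = "\<lambda>z::real \<times> real. (fst z, snd z + sin a * fst z)"
    have s: "sin a = 2 * sin (a/2) * cos (a/2)" "cos a = 1 - 2 * (sin (a/2))\<^sup>2"
      using sin_double[of "a/2"] cos_double_sin[of "a/2"] by simp_all
    have 1: "1 - ?t * sin a = cos a"
      using c by (simp add: s tan_def power2_eq_square)
    have 2: "?t * (1 + cos a) = sin a"
    proof -
      have "1 + cos a = 2 * (cos (a/2))\<^sup>2" using cos_double_cos[of "a/2"] by simp
      then show ?thesis using c by (simp add: s(1) tan_def power2_eq_square)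
    qed
    have eq: "rot a z = ?X (?Y (?X z))" for z
    proof -
      have "fst z - ?t * snd z - ?t * (snd z + sin a * (fst z - ?t * snd z)) 
         = (1 - ?t * sin a) * fst z - ?t * (1 + (1 - ?t * sin a)) * snd z" by algebra
      also have "\<dots> = cos a * fst z - sin a * snd z" unfolding 1 2 by simp
      finally have A: "fst z - ?t * snd z - ?t * (snd z + sin a * (fst z - ?t * snd z)) 
         = cos a * fst z - sin a * snd z" .
      have "snd z + sin a * (fst z - ?t * snd z) = sin a * fst z + (1 - ?t * sin a) * snd z"
        by algebra
      then show ?thesis using A unfolding 1 by (simp add: rot_def)
    qed
    have "(\<integral>\<^sup>+ z. f (rot a z) \<partial>lborel) = (\<integral>\<^sup>+ z. f (?X (?Y (?X z))) \<partial>lborel)"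
      unfolding eq ..
    also have "\<dots> = (\<integral>\<^sup>+ z. f (?X (?Y z)) \<partial>lborel)"
      by (rule nn_integral_shear_fst) measurable
    also have "\<dots> = (\<integral>\<^sup>+ z. f (?X z) \<partial>lborel)"
      by (rule nn_integral_shear_snd) measurable
    also have "\<dots> = (\<integral>\<^sup>+ z. f z \<partial>lborel)"
      by (rule nn_integral_shear_fst) measurable
    finally show ?thesis .
  qed
  show ?thesis
  proof (cases "cos (a / 2) = 0")
    case False
    then show ?thesis using *[OF assms] by blast
  next
    case True
    \<comment> \<open>If \<open>cos (a / 4)\<close> vanished, the double angle formula would give
      \<open>cos (a / 2) = -1\<close>. So the three shears are available for \<open>a / 2\<close>,
      and two such rotations make \<open>rot a\<close>.\<close>
    then have c: "cos (a / 2 / 2) \<noteq> 0"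
      using cos_double_cos[of "a/2/2"] by auto
    have "(\<integral>\<^sup>+ z. f (rot a z) \<partial>lborel) = (\<integral>\<^sup>+ z. f (rot (a/2) (rot (a/2) z)) \<partial>lborel)"
      by (simp add: rot_rot)
    also have "\<dots> = (\<integral>\<^sup>+ z. f z \<partial>lborel)"
      using *[of "\<lambda>z. f (rot (a/2) z)", OF _ c] *[OF assms c] by simp
    finally show ?thesis .
  qed
qed

text \<open>Translation by a multiple of \<open>p\<close> makes the window start at some
  \<open>d\<close> in \<open>{0..<p}\<close>; the part beyond \<open>p\<close> is then moved back by
  one period.\<close>

lemma nn_integral_periodic:
  fixes h :: "real \<Rightarrow> ennreal"
  assumes [measurable]: "h \<in> borel_measurable borel" and per: "\<And>x. h (x + p) = h x" and p: "p > 0"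
  shows "(\<integral>\<^sup>+ x\<in>{c..<c+p}. h x \<partial>lborel) = (\<integral>\<^sup>+ x\<in>{0..<p}. h x \<partial>lborel)"
proof -
  have per': "h (x + of_int n * p) = h x" for x n
  proof (induction n)
    case (nonneg n)
    then show ?case by (induction n) (use per[of "x + real _ * p"] in \<open>auto simp: algebra_simps\<close>)
  next
    case (neg n)
    have "h (x - real m * p) = h x" for m
      by (induction m) (use per[of "x - real (Suc _) * p"] in \<open>auto simp: algebra_simps\<close>)
    from this[of "Suc n"] show ?case by (simp add: algebra_simps)
  qed
  have shift: "(\<integral>\<^sup>+ x\<in>{a + of_int n * p..<b + of_int n * p}. h x \<partial>lborel) = (\<integral>\<^sup>+ x\<in>{a..<b}. h x \<partial>lborel)"
    for a b n
    using nn_integral_translate[of "\<lambda>x. h x * indicator {a + of_int n * p..<b + of_int n * p} x" "of_int n * p", symmetric]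
    by (auto simp: per' add.commute indicator_def cong: if_cong)
  define n where "n = \<lfloor>c / p\<rfloor>"
  define d where "d = c - of_int n * p"
  have d: "0 \<le> d" "d < p"
    using floor_divide_lower[OF p, of c] floor_divide_upper[OF p, of c] by (auto simp: d_def n_def algebra_simps)
  have split: "(\<integral>\<^sup>+ x\<in>{a..<b}. h x \<partial>lborel) = (\<integral>\<^sup>+ x\<in>{a..<m}. h x \<partial>lborel) + (\<integral>\<^sup>+ x\<in>{m..<b}. h x \<partial>lborel)"
    if "a \<le> m" "m \<le> b" for a m b
    using that by (subst nn_integral_add[symmetric]) (auto intro!: nn_integral_cong simp: indicator_def)
  have "(\<integral>\<^sup>+ x\<in>{c..<c+p}. h x \<partial>lborel) = (\<integral>\<^sup>+ x\<in>{d..<d+p}. h x \<partial>lborel)"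
    using shift[of d n "d+p"] by (simp add: d_def algebra_simps)
  also have "\<dots> = (\<integral>\<^sup>+ x\<in>{d..<p}. h x \<partial>lborel) + (\<integral>\<^sup>+ x\<in>{p..<d+p}. h x \<partial>lborel)"
    using d by (intro split) auto
  also have "(\<integral>\<^sup>+ x\<in>{p..<d+p}. h x \<partial>lborel) = (\<integral>\<^sup>+ x\<in>{0..<d}. h x \<partial>lborel)"
    using shift[of 0 1 d] by simp
  also have "(\<integral>\<^sup>+ x\<in>{d..<p}. h x \<partial>lborel) + (\<integral>\<^sup>+ x\<in>{0..<d}. h x \<partial>lborel) = (\<integral>\<^sup>+ x\<in>{0..<p}. h x \<partial>lborel)"
    using split[of 0 d p] d by (simp add: add.commute)
  finally show ?thesis .
qed

text \<open>The flow map: the solution at time \<open>t\<close> is the initial datum composed with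
  it (\<open>transport_eq_twist\<close>).\<close>

definition twist :: "real \<Rightarrow> real \<times> real \<Rightarrow> real \<times> real" where
  "twist t x = rot (2 * pi * t * norm x) x"

lemma norm_twist [simp]: "norm (twist t x) = norm x"
  by (simp add: twist_def)

lemma measurable_twist [measurable (raw)]:
  assumes [measurable]: "f \<in> borel_measurable M" "g \<in> borel_measurable M"
  shows "(\<lambda>x. twist (f x) (g x)) \<in> borel_measurable M"
  unfolding twist_def by measurable

lemma nn_integral_twist:
  fixes f :: "real \<times> real \<Rightarrow> ennreal"
  assumes [measurable]: "f \<in> borel_measurable borel"
  shows "(\<integral>\<^sup>+ x. f (twist t x) \<partial>lborel) = (\<integral>\<^sup>+ x. f x \<partial>lborel)"
proof -
  \<comment> \<open>Averaged over all rotations, \<open>f \<circ> twist t\<close> and \<open>f\<close> agree.\<close>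
  have avg: "ennreal (2 * pi) * (\<integral>\<^sup>+ x. g x \<partial>lborel)
      = (\<integral>\<^sup>+ x. (\<integral>\<^sup>+ a\<in>{0..<2 * pi}. g (rot a x) \<partial>lborel) \<partial>lborel)"
    if [measurable]: "g \<in> borel_measurable borel" for g :: "real \<times> real \<Rightarrow> ennreal"
  proof -
    have "(\<integral>\<^sup>+ x. (\<integral>\<^sup>+ a\<in>{0..<2 * pi}. g (rot a x) \<partial>lborel) \<partial>lborel)
      = (\<integral>\<^sup>+ a. (\<integral>\<^sup>+ x. g (rot a x) * indicator {0..<2 * pi} a \<partial>lborel) \<partial>lborel)"
      by (rule pair_sigma_finite.Fubini') (unfold_locales, measurable)
    also have "\<dots> = (\<integral>\<^sup>+ a. (\<integral>\<^sup>+ x. g x \<partial>lborel) * indicator {0..<2 * pi} a \<partial>lborel)"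
      by (simp add: nn_integral_multc nn_integral_rot)
    also have "\<dots> = ennreal (2 * pi) * (\<integral>\<^sup>+ x. g x \<partial>lborel)"
      by (simp add: nn_integral_cmult mult.commute)
    finally show ?thesis by simp
  qed
  have "(\<integral>\<^sup>+ a\<in>{0..<2 * pi}. f (twist t (rot a x)) \<partial>lborel)
      = (\<integral>\<^sup>+ a\<in>{0..<2 * pi}. f (rot a x) \<partial>lborel)" for x
  proof -
    \<comment> \<open>All points \<open>rot a x\<close> have the same norm, so on this circle the
      twist is the rotation by the fixed angle \<open>?c\<close>. It only shifts the window of
      angles, which periodicity ignores.\<close>
    let ?c = "2 * pi * t * norm x"
    have "(\<integral>\<^sup>+ a\<in>{0..<2 * pi}. f (twist t (rot a x)) \<partial>lborel)
       = (\<integral>\<^sup>+ a. f (rot (?c + a) x) * indicator {?c..<?c + 2 * pi} (?c + a) \<partial>lborel)"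
      by (intro nn_integral_cong) (auto simp: twist_def rot_rot indicator_def)
    also have "\<dots> = (\<integral>\<^sup>+ a\<in>{?c..<?c + 2 * pi}. f (rot a x) \<partial>lborel)"
      by (rule nn_integral_translate) measurable
    also have "\<dots> = (\<integral>\<^sup>+ a\<in>{0..<2 * pi}. f (rot a x) \<partial>lborel)"
      by (rule nn_integral_periodic) (auto simp: rot_periodic)
    finally show ?thesis .
  qed
  then have "ennreal (2 * pi) * (\<integral>\<^sup>+ x. f (twist t x) \<partial>lborel) = ennreal (2 * pi) * (\<integral>\<^sup>+ x. f x \<partial>lborel)"
    using avg[of "\<lambda>x. f (twist t x)"] avg[of f] by simp
  then show ?thesis
    by (simp add: ennreal_mult_cancel_left)
qed

lemma distr_lborel_eqI:
  fixes f :: "'a::euclidean_space \<Rightarrow> 'a"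
  assumes [measurable]: "f \<in> borel_measurable borel"
    and f: "\<And>h. h \<in> borel_measurable borel \<Longrightarrow> (\<integral>\<^sup>+ x. h (f x) \<partial>lborel) = (\<integral>\<^sup>+ x. h x \<partial>lborel)"
  shows "distr lborel borel f = lborel"
proof (rule measure_eqI)
  fix A assume "A \<in> sets (distr lborel borel f)"
  then have [measurable]: "A \<in> sets borel" by simp
  have "emeasure (distr lborel borel f) A = (\<integral>\<^sup>+ x. indicator A (f x) \<partial>lborel)"
    by (simp add: nn_integral_distr flip: nn_integral_indicator)
  also have "\<dots> = emeasure lborel A"
    by (subst f) auto
  finally show "emeasure (distr lborel borel f) A = emeasure lborel A" .
qed simp

lemma distr_twist: "distr lborel borel (twist t) = lborel"
  by (rule distr_lborel_eqI) (auto simp: nn_integral_twist)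

lemma distr_rot: "distr lborel borel (rot a) = lborel"
  by (rule distr_lborel_eqI) (auto simp: nn_integral_rot)

section \<open>Bounded integrands, periodic integrands with mean zero, and time averages along the
  twist\<close>

lemma integrable_bounded_on:
  fixes f :: "'a::euclidean_space \<Rightarrow> real"
  assumes [measurable]: "f \<in> borel_measurable borel" "A \<in> sets borel"
    and bdd: "bounded A" and b: "\<And>x. x \<in> A \<Longrightarrow> \<bar>f x\<bar> \<le> C"
  shows "set_integrable lborel A f"
  unfolding set_integrable_def
proof (rule Bochner_Integration.integrable_bound[where f="\<lambda>x. C * indicator A x"])
  show "integrable lborel (\<lambda>x. C * indicat_real A x)"
    using emeasure_bounded_finite[OF bdd] by (intro integrable_mult_right) (auto simp: integrable_indicator_iff)
qed (use b in \<open>auto simp: indicator_def intro!: AE_I2 order_trans[OF b]\<close>)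

lemma set_integral_bounded:
  fixes f :: "'a::euclidean_space \<Rightarrow> real"
  assumes "f \<in> borel_measurable borel" "A \<in> sets borel"
    and bdd: "bounded A" and "\<And>x. x \<in> A \<Longrightarrow> \<bar>f x\<bar> \<le> C"
  shows "\<bar>\<integral>x\<in>A. f x \<partial>lborel\<bar> \<le> C * measure lborel A"
proof -
  have "\<bar>\<integral>x\<in>A. f x \<partial>lborel\<bar> \<le> (\<integral>x\<in>A. \<bar>f x\<bar> \<partial>lborel)"
    unfolding set_lebesgue_integral_def
    by (rule order_trans[OF integral_abs_bound]) (simp add: abs_mult)
  also have "\<dots> \<le> (\<integral>x\<in>A. C \<partial>lborel)"
    using assms
    by (intro set_integral_mono set_integrable_abs integrable_bounded_on[where C=C] integrable_bounded_on[where C="\<bar>C\<bar>"]) auto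
  also have "\<dots> = C * measure lborel A"
    using assms emeasure_bounded_finite[OF bdd] by (simp add: set_integral_const)
  finally show ?thesis .
qed

lemma set_integral_periodic:
  fixes h :: "real \<Rightarrow> real"
  assumes [measurable]: "h \<in> borel_measurable borel" and per: "\<And>x. h (x + p) = h x" and p: "p > 0"
    and b: "\<And>x. \<bar>h x\<bar> \<le> C"
  shows "(\<integral>x\<in>{c..<c+p}. h x \<partial>lborel) = (\<integral>x\<in>{0..<p}. h x \<partial>lborel)"
proof -
  have C: "C \<ge> 0" using b[of 0] by linarith
  \<comment> \<open>Adding \<open>C\<close> makes the integrand nonnegative, so
    \<open>nn_integral_periodic\<close> applies; the added constant contributes \<open>C * p\<close>
    for either window.\<close>
  have nn: "h x + C \<ge> 0" for x using b[of x] by linarith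
  have "(\<integral>x\<in>{d..<d+p}. h x \<partial>lborel) = enn2real (\<integral>\<^sup>+ x\<in>{d..<d+p}. ennreal (h x + C) \<partial>lborel) - C * p" for d
  proof -
    have i: "set_integrable lborel {d..<d+p} h" 
      using b by (intro integrable_bounded_on[where C=C]) auto
    have i2: "set_integrable lborel {d..<d+p} (\<lambda>x. h x + C)"
      using b by (intro integrable_bounded_on[where C="C+C"]) (auto intro: order_trans[OF abs_triangle_ineq] simp: add_mono C)
    have "(\<integral>x\<in>{d..<d+p}. h x + C \<partial>lborel) = (\<integral>x\<in>{d..<d+p}. h x \<partial>lborel) + C * p"
      using i p by (subst set_integral_add) (auto simp: set_integral_const intro!: integrable_bounded_on)
    moreover have "(\<integral>x\<in>{d..<d+p}. h x + C \<partial>lborel) = enn2real (\<integral>\<^sup>+ x. ennreal (indicator {d..<d+p} x * (h x + C)) \<partial>lborel)"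
      unfolding set_lebesgue_integral_def using i2 nn
      by (subst integral_eq_nn_integral) (auto simp: set_integrable_def)
    moreover have "(\<integral>\<^sup>+ x. ennreal (indicator {d..<d+p} x * (h x + C)) \<partial>lborel) = (\<integral>\<^sup>+ x\<in>{d..<d+p}. ennreal (h x + C) \<partial>lborel)"
      by (intro nn_integral_cong) (auto simp: indicator_def)
    ultimately show ?thesis by simp
  qed
  from this[of c] this[of 0] nn_integral_periodic[of "\<lambda>x. ennreal (h x + C)" p c] per p
  show ?thesis by simp
qed

text \<open>Complete periods contribute nothing, which leaves a remainder shorter than one period
  however long the window is.\<close>

lemma set_integral_periodic_bound:
  fixes h :: "real \<Rightarrow> real"
  assumes [measurable]: "h \<in> borel_measurable borel" and per: "\<And>x. h (x + p) = h x" and p: "p > 0"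
    and b: "\<And>x. \<bar>h x\<bar> \<le> C" and mean: "(\<integral>x\<in>{0..<p}. h x \<partial>lborel) = 0" and "c \<le> d"
  shows "\<bar>\<integral>x\<in>{c..<d}. h x \<partial>lborel\<bar> \<le> C * p"
proof -
  have C: "C \<ge> 0" using b[of 0] by linarith
  have i: "set_integrable lborel {u..<v} h" for u v
    using b by (intro integrable_bounded_on[where C=C]) auto
  have split: "(\<integral>x\<in>{u..<w}. h x \<partial>lborel) = (\<integral>x\<in>{u..<v}. h x \<partial>lborel) + (\<integral>x\<in>{v..<w}. h x \<partial>lborel)"
    if "u \<le> v" "v \<le> w" for u v w
  proof -
    have "{u..<w} = {u..<v} \<union> {v..<w}" using that by auto
    then show ?thesis using i by (simp add: set_integral_Un)
  qed
  have z: "(\<integral>x\<in>{c..<c + real n * p}. h x \<partial>lborel) = 0" for n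
  proof (induction n)
    case (Suc n)
    have "(\<integral>x\<in>{c..<c + real (Suc n) * p}. h x \<partial>lborel) = 
       (\<integral>x\<in>{c..<c + real n * p}. h x \<partial>lborel) + (\<integral>x\<in>{c + real n * p..<c + real n * p + p}. h x \<partial>lborel)"
      using p by (subst split[of _ "c + real n * p"]) (auto simp: algebra_simps)
    also have "(\<integral>x\<in>{c + real n * p..<c + real n * p + p}. h x \<partial>lborel) = 0"
      using set_integral_periodic[of h p C "c + real n * p"] assms by simp
    finally show ?case using Suc by simp
  qed (simp add: set_lebesgue_integral_def)
  define n where "n = nat \<lfloor>(d - c) / p\<rfloor>"
  have n: "real n * p \<le> d - c" "d - c < real n * p + p"
    using floor_divide_lower[OF p, of "d - c"] floor_divide_upper[OF p, of "d - c"] \<open>c \<le> d\<close> p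
    by (auto simp: n_def algebra_simps)
  have "\<bar>\<integral>x\<in>{c..<d}. h x \<partial>lborel\<bar> = \<bar>\<integral>x\<in>{c + real n * p..<d}. h x \<partial>lborel\<bar>"
    using split[of c "c + real n * p" d] z[of n] n p by simp
  also have "\<dots> \<le> C * measure lborel {c + real n * p..<d}"
    using b by (intro set_integral_bounded) auto
  also have "\<dots> \<le> C * p"
    using n C by (intro mult_left_mono) auto
  finally show ?thesis .
qed

text \<open>The substitution \<open>u = 2 * pi * (t - s) * norm x\<close> turns time into angle. The
  angular integral is at most \<open>C * (2 * pi)\<close> by cancellation, and the Jacobian
  \<open>2 * pi * norm x\<close> is divided out. The bound does not grow with \<open>S\<close>, so
  dividing by \<open>S\<close> makes the time average small.\<close>

lemma twist_time_average_bound: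
  fixes \<rho> :: "real \<times> real \<Rightarrow> real"
  assumes [measurable]: "\<rho> \<in> borel_measurable borel" and b: "\<And>x. \<bar>\<rho> x\<bar> \<le> C"
    and mean: "(\<integral>a\<in>{0..<2*pi}. \<rho> (rot a x) \<partial>lborel) = 0" and x: "x \<noteq> 0" and S: "S \<ge> 0"
  shows "\<bar>\<integral>s\<in>{0<..S}. \<rho> (twist (t - s) x) \<partial>lborel\<bar> \<le> C / norm x"
proof -
  let ?c = "- (2 * pi * norm x)" and ?d = "2 * pi * t * norm x"
  have nx: "norm x > 0" using x by simp
  let ?F = "\<lambda>u. indicator {?d + ?c * S..<?d} u *\<^sub>R \<rho> (rot u x)"
  \<comment> \<open>The substitution reverses orientation: the half-open time window
    \<open>{0<..S}\<close> corresponds exactly to an angular window closed on the left, the form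
    used for periodic integrands.\<close>
  have ind: "indicat_real {?d + ?c * S..<?d} (?d + ?c * s) = indicat_real {0<..S} s" for s
    using nx by (auto simp: indicator_def zero_less_mult_iff mult_less_0_iff not_less[symmetric])
  have "(\<integral>u. ?F u \<partial>lborel) = \<bar>?c\<bar> *\<^sub>R (\<integral>s. ?F (?d + ?c * s) \<partial>lborel)"
    using nx by (intro lborel_integral_real_affine) auto
  also have "(\<integral>s. ?F (?d + ?c * s) \<partial>lborel) = (\<integral>s\<in>{0<..S}. \<rho> (twist (t - s) x) \<partial>lborel)"
    unfolding set_lebesgue_integral_def ind by (simp add: twist_def algebra_simps)
  finally have "(\<integral>u\<in>{?d + ?c * S..<?d}. \<rho> (rot u x) \<partial>lborel) = 2 * pi * norm x * (\<integral>s\<in>{0<..S}. \<rho> (twist (t - s) x) \<partial>lborel)"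
    using nx by (simp add: set_lebesgue_integral_def)
  moreover have "\<bar>\<integral>u\<in>{?d + ?c * S..<?d}. \<rho> (rot u x) \<partial>lborel\<bar> \<le> C * (2 * pi)"
    using mean b S by (intro set_integral_periodic_bound) (auto simp: rot_periodic)
  ultimately show ?thesis
    using nx by (simp add: abs_mult field_simps)
qed

section \<open>From almost every radius to almost every point of the plane\<close>

lemma polar_rot:
  assumes "x \<noteq> 0"
  obtains \<theta> where "x = rot \<theta> (norm x, 0)"
proof -
  have nx: "norm x \<noteq> 0" using assms by simp
  have "(fst x / norm x)\<^sup>2 + (snd x / norm x)\<^sup>2 = ((fst x)\<^sup>2 + (snd x)\<^sup>2) / (norm x)\<^sup>2"
    by (simp add: power_divide add_divide_distrib)
  also have "(fst x)\<^sup>2 + (snd x)\<^sup>2 = (norm x)\<^sup>2"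
    by (simp add: norm_prod_def)
  finally have "(fst x / norm x)\<^sup>2 + (snd x / norm x)\<^sup>2 = 1"
    using nx by simp
  then obtain \<theta> where "fst x / norm x = cos \<theta>" "snd x / norm x = sin \<theta>"
    using sincos_total_2pi by metis
  then have "fst x = cos \<theta> * norm x" "snd x = sin \<theta> * norm x"
    using nx by (auto simp: nonzero_divide_eq_eq)
  then have "x = rot \<theta> (norm x, 0)"
    by (intro prod_eqI) (auto simp: rot_def)
  then show ?thesis using that by blast
qed

text \<open>The bad radii form a null set \<open>N\<close>, so \<open>N \<times> UNIV\<close> is
  null in the plane. Polar coordinates are a differentiable map between spaces of equal dimension
  and hence send it to a null set.\<close>

lemma AE_norm:
  fixes P :: "real \<Rightarrow> bool"
  assumes "AE r in lborel. r > 0 \<longrightarrow> P r"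
  shows "AE x::real \<times> real in lborel. x \<noteq> 0 \<longrightarrow> P (norm x)"
proof -
  from assms obtain N where N: "N \<in> null_sets lborel" "{r. \<not> (r > 0 \<longrightarrow> P r)} \<subseteq> N"
    by (auto simp: eventually_ae_filter)
  let ?f = "\<lambda>z::real \<times> real. (fst z * cos (snd z), fst z * sin (snd z))"
  have "N \<times> (UNIV::real set) \<in> null_sets (lborel \<Otimes>\<^sub>M lborel)"
    using N by (intro lborel.times_in_null_sets1) auto
  then have neg: "negligible (N \<times> (UNIV::real set))"
    by (auto simp: lborel_prod negligible_iff_null_sets null_sets_completionI)
  have diff: "?f differentiable_on N \<times> UNIV"
  proof -
    have "(?f has_derivative (\<lambda>h. (fst z * (- (snd h * sin (snd z))) + fst h * cos (snd z),
        fst z * (snd h * cos (snd z)) + fst h * sin (snd z)))) (at z within X)" for z X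
      by (rule has_derivative_Pair;
          rule has_derivative_eq_rhs[OF has_derivative_mult[OF has_derivative_fst[OF has_derivative_ident]]],
          (rule has_derivative_cos has_derivative_sin has_derivative_snd has_derivative_ident)+,
          simp add: fun_eq_iff)
    then show ?thesis
      unfolding differentiable_on_def differentiable_def by blast
  qed
  have "negligible (?f ` (N \<times> UNIV))"
    by (rule negligible_differentiable_image_negligible[OF _ neg diff]) simp
  then have "AE x in lebesgue. x \<notin> ?f ` (N \<times> UNIV)"
    by (simp add: negligible_iff_null_sets AE_not_in)
  then have "AE x::real \<times> real in lebesgue. x \<noteq> 0 \<longrightarrow> P (norm x)"
  proof (eventually_elim, intro impI)
    fix x :: "real \<times> real" assume x: "x \<notin> ?f ` (N \<times> UNIV)" "x \<noteq> 0"
    obtain \<theta> where "x = rot \<theta> (norm x, 0)" using polar_rot[OF x(2)] .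
    then have "x = ?f (norm x, \<theta>)" unfolding rot_def by (simp add: mult.commute)
    moreover have "?f (norm x, \<theta>) \<in> ?f ` (N \<times> UNIV)" if "norm x \<in> N"
      using that by (intro imageI) auto
    ultimately have "norm x \<notin> N" using x(1) by argo
    then have "norm x \<notin> {r. \<not> (r > 0 \<longrightarrow> P r)}" using N(2) by blast
    then show "P (norm x)" using x(2) by simp
  qed
  then show ?thesis by (simp add: AE_completion_iff)
qed

lemma AE_rot:
  assumes "AE x in lborel. P x"
  shows "AE x in lborel. P (rot a x)"
proof -
  have "AE x in distr lborel borel (rot a). P x"
    unfolding distr_rot by (rule assms)
  then show ?thesis by (intro AE_distrD[where f="rot a" and M'=borel]) auto
qed

lemma AE_twist:
  assumes "AE x in lborel. P x"
  shows "AE x in lborel. P (twist t x)"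
proof -
  have "AE x in distr lborel borel (twist t). P x"
    unfolding distr_twist by (rule assms)
  then show ?thesis by (intro AE_distrD[where f="twist t" and M'=borel]) auto
qed

text \<open>A single circle is a null set, so a property valid almost everywhere says nothing about
  a given circle. Fubini over the angle and the point gives it along almost every circle.\<close>

lemma AE_AE_rot:
  assumes P: "AE x in lborel. P x" and [measurable]: "Measurable.pred borel P"
  shows "AE x in lborel. AE a in lborel. P (rot a x)"
proof -
  have "AE a in lborel. AE x in lborel. P (rot a x)"
    using AE_rot[OF P] by simp
  moreover have "Measurable.pred (lborel \<Otimes>\<^sub>M lborel) (\<lambda>z. P (rot (snd z) (fst z)))"
    by measurable
  ultimately show ?thesis
    by (subst lborel_pair.AE_commute) (auto simp: pred_def)
qed

text \<open>Carries the hypothesis on \<open>circle_int\<close> from \<open>\<rho>0\<close> to its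
  bounded representative \<open>\<rho>\<close>, and from the base point \<open>(norm x, 0)\<close>
  of the circle to \<open>x\<close> itself, which costs only a shift of the angle.\<close>

lemma AE_rotation_mean_zero:
  assumes [measurable]: "\<rho>0 \<in> borel_measurable borel" "\<rho> \<in> borel_measurable borel"
    and b: "\<And>x. \<bar>\<rho> x\<bar> \<le> C" and eq: "AE x in lborel. \<rho>0 x = \<rho> x"
    and circ: "AE r in lborel. r > 0 \<longrightarrow> circle_int \<rho>0 r = 0"
  shows "AE x in lborel. (\<integral>a\<in>{0..<2*pi}. \<rho> (rot a x) \<partial>lborel) = 0"
proof -
  have "AE x in lborel. AE a in lborel. \<rho>0 (rot a x) = \<rho> (rot a x)"
    by (rule AE_AE_rot[OF eq]) measurable
  moreover have "AE x::real \<times> real in lborel. x \<noteq> 0 \<longrightarrow> circle_int \<rho>0 (norm x) = 0"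
    by (rule AE_norm[OF circ])
  moreover have "AE x::real \<times> real in lborel. x \<noteq> 0"
    by (rule AE_lborel_singleton)
  ultimately show ?thesis
  proof eventually_elim
    fix x :: "real \<times> real"
    assume ae: "AE a in lborel. \<rho>0 (rot a x) = \<rho> (rot a x)"
      and c: "x \<noteq> 0 \<longrightarrow> circle_int \<rho>0 (norm x) = 0" and x: "x \<noteq> 0"
    let ?r = "norm x"
    obtain \<theta> where \<theta>: "x = rot \<theta> (?r, 0)" using polar_rot[OF x] .
    have \<theta>': "rot (a + (- \<theta>)) x = rot a (?r, 0)" for a
      by (subst \<theta>) (simp add: rot_rot)
    have "AE a in lborel. \<rho>0 (rot (- \<theta> + 1 * a) x) = \<rho> (rot (- \<theta> + 1 * a) x)"
      using ae by (intro AE_borel_affine) auto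
    then have ae': "AE a in lborel. \<rho>0 (rot a (?r, 0)) = \<rho> (rot a (?r, 0))"
      unfolding mult_1 add.commute[of "- \<theta>"] \<theta>' .
    have "0 = (\<integral>a\<in>{0..2*pi}. \<rho>0 (rot a (?r, 0)) * ?r \<partial>lborel)"
      using c x by (simp add: circle_int_def rot_def mult.commute)
    also have "\<dots> = (\<integral>a\<in>{0..2*pi}. \<rho> (rot a (?r, 0)) * ?r \<partial>lborel)"
      unfolding set_lebesgue_integral_def using ae'
      by (intro integral_cong_AE) auto
    \<comment> \<open>Dropping the null endpoint \<open>2 * pi\<close> turns the closed window of
      \<open>circle_int\<close> into the half-open one for which periods fit together
      exactly.\<close>
    also have "\<dots> = (\<integral>a\<in>{0..<2*pi}. \<rho> (rot a (?r, 0)) * ?r \<partial>lborel)"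
      unfolding set_lebesgue_integral_def using AE_lborel_singleton[of "2 * pi"]
      by (intro integral_cong_AE) (auto simp: indicator_def elim!: eventually_mono)
    also have "\<dots> = ?r * (\<integral>a\<in>{0..<2*pi}. \<rho> (rot a (?r, 0)) \<partial>lborel)"
      by simp
    finally have z: "(\<integral>a\<in>{0..<2*pi}. \<rho> (rot a (?r, 0)) \<partial>lborel) = 0"
      using x by simp
    have "(\<integral>a\<in>{0..<2*pi}. \<rho> (rot a x) \<partial>lborel) = (\<integral>a. indicator {\<theta>..<\<theta>+2*pi} (\<theta> + 1 * a) *\<^sub>R \<rho> (rot (\<theta> + 1 * a) (?r, 0)) \<partial>lborel)"
      unfolding set_lebesgue_integral_def
      by (subst \<theta>) (auto intro!: Bochner_Integration.integral_cong simp: indicator_def rot_rot add.commute)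
    also have "\<dots> = (\<integral>a\<in>{\<theta>..<\<theta>+2*pi}. \<rho> (rot a (?r, 0)) \<partial>lborel)"
      unfolding set_lebesgue_integral_def by (subst lborel_integral_real_affine[where c=1 and t=\<theta>]) auto
    also have "\<dots> = (\<integral>a\<in>{0..<2*pi}. \<rho> (rot a (?r, 0)) \<partial>lborel)"
      by (intro set_integral_periodic[where C=C]) (auto simp: rot_periodic b)
    finally show "(\<integral>a\<in>{0..<2*pi}. \<rho> (rot a x) \<partial>lborel) = 0" using z by simp
  qed
qed

section \<open>Continuity of dilations in the mean\<close>

lemma nn_integral_affine:
  fixes f :: "real \<times> real \<Rightarrow> ennreal"
  assumes [measurable]: "f \<in> borel_measurable borel" and c: "c > 0"
  shows "(\<integral>\<^sup>+x. f x \<partial>lborel) = ennreal (c\<^sup>2) * (\<integral>\<^sup>+x. f (z + c *\<^sub>R x) \<partial>lborel)"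
proof -
  have "c \<noteq> 0" using c by simp
  show ?thesis
    by (subst lborel_affine[OF \<open>c \<noteq> 0\<close>, of z])
       (use c in \<open>simp add: nn_integral_density nn_integral_distr nn_integral_cmult power2_eq_square\<close>)
qed

lemma integrable_affine:
  fixes f :: "real \<times> real \<Rightarrow> 'a :: {banach, second_countable_topology}"
  assumes f: "integrable lborel f" and c: "c > 0"
  shows "integrable lborel (\<lambda>x. f (z + c *\<^sub>R x))"
proof -
  have [measurable]: "f \<in> borel_measurable borel" using f by simp
  have "(\<integral>\<^sup>+x. norm (f x) \<partial>lborel) < \<infinity>" using f by (simp add: integrable_iff_bounded)
  then have "(\<integral>\<^sup>+x. norm (f (z + c *\<^sub>R x)) \<partial>lborel) < \<infinity>"
    using c by (subst (asm) nn_integral_affine[of _ c z]) (auto simp: ennreal_mult_less_top)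
  then show ?thesis by (simp add: integrable_iff_bounded)
qed

lemma integral_affine:
  fixes f :: "real \<times> real \<Rightarrow> real"
  assumes f: "integrable lborel f" and c: "c > 0"
  shows "(\<integral>x. f x \<partial>lborel) = c\<^sup>2 * (\<integral>x. f (z + c *\<^sub>R x) \<partial>lborel)"
proof -
  have [measurable]: "f \<in> borel_measurable borel" using f by simp
  have "c \<noteq> 0" using c by simp
  show ?thesis
    by (subst lborel_affine[OF \<open>c \<noteq> 0\<close>, of z])
       (use c in \<open>simp add: integral_density integral_distr power2_eq_square\<close>)
qed

text \<open>Continuous functions that converge to \<open>f\<close> almost everywhere come without a
  dominating function. Truncating them at height \<open>C\<close> keeps them continuous and supplies
  one on the ball; truncating \<open>f\<close> itself costs at most \<open>e / 2\<close> for large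
  \<open>C\<close>.\<close>

lemma L1_approx_continuous:
  fixes f :: "'a::euclidean_space \<Rightarrow> real"
  assumes f: "integrable lborel f" and e: "e > 0"
  obtains g where "continuous_on UNIV g" "(\<integral>x\<in>cball 0 R. \<bar>f x - g x\<bar> \<partial>lborel) \<le> e"
proof -
  have [measurable]: "f \<in> borel_measurable borel" using f by simp
  define T where "T C y = max (- C) (min C y)" for C y :: real
  have T: "\<bar>T C y\<bar> \<le> C" "\<bar>T C y\<bar> \<le> \<bar>y\<bar>" if "C \<ge> 0" for C y
    using that by (auto simp: T_def)
  have T_id: "T C y = y" if "\<bar>y\<bar> \<le> C" for C y
    using that by (auto simp: T_def)
  have T_cont: "continuous_on UNIV (T C)" for C
    unfolding T_def by (intro continuous_intros)
  have [measurable]: "T C \<in> borel_measurable borel" for C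
    by (rule borel_measurable_continuous_onI[OF T_cont])
  have "(\<lambda>n. \<integral>x. \<bar>f x - T (real n) (f x)\<bar> \<partial>lborel) \<longlonglongrightarrow> (\<integral>x. 0 \<partial>(lborel :: 'a measure))"
  proof (rule integral_dominated_convergence[where w="\<lambda>x. 2 * \<bar>f x\<bar>"])
    show "AE x in lborel. (\<lambda>n. \<bar>f x - T (real n) (f x)\<bar>) \<longlonglongrightarrow> 0"
    proof (rule AE_I2)
      fix x
      have "\<forall>\<^sub>F n in sequentially. \<bar>f x - T (real n) (f x)\<bar> = 0"
        using eventually_ge_at_top[of "nat \<lceil>\<bar>f x\<bar>\<rceil>"]
      proof eventually_elim
        case (elim n)
        then have "\<bar>f x\<bar> \<le> real n" by linarith
        then show ?case by (simp add: T_id)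
      qed
      then show "(\<lambda>n. \<bar>f x - T (real n) (f x)\<bar>) \<longlonglongrightarrow> 0"
        by (rule tendsto_eventually)
    qed
    show "AE x in lborel. norm \<bar>f x - T (real n) (f x)\<bar> \<le> 2 * \<bar>f x\<bar>" for n
    proof (rule AE_I2)
      fix x show "norm \<bar>f x - T (real n) (f x)\<bar> \<le> 2 * \<bar>f x\<bar>"
        using T(2)[of "real n" "f x"] by auto
    qed
  qed (use f in auto)
  then have "\<forall>\<^sub>F n in sequentially. (\<integral>x. \<bar>f x - T (real n) (f x)\<bar> \<partial>lborel) < e / 2"
    using e by (intro order_tendstoD) auto
  then obtain N where N: "(\<integral>x. \<bar>f x - T (real N) (f x)\<bar> \<partial>lborel) < e / 2"
    by (auto simp: eventually_sequentially)
  define C where "C = real N"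
  have C: "C \<ge> 0" by (simp add: C_def)
  \<comment> \<open>The detour through \<open>measurable_on\<close> provides the approximants: it is
    defined by almost everywhere convergence of continuous functions.\<close>
  have "f \<in> borel_measurable lebesgue"
    by (simp add: measurable_completion)
  then have "f measurable_on UNIV"
    by (simp add: measurable_on_iff_borel_measurable)
  then obtain M g where neg: "negligible M" and gc: "\<And>n. continuous_on UNIV (g n)"
    and gl: "\<And>x. x \<notin> M \<Longrightarrow> (\<lambda>n. g n x) \<longlonglongrightarrow> f x"
    by (auto simp: measurable_on_def)
  have Tg: "continuous_on UNIV (\<lambda>x. T C (g n x))" for n
    unfolding T_def by (intro continuous_intros gc)
  have [measurable]: "(\<lambda>x. T C (g n x)) \<in> borel_measurable borel" for n
    by (rule borel_measurable_continuous_onI[OF Tg])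
  have [measurable]: "cball (0::'a) R \<in> sets borel" by simp
  have fb: "emeasure lborel (cball (0::'a) R) < \<infinity>"
    by (rule emeasure_bounded_finite) simp
  have "AE x in lebesgue. x \<notin> M"
    using neg by (simp add: negligible_iff_null_sets AE_not_in)
  then have "AE x in lebesgue. (\<lambda>n. g n x) \<longlonglongrightarrow> f x"
    by eventually_elim (rule gl)
  then have ae: "AE x in lborel. (\<lambda>n. g n x) \<longlonglongrightarrow> f x"
    by (simp add: AE_completion_iff)
  have "(\<lambda>n. \<integral>x. indicator (cball 0 R) x *\<^sub>R \<bar>T C (f x) - T C (g n x)\<bar> \<partial>lborel) \<longlonglongrightarrow> (\<integral>x. 0 \<partial>(lborel :: 'a measure))"
  proof (rule integral_dominated_convergence[where w="\<lambda>x. 2 * C * indicator (cball 0 R) x"])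
    show "AE x in lborel. (\<lambda>n. indicat_real (cball 0 R) x *\<^sub>R \<bar>T C (f x) - T C (g n x)\<bar>) \<longlonglongrightarrow> 0"
      using ae
    proof eventually_elim
      case (elim x)
      have "(\<lambda>n. T C (g n x)) \<longlonglongrightarrow> T C (f x)"
        unfolding T_def by (intro tendsto_intros elim)
      then have "(\<lambda>n. indicat_real (cball 0 R) x *\<^sub>R \<bar>T C (f x) - T C (g n x)\<bar>) \<longlonglongrightarrow>
          indicat_real (cball 0 R) x *\<^sub>R \<bar>T C (f x) - T C (f x)\<bar>"
        by (intro tendsto_intros)
      then show ?case by simp
    qed
    show "AE x in lborel. norm (indicat_real (cball 0 R) x *\<^sub>R \<bar>T C (f x) - T C (g n x)\<bar>) \<le> 2 * C * indicator (cball 0 R) x" for n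
    proof (rule AE_I2)
      fix x
      show "norm (indicat_real (cball 0 R) x *\<^sub>R \<bar>T C (f x) - T C (g n x)\<bar>) \<le> 2 * C * indicator (cball 0 R) x"
        using T(1)[OF C, of "f x"] T(1)[OF C, of "g n x"] by (auto simp: indicator_def)
    qed
    show "integrable lborel (\<lambda>x. 2 * C * indicat_real (cball (0::'a) R) x)"
      using fb by (intro integrable_mult_right) (auto simp: integrable_indicator_iff)
    show "(\<lambda>x. indicator (cball 0 R) x *\<^sub>R \<bar>T C (f x) - T C (g n x)\<bar>) \<in> borel_measurable lborel" for n
      by measurable
  qed simp
  then have "\<forall>\<^sub>F n in sequentially. (\<integral>x\<in>cball 0 R. \<bar>T C (f x) - T C (g n x)\<bar> \<partial>lborel) < e / 2"
    unfolding set_lebesgue_integral_def using e by (intro order_tendstoD) auto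
  then obtain n where n: "(\<integral>x\<in>cball 0 R. \<bar>T C (f x) - T C (g n x)\<bar> \<partial>lborel) < e / 2"
    by (auto simp: eventually_sequentially)
  have i1: "integrable lborel (\<lambda>x. \<bar>f x - T C (f x)\<bar>)"
    by (rule Bochner_Integration.integrable_bound[where f="\<lambda>x. 2 * \<bar>f x\<bar>"])
       (use f T(2)[OF C] in \<open>auto intro!: AE_I2 order_trans[OF abs_triangle_ineq4]\<close>)
  have i1': "set_integrable lborel (cball 0 R) (\<lambda>x. \<bar>f x - T C (f x)\<bar>)"
    unfolding set_integrable_def using integrable_mult_indicator[OF _ i1, of "cball 0 R"] by simp
  have i2: "set_integrable lborel (cball 0 R) (\<lambda>x. \<bar>T C (f x) - T C (g n x)\<bar>)"
  proof (intro integrable_bounded_on[where C="C + C"])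
    show "\<bar>\<bar>T C (f x) - T C (g n x)\<bar>\<bar> \<le> C + C" for x
      using T(1)[OF C, of "f x"] T(1)[OF C, of "g n x"] by auto
  qed auto
  have i3: "set_integrable lborel (cball 0 R) f"
    unfolding set_integrable_def using integrable_mult_indicator[OF _ f, of "cball 0 R"] by simp
  have i4: "set_integrable lborel (cball 0 R) (\<lambda>x. T C (g n x))"
    using T(1)[OF C] by (intro integrable_bounded_on[where C="C"]) auto
  have "(\<integral>x\<in>cball 0 R. \<bar>f x - T C (g n x)\<bar> \<partial>lborel) \<le> (\<integral>x\<in>cball 0 R. \<bar>f x - T C (f x)\<bar> + \<bar>T C (f x) - T C (g n x)\<bar> \<partial>lborel)"
    by (rule set_integral_mono) (use i1' i2 i3 i4 in \<open>auto intro!: set_integrable_abs set_integral_diff set_integral_add\<close>)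
  also have "\<dots> = (\<integral>x\<in>cball 0 R. \<bar>f x - T C (f x)\<bar> \<partial>lborel) + (\<integral>x\<in>cball 0 R. \<bar>T C (f x) - T C (g n x)\<bar> \<partial>lborel)"
    using i1' i2 by (rule set_integral_add)
  also have "(\<integral>x\<in>cball 0 R. \<bar>f x - T C (f x)\<bar> \<partial>lborel) \<le> (\<integral>x. \<bar>f x - T C (f x)\<bar> \<partial>lborel)"
    unfolding set_lebesgue_integral_def
    by (rule integral_mono) (use i1 i1' in \<open>auto simp: set_integrable_def indicator_def\<close>)
  finally have "(\<integral>x\<in>cball 0 R. \<bar>f x - T C (g n x)\<bar> \<partial>lborel) \<le> e"
    using N n by (simp add: C_def)
  with Tg show ?thesis using that by blast
qed

text \<open>One \<open>d\<close> covers dilations and translations together, because the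
  mollification is later read at a contracted point and so involves both at once. The proof compares
  with a uniformly continuous \<open>g\<close>.\<close>

lemma L1_continuous_affine:
  fixes f :: "real \<times> real \<Rightarrow> real"
  assumes f: "integrable lborel f" and supp: "\<And>x. norm x > 1 \<Longrightarrow> f x = 0" and e: "e > 0"
  obtains d where "d > 0" "d \<le> 1/2"
    "\<And>c z. 1 - d \<le> c \<Longrightarrow> c \<le> 1 \<Longrightarrow> norm z \<le> d \<Longrightarrow> (\<integral>x. \<bar>f (z + c *\<^sub>R x) - f x\<bar> \<partial>lborel) \<le> e"
proof -
  have [measurable]: "f \<in> borel_measurable borel" using f by simp
  let ?K = "cball (0::real \<times> real)"
  \<comment> \<open>The budget is \<open>e/10\<close> for replacing \<open>f\<close> by
    \<open>g\<close> at \<open>x\<close>, at most \<open>4 * (e/10)\<close> for the same at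
    \<open>?a x\<close> (since \<open>c\<^sup>2 \<ge> 1/4\<close>), and \<open>e/2\<close> for the
    oscillation of \<open>g\<close>, spread over the area \<open>V\<close>.\<close>
  obtain g where gc: "continuous_on UNIV g" and g: "(\<integral>x\<in>?K 5. \<bar>f x - g x\<bar> \<partial>lborel) \<le> e / 10"
    using L1_approx_continuous[OF f, of "e/10"] e by auto
  have [measurable]: "g \<in> borel_measurable borel"
    by (rule borel_measurable_continuous_onI[OF gc])
  define V where "V = measure lborel (?K 4)"
  have V: "V > 0" by (simp add: V_def)
  have "uniformly_continuous_on (?K 5) g"
    by (rule compact_uniformly_continuous[OF continuous_on_subset[OF gc]]) auto
  then obtain \<delta> where \<delta>: "\<delta> > 0" "\<And>x y. x \<in> ?K 5 \<Longrightarrow> y \<in> ?K 5 \<Longrightarrow> dist y x < \<delta> \<Longrightarrow> dist (g y) (g x) < e / (2 * V)"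
    by (rule uniformly_continuous_onE[where \<epsilon>="e / (2 * V)"]) (use e V in auto)
  \<comment> \<open>On \<open>?K 4\<close> the displacement is at most
    \<open>norm z + (1 - c) * 4\<close>, hence at most \<open>5 * d\<close>.\<close>
  define d where "d = min (1/2) (\<delta> / 10)"
  have "d > 0" "d \<le> 1/2" using \<delta> by (auto simp: d_def)
  moreover have "(\<integral>x. \<bar>f (z + c *\<^sub>R x) - f x\<bar> \<partial>lborel) \<le> e" if c: "1 - d \<le> c" "c \<le> 1" and z: "norm z \<le> d" for c z
  proof -
    have c2: "c \<ge> 1/2" "c > 0" using c \<open>d \<le> 1/2\<close> by auto
    let ?a = "\<lambda>x. z + c *\<^sub>R x"
    \<comment> \<open>Outside radius 4 the image has norm above \<open>2 - 1/2\<close>, so both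
      values of \<open>f\<close> vanish; inside radius 4 the image stays within radius 5.\<close>
    have big: "f (?a x) = 0" "f x = 0" if "x \<notin> ?K 4" for x
    proof -
      have nx: "norm x > 4" using that by simp
      have "norm (c *\<^sub>R x) \<le> norm (?a x) + norm z" using norm_triangle_ineq4[of "?a x" z] by simp
      moreover have "norm (c *\<^sub>R x) \<ge> 2" using c2 nx mult_mono[of "1/2" c 4 "norm x"] by simp
      ultimately show "f (?a x) = 0" using z \<open>d \<le> 1/2\<close> by (intro supp) linarith
      show "f x = 0" using nx by (intro supp) simp
    qed
    have in5: "?a x \<in> ?K 5" and near: "dist (?a x) x < \<delta>" if "x \<in> ?K 4" for x
    proof -
      have "norm (c *\<^sub>R x) \<le> 1 * 4" unfolding norm_scaleR using that c c2 by (intro mult_mono) auto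
      then show "?a x \<in> ?K 5" using z \<open>d \<le> 1/2\<close> norm_triangle_ineq[of z "c *\<^sub>R x"] by simp
      have "?a x - x = z - (1 - c) *\<^sub>R x" by (simp add: algebra_simps)
      then have "norm (?a x - x) \<le> norm z + norm ((1 - c) *\<^sub>R x)" by (metis norm_triangle_ineq4)
      also have "norm ((1 - c) *\<^sub>R x) \<le> d * 4" unfolding norm_scaleR using that c by (intro mult_mono) auto
      finally have "norm (?a x - x) \<le> 5 * d" using z by simp
      also have "\<dots> < \<delta>" using \<delta>(1) by (simp add: d_def min_def)
      finally show "dist (?a x) x < \<delta>" by (simp add: dist_norm)
    qed
    let ?h = "\<lambda>x. indicator (?K 5) x *\<^sub>R \<bar>f x - g x\<bar>"
    have hi: "integrable lborel ?h"
    proof -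
      have "set_integrable lborel (?K 5) f"
        unfolding set_integrable_def using integrable_mult_indicator[OF _ f, of "?K 5"] by simp
      moreover have "set_integrable lborel (?K 5) g"
        unfolding set_integrable_def
        by (rule borel_integrable_compact) (auto intro: continuous_on_subset[OF gc])
      ultimately have "set_integrable lborel (?K 5) (\<lambda>x. \<bar>f x - g x\<bar>)"
        by (intro set_integrable_abs set_integral_diff)
      then show ?thesis by (simp add: set_integrable_def)
    qed
    have hle: "(\<integral>x. ?h x \<partial>lborel) \<le> e / 10" using g by (simp add: set_lebesgue_integral_def)
    have hai: "integrable lborel (\<lambda>x. ?h (?a x))"
      by (rule integrable_affine[OF hi c2(2)])
    have "(\<integral>x. ?h x \<partial>lborel) = c\<^sup>2 * (\<integral>x. ?h (?a x) \<partial>lborel)"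
      by (rule integral_affine[OF hi c2(2)])
    moreover have "c\<^sup>2 \<ge> 1/4" using c2 power_mono[of "1/2" c 2] by (simp add: power2_eq_square)
    moreover have "(\<integral>x. ?h (?a x) \<partial>lborel) \<ge> 0" by (intro integral_nonneg_AE) auto
    ultimately have hale: "(\<integral>x. ?h (?a x) \<partial>lborel) \<le> 4 * (e / 10)"
      using hle mult_right_mono[of "1/4" "c\<^sup>2" "\<integral>x. ?h (?a x) \<partial>lborel"] by linarith
    have ki: "integrable lborel (\<lambda>x. indicator (?K 4) x * (e / (2 * V)))"
      using emeasure_bounded_finite[of "?K 4"] by (intro integrable_mult_left) (auto simp: integrable_indicator_iff)
    have "(\<integral>x. \<bar>f (?a x) - f x\<bar> \<partial>lborel) \<le> (\<integral>x. (?h (?a x) + ?h x) + indicator (?K 4) x * (e / (2 * V)) \<partial>lborel)"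
    proof (rule integral_mono)
      show "integrable lborel (\<lambda>x. \<bar>f (?a x) - f x\<bar>)"
        using f integrable_affine[OF f c2(2)] by (intro integrable_abs Bochner_Integration.integrable_diff)
      show "integrable lborel (\<lambda>x. (?h (?a x) + ?h x) + indicator (?K 4) x * (e / (2 * V)))"
        using hi hai ki by (intro Bochner_Integration.integrable_add)
      show "\<bar>f (?a x) - f x\<bar> \<le> (?h (?a x) + ?h x) + indicator (?K 4) x * (e / (2 * V))" for x
      proof (cases "x \<in> ?K 4")
        case True
        then have 1: "x \<in> ?K 5" by simp
        from True have 2: "?a x \<in> ?K 5" by (rule in5)
        have "\<bar>g (?a x) - g x\<bar> \<le> e / (2 * V)"
          using \<delta>(2)[OF 1 2 near[OF True]] by (simp add: dist_real_def)
        then show ?thesis using True 1 2 by (simp add: indicator_def del: mem_cball mem_cball_0)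
      next
        case False
        then show ?thesis using big[OF False] by simp
      qed
    qed
    also have "\<dots> = (\<integral>x. ?h (?a x) \<partial>lborel) + (\<integral>x. ?h x \<partial>lborel) + (\<integral>x. indicator (?K 4) x * (e / (2 * V)) \<partial>lborel)"
      using hi hai ki by simp
    also have "(\<integral>x. indicator (?K 4) x * (e / (2 * V)) \<partial>lborel) = e / 2"
      using V by (simp add: V_def)
    finally show ?thesis using hle hale by simp
  qed
  ultimately show ?thesis using that by blast
qed

section \<open>Uniform weak mixing\<close>

lemma sets_borel_balls [measurable]:
  fixes x :: "'a::euclidean_space"
  shows "ball x r \<in> sets borel" "cball x r \<in> sets borel"
  by auto

text \<open>Expanding \<open>(\<bar>f x\<bar> - 2 * \<eta> * \<bar>g x\<bar>)\<^sup>2 \<ge>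
  0\<close> gives it pointwise. Compared with Cauchy-Schwarz, the result is linear in both square
  integrals, and the free \<open>\<eta>\<close> can be fixed once, before the test function.\<close>

lemma integral_mult_Young:
  fixes f g :: "'a \<Rightarrow> real"
  assumes [measurable]: "f \<in> borel_measurable M" "g \<in> borel_measurable M"
    and f2: "integrable M (\<lambda>x. (f x)\<^sup>2)" and g2: "integrable M (\<lambda>x. (g x)\<^sup>2)" and \<eta>: "\<eta> > 0"
  shows "integrable M (\<lambda>x. f x * g x)"
    and "(\<integral>x. \<bar>f x * g x\<bar> \<partial>M) \<le> (\<integral>x. (f x)\<^sup>2 \<partial>M) / (4 * \<eta>) + \<eta> * (\<integral>x. (g x)\<^sup>2 \<partial>M)"
    and "\<bar>\<integral>x. f x * g x \<partial>M\<bar> \<le> (\<integral>x. (f x)\<^sup>2 \<partial>M) / (4 * \<eta>) + \<eta> * (\<integral>x. (g x)\<^sup>2 \<partial>M)"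
proof -
  have le: "\<bar>f x * g x\<bar> \<le> (f x)\<^sup>2 / (4 * \<eta>) + \<eta> * (g x)\<^sup>2" for x
  proof -
    have "0 \<le> (\<bar>f x\<bar> - 2 * \<eta> * \<bar>g x\<bar>)\<^sup>2" by simp
    also have "\<dots> = (f x)\<^sup>2 - 4 * \<eta> * \<bar>f x * g x\<bar> + 4 * \<eta>\<^sup>2 * (g x)\<^sup>2"
      by (simp add: power2_diff abs_mult power_mult_distrib)
    finally have "4 * \<eta> * \<bar>f x * g x\<bar> \<le> (f x)\<^sup>2 + 4 * \<eta>\<^sup>2 * (g x)\<^sup>2" by simp
    then show ?thesis using \<eta> by (simp add: field_simps power2_eq_square)
  qed
  have i: "integrable M (\<lambda>x. (f x)\<^sup>2 / (4 * \<eta>) + \<eta> * (g x)\<^sup>2)"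
    using f2 g2 by simp
  show fg: "integrable M (\<lambda>x. f x * g x)"
    by (rule Bochner_Integration.integrable_bound[OF i]) (auto intro!: AE_I2 order_trans[OF le])
  have "(\<integral>x. \<bar>f x * g x\<bar> \<partial>M) \<le> (\<integral>x. (f x)\<^sup>2 / (4 * \<eta>) + \<eta> * (g x)\<^sup>2 \<partial>M)"
    by (rule integral_mono) (use fg i le in auto)
  also have "\<dots> = (\<integral>x. (f x)\<^sup>2 \<partial>M) / (4 * \<eta>) + \<eta> * (\<integral>x. (g x)\<^sup>2 \<partial>M)"
    using f2 g2 by simp
  finally show *: "(\<integral>x. \<bar>f x * g x\<bar> \<partial>M) \<le> (\<integral>x. (f x)\<^sup>2 \<partial>M) / (4 * \<eta>) + \<eta> * (\<integral>x. (g x)\<^sup>2 \<partial>M)" .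
  show "\<bar>\<integral>x. f x * g x \<partial>M\<bar> \<le> (\<integral>x. (f x)\<^sup>2 \<partial>M) / (4 * \<eta>) + \<eta> * (\<integral>x. (g x)\<^sup>2 \<partial>M)"
    by (rule order_trans[OF integral_abs_bound *])
qed

lemma measure_disk: "r \<ge> 0 \<Longrightarrow> measure lborel (ball (x::real \<times> real) r) = pi * r\<^sup>2"
  by (simp add: content_ball unit_ball_vol_2 power2_eq_square)

lemma integrable_indicator_bounded:
  fixes A :: "'a::euclidean_space set"
  assumes "A \<in> sets borel" "bounded A"
  shows "integrable lborel (indicat_real A)"
  using assms emeasure_bounded_finite[OF assms(2)] by (simp add: integrable_indicator_iff)

lemma integrable_bounded_support:
  fixes f :: "'a::euclidean_space \<Rightarrow> real"
  assumes [measurable]: "f \<in> borel_measurable borel" and b: "\<And>x. \<bar>f x\<bar> \<le> C"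
    and supp: "\<And>x. norm x > R \<Longrightarrow> f x = 0"
  shows "integrable lborel f"
proof (rule Bochner_Integration.integrable_bound)
  show "integrable lborel (\<lambda>x. C * indicator (cball (0::'a) R) x)"
    by (intro integrable_mult_right integrable_indicator_bounded) auto
  show "AE x in lborel. norm (f x) \<le> norm (C * indicator (cball (0::'a) R) x)"
  proof (rule AE_I2)
    fix x show "norm (f x) \<le> norm (C * indicator (cball (0::'a) R) x)"
      using b[of x] supp[of x] by (cases "norm x > R") auto
  qed
qed simp

text \<open>The comparison with the dilate runs over the open disk only, because a function cut off
  at the unit circle may jump there. The bound \<open>1/2 \<le> c\<close> keeps the Jacobians
  \<open>c\<^sup>2\<close> away from 0.\<close>

definition dilation_regular :: "real \<Rightarrow> (real \<times> real \<Rightarrow> real) \<Rightarrow> bool" where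
  "dilation_regular K \<zeta> \<longleftrightarrow> \<zeta> \<in> borel_measurable borel \<and> (\<forall>x. norm x \<ge> 1 \<longrightarrow> \<zeta> x = 0)
     \<and> integrable lborel (\<lambda>x. (\<zeta> x)\<^sup>2) \<and> (\<integral>x. (\<zeta> x)\<^sup>2 \<partial>lborel) \<le> K
     \<and> (\<forall>c. 1/2 \<le> c \<longrightarrow> c \<le> 1 \<longrightarrow> (\<integral>x\<in>ball 0 1. \<bar>\<zeta> (c *\<^sub>R x) - \<zeta> x\<bar> \<partial>lborel) \<le> K * (1 - c))"

text \<open>The weight \<open>c\<^sup>2\<close> is the Jacobian that appears when a pairing is
  rescaled by \<open>c\<close>.\<close>

lemma dilation_L1_small:
  fixes \<rho> :: "real \<times> real \<Rightarrow> real"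
  assumes i: "integrable lborel \<rho>" and supp: "\<And>x. norm x > 1 \<Longrightarrow> \<rho> x = 0" and e: "e > 0"
  obtains d where "d > 0" "d \<le> 1/2"
    "\<And>c. 1 - d \<le> c \<Longrightarrow> c \<le> 1 \<Longrightarrow> (\<integral>x. \<bar>c\<^sup>2 * \<rho> (c *\<^sub>R x) - \<rho> x\<bar> \<partial>lborel) \<le> e"
proof -
  define N where "N = (\<integral>x. \<bar>\<rho> x\<bar> \<partial>lborel)"
  have N: "N \<ge> 0" by (simp add: N_def)
  obtain d where d: "d > 0" "d \<le> 1/2"
    "\<And>c z. 1 - d \<le> c \<Longrightarrow> c \<le> 1 \<Longrightarrow> norm z \<le> d \<Longrightarrow> (\<integral>x. \<bar>\<rho> (z + c *\<^sub>R x) - \<rho> x\<bar> \<partial>lborel) \<le> e / 2"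
    using L1_continuous_affine[OF i supp, of "e/2"] e by auto
  \<comment> \<open>The weight adds an error of at most \<open>(1 - c\<^sup>2) * (4 * N)\<close>,
    hence at most \<open>8 * d' * N\<close>; the denominator makes this at most
    \<open>e / 2\<close>, and the 1 in it covers \<open>N = 0\<close>.\<close>
  define d' where "d' = min d (e / (16 * (N + 1)))"
  have "d' > 0" "d' \<le> 1/2" using d(1,2) e N min.cobounded1[of d "e / (16 * (N + 1))"] by (auto simp: d'_def simp del: min.cobounded1)
  moreover have "(\<integral>x. \<bar>c\<^sup>2 * \<rho> (c *\<^sub>R x) - \<rho> x\<bar> \<partial>lborel) \<le> e" if c: "1 - d' \<le> c" "c \<le> 1" for c
  proof -
    have c2: "c \<ge> 1/2" using c \<open>d' \<le> 1/2\<close> by linarith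
    have i': "integrable lborel (\<lambda>x. \<rho> (c *\<^sub>R x))"
      using integrable_affine[OF i, of c 0] c2 by simp
    have sq: "c\<^sup>2 \<le> 1" "c\<^sup>2 \<ge> 1/4" "1 - c\<^sup>2 \<le> 2 * d'"
    proof -
      show "c\<^sup>2 \<le> 1" using c c2 by (simp add: power_le_one)
      show "c\<^sup>2 \<ge> 1/4" using c2 power_mono[of "1/2" c 2] by (simp add: power2_eq_square)
      have "1 - c\<^sup>2 = (1 - c) * (1 + c)" by (simp add: power2_eq_square algebra_simps)
      also have "\<dots> \<le> d' * 2" using c c2 \<open>d' > 0\<close> by (intro mult_mono) auto
      finally show "1 - c\<^sup>2 \<le> 2 * d'" by simp
    qed
    have "N = c\<^sup>2 * (\<integral>x. \<bar>\<rho> (c *\<^sub>R x)\<bar> \<partial>lborel)"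
      using integral_affine[of "\<lambda>x. \<bar>\<rho> x\<bar>" c 0] i c2 by (simp add: N_def)
    moreover have "1/4 * (\<integral>x. \<bar>\<rho> (c *\<^sub>R x)\<bar> \<partial>lborel) \<le> c\<^sup>2 * (\<integral>x. \<bar>\<rho> (c *\<^sub>R x)\<bar> \<partial>lborel)"
      using sq(2) by (intro mult_right_mono) auto
    ultimately have Nc: "(\<integral>x. \<bar>\<rho> (c *\<^sub>R x)\<bar> \<partial>lborel) \<le> 4 * N" by linarith
    have "(\<integral>x. \<bar>c\<^sup>2 * \<rho> (c *\<^sub>R x) - \<rho> x\<bar> \<partial>lborel) \<le> (\<integral>x. \<bar>\<rho> (c *\<^sub>R x) - \<rho> x\<bar> + (1 - c\<^sup>2) * \<bar>\<rho> (c *\<^sub>R x)\<bar> \<partial>lborel)"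
    proof (rule integral_mono)
      show "\<bar>c\<^sup>2 * \<rho> (c *\<^sub>R x) - \<rho> x\<bar> \<le> \<bar>\<rho> (c *\<^sub>R x) - \<rho> x\<bar> + (1 - c\<^sup>2) * \<bar>\<rho> (c *\<^sub>R x)\<bar>" for x
      proof -
        have "c\<^sup>2 * \<rho> (c *\<^sub>R x) - \<rho> x = (\<rho> (c *\<^sub>R x) - \<rho> x) - (1 - c\<^sup>2) * \<rho> (c *\<^sub>R x)"
          by (simp add: algebra_simps)
        then have "\<bar>c\<^sup>2 * \<rho> (c *\<^sub>R x) - \<rho> x\<bar> \<le> \<bar>\<rho> (c *\<^sub>R x) - \<rho> x\<bar> + \<bar>(1 - c\<^sup>2) * \<rho> (c *\<^sub>R x)\<bar>"
          by (metis abs_triangle_ineq4)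
        then show ?thesis using sq(1) by (simp add: abs_mult)
      qed
    qed (use i i' in auto)
    also have "\<dots> = (\<integral>x. \<bar>\<rho> (c *\<^sub>R x) - \<rho> x\<bar> \<partial>lborel) + (1 - c\<^sup>2) * (\<integral>x. \<bar>\<rho> (c *\<^sub>R x)\<bar> \<partial>lborel)"
      using i i' by simp
    also have "\<dots> \<le> e / 2 + (2 * d') * (4 * N)"
      using d(3)[of c 0] c d'_def sq Nc N d(1) by (intro add_mono mult_mono) auto
    also have "(2 * d') * (4 * N) \<le> e / 2"
    proof -
      have "d' * (16 * (N + 1)) \<le> e" 
        using N min.cobounded2[of d "e / (16 * (N + 1))"] by (subst pos_le_divide_eq[symmetric]) (auto simp: d'_def)
      then show ?thesis using \<open>d' > 0\<close> by (simp add: algebra_simps)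
    qed
    finally show ?thesis by simp
  qed
  ultimately show ?thesis using that by blast
qed

text \<open>The angle is linear in the radius, so shrinking the radius by \<open>c\<close> acts like
  shrinking the time by \<open>c\<close>. This converts time shifts into dilations.\<close>

lemma twist_scaleR: "c \<ge> 0 \<Longrightarrow> twist t (c *\<^sub>R x) = c *\<^sub>R twist (t * c) x"
  by (simp add: twist_def rot_scaleR mult.assoc)

lemma integral_twist:
  fixes f :: "real \<times> real \<Rightarrow> real"
  assumes "f \<in> borel_measurable borel"
  shows "(\<integral>x. f (twist t x) \<partial>lborel) = (\<integral>x. f x \<partial>lborel)"
  using integral_distr[of "twist t" lborel borel f] assms by (simp add: distr_twist)

lemma integrable_twist:
  fixes f :: "real \<times> real \<Rightarrow> real"
  assumes "integrable lborel f"
  shows "integrable lborel (\<lambda>x. f (twist t x))"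
  using integrable_distr[of "twist t" lborel borel f] assms by (simp add: distr_twist)

text \<open>Substituting \<open>c *\<^sub>R x\<close> in the first pairing brings both to the same
  time \<open>t * c\<close>. Two defects remain: that of dilating \<open>\<zeta>\<close>, paired
  with the bounded \<open>\<rho>\<close>, and that of dilating \<open>\<rho>\<close>, called
  \<open>E\<close>, paired with \<open>\<zeta>\<close>.\<close>

lemma twist_pairing_slow_variation:
  fixes \<rho> \<zeta> :: "real \<times> real \<Rightarrow> real"
  assumes [measurable]: "\<rho> \<in> borel_measurable borel" and b: "\<And>x. \<bar>\<rho> x\<bar> \<le> C"
    and supp: "\<And>x. norm x > 1 \<Longrightarrow> \<rho> x = 0"
    and \<zeta>: "dilation_regular K \<zeta>" and \<eta>: "\<eta> > 0" and t: "t > 0" and c: "1/2 \<le> c" "c \<le> 1"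
  shows "\<bar>(\<integral>x. \<rho> (twist t x) * \<zeta> x \<partial>lborel) - (\<integral>x. \<rho> (twist (t * c) x) * \<zeta> x \<partial>lborel)\<bar>
    \<le> (C + 1) * K * \<eta> + C * K * (1 - c) + C * pi * (1 - c) / (2 * \<eta>)
       + C / (2 * \<eta>) * (\<integral>x. \<bar>c\<^sup>2 * \<rho> (c *\<^sub>R x) - \<rho> x\<bar> \<partial>lborel)"
proof -
  have [measurable]: "\<zeta> \<in> borel_measurable borel" and \<zeta>0: "\<And>x. norm x \<ge> 1 \<Longrightarrow> \<zeta> x = 0"
    and \<zeta>2: "integrable lborel (\<lambda>x. (\<zeta> x)\<^sup>2)" and \<zeta>K: "(\<integral>x. (\<zeta> x)\<^sup>2 \<partial>lborel) \<le> K"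
    and \<zeta>c: "(\<integral>x\<in>ball 0 1. \<bar>\<zeta> (c *\<^sub>R x) - \<zeta> x\<bar> \<partial>lborel) \<le> K * (1 - c)"
    using \<zeta> c unfolding dilation_regular_def by auto
  have C: "C \<ge> 0" using b[of 0] by linarith
  have K: "K \<ge> 0" using \<zeta>K by (rule order_trans[rotated]) simp
  have c0: "c > 0" "c \<ge> 0" using c by auto
  let ?B = "ball (0::real \<times> real) 1"
  define E where "E x = c\<^sup>2 * \<rho> (c *\<^sub>R x) - \<rho> x" for x
  have [measurable]: "E \<in> borel_measurable borel" unfolding E_def by measurable
  have csq: "c\<^sup>2 \<le> 1" using c by (simp add: power_le_one)
  have Eb: "\<bar>E x\<bar> \<le> 2 * C" for x
  proof -
    have "\<bar>c\<^sup>2 * \<rho> (c *\<^sub>R x)\<bar> \<le> 1 * C" unfolding abs_mult using csq b by (intro mult_mono) auto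
    then show ?thesis unfolding E_def using b[of x] by (intro order_trans[OF abs_triangle_ineq4]) auto
  qed
  have Esupp: "E x = 0" if "norm x > 2" for x
  proof -
    have "norm (c *\<^sub>R x) > 1" using that c mult_mono[of "1/2" c "norm x" "norm x"] by simp
    then show ?thesis using that by (simp add: E_def supp)
  qed
  have Ei: "integrable lborel E" by (rule integrable_bounded_support[OF _ Eb Esupp]) auto
  \<comment> \<open>Boundedness of \<open>E\<close> controls its square integral by its
    \<open>L^1\<close> norm, the only one known to be small.\<close>
  have E2le: "(E x)\<^sup>2 \<le> 2 * C * \<bar>E x\<bar>" for x
    using mult_right_mono[OF Eb[of x], of "\<bar>E x\<bar>"] by (simp add: power2_eq_square)
  have E2i: "integrable lborel (\<lambda>x. (E x)\<^sup>2)"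
    by (rule Bochner_Integration.integrable_bound[where f="\<lambda>x. 2 * C * \<bar>E x\<bar>"])
       (use Ei in \<open>auto intro!: AE_I2 order_trans[OF E2le]\<close>)
  have E2: "(\<integral>x. (E x)\<^sup>2 \<partial>lborel) \<le> 2 * C * (\<integral>x. \<bar>E x\<bar> \<partial>lborel)"
    using integral_mono[OF E2i, of "\<lambda>x. 2 * C * \<bar>E x\<bar>"] Ei E2le by simp
  have \<zeta>i: "integrable lborel \<zeta>"
  proof -
    have "integrable lborel (\<lambda>x. indicat_real ?B x * \<zeta> x)"
      by (rule integral_mult_Young(1)[of _ _ _ 1])
         (use \<zeta>2 integrable_indicator_bounded[of ?B] in \<open>auto simp: power2_eq_square simp flip: indicator_inter_arith\<close>)
    moreover have "(\<lambda>x. indicat_real ?B x * \<zeta> x) = \<zeta>"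
      using \<zeta>0 by (auto simp: fun_eq_iff indicator_def)
    ultimately show ?thesis by simp
  qed
  have prod_i: "integrable lborel (\<lambda>x. f x * g x)"
    if "integrable lborel g" "f \<in> borel_measurable borel" "\<And>x. \<bar>f x\<bar> \<le> D" for f g :: "real \<times> real \<Rightarrow> real" and D
  proof (rule Bochner_Integration.integrable_bound[where f="\<lambda>x. D * g x"])
    show "AE x in lborel. norm (f x * g x) \<le> norm (D * g x)"
      using that(3) by (auto intro!: AE_I2 mult_right_mono simp: abs_mult intro: order_trans[OF _ abs_ge_self])
  qed (use that in auto)
  let ?T = "twist (t * c)"
  have \<zeta>ci: "integrable lborel (\<lambda>x. \<zeta> (c *\<^sub>R x))"
    using integrable_affine[OF \<zeta>i, of c 0] c by simp
  have i1: "integrable lborel (\<lambda>x. \<rho> (twist t x) * \<zeta> x)" by (rule prod_i[OF \<zeta>i]) (auto intro: b)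
  have i2: "integrable lborel (\<lambda>x. \<rho> (?T x) * \<zeta> x)" by (rule prod_i[OF \<zeta>i]) (auto intro: b)
  have i3: "integrable lborel (\<lambda>x. \<rho> (c *\<^sub>R ?T x) * (\<zeta> (c *\<^sub>R x) - \<zeta> x))" 
    by (rule prod_i) (use \<zeta>i \<zeta>ci in \<open>auto intro: b\<close>)
  have i4: "integrable lborel (\<lambda>x. E (?T x) * \<zeta> x)" by (rule prod_i[OF \<zeta>i]) (auto intro: Eb)
  have "(\<integral>x. \<rho> (twist t x) * \<zeta> x \<partial>lborel) = c\<^sup>2 * (\<integral>x. \<rho> (twist t (c *\<^sub>R x)) * \<zeta> (c *\<^sub>R x) \<partial>lborel)"
    using integral_affine[OF i1, of c 0] c by simp
  also have "\<dots> = (\<integral>x. c\<^sup>2 * (\<rho> (c *\<^sub>R ?T x) * \<zeta> (c *\<^sub>R x)) \<partial>lborel)"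
    using c by (simp add: twist_scaleR)
  also have "\<dots> = (\<integral>x. c\<^sup>2 * (\<rho> (c *\<^sub>R ?T x) * (\<zeta> (c *\<^sub>R x) - \<zeta> x)) + E (?T x) * \<zeta> x + \<rho> (?T x) * \<zeta> x \<partial>lborel)"
    by (intro Bochner_Integration.integral_cong) (auto simp: E_def algebra_simps)
  also have "\<dots> = c\<^sup>2 * (\<integral>x. \<rho> (c *\<^sub>R ?T x) * (\<zeta> (c *\<^sub>R x) - \<zeta> x) \<partial>lborel) + (\<integral>x. E (?T x) * \<zeta> x \<partial>lborel)
      + (\<integral>x. \<rho> (?T x) * \<zeta> x \<partial>lborel)"
    using i2 i3 i4 by simp
  finally have split: "(\<integral>x. \<rho> (twist t x) * \<zeta> x \<partial>lborel) - (\<integral>x. \<rho> (?T x) * \<zeta> x \<partial>lborel)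
     = c\<^sup>2 * (\<integral>x. \<rho> (c *\<^sub>R ?T x) * (\<zeta> (c *\<^sub>R x) - \<zeta> x) \<partial>lborel) + (\<integral>x. E (?T x) * \<zeta> x \<partial>lborel)"
    by simp
  \<comment> \<open>The twist preserves measure, so it disappears from the square integral of
    \<open>E\<close>, and the bound does not depend on the time.\<close>
  have T2: "\<bar>\<integral>x. E (?T x) * \<zeta> x \<partial>lborel\<bar> \<le> C / (2 * \<eta>) * (\<integral>x. \<bar>E x\<bar> \<partial>lborel) + \<eta> * K"
  proof -
    have "\<bar>\<integral>x. E (?T x) * \<zeta> x \<partial>lborel\<bar> \<le> (\<integral>x. (E (?T x))\<^sup>2 \<partial>lborel) / (4 * \<eta>) + \<eta> * (\<integral>x. (\<zeta> x)\<^sup>2 \<partial>lborel)"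
      by (rule integral_mult_Young(3)) (use \<zeta>2 \<eta> integrable_twist[OF E2i] in auto)
    also have "(\<integral>x. (E (?T x))\<^sup>2 \<partial>lborel) = (\<integral>x. (E x)\<^sup>2 \<partial>lborel)"
      by (rule integral_twist) measurable
    also have "(\<integral>x. (E x)\<^sup>2 \<partial>lborel) / (4 * \<eta>) + \<eta> * (\<integral>x. (\<zeta> x)\<^sup>2 \<partial>lborel)
        \<le> 2 * C * (\<integral>x. \<bar>E x\<bar> \<partial>lborel) / (4 * \<eta>) + \<eta> * K"
      using E2 \<zeta>K \<eta> by (intro add_mono divide_right_mono mult_left_mono) auto
    finally show ?thesis by (simp add: field_simps)
  qed
  \<comment> \<open>Where \<open>1 \<le> norm x < 1/c\<close>, the dilate of \<open>\<zeta>\<close>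
    may be nonzero although \<open>\<zeta> x = 0\<close>. Scaled back this is the annulus
    \<open>?A\<close>, of area at most \<open>2 * pi * (1 - c)\<close>, on which only the square
    integral of \<open>\<zeta>\<close> is available.\<close>
  have ring: "c\<^sup>2 * (\<integral>x. indicator (- ?B) x * \<bar>\<zeta> (c *\<^sub>R x)\<bar> \<partial>lborel) \<le> pi * (1 - c) / (2 * \<eta>) + \<eta> * K"
  proof -
    let ?A = "?B - ball 0 c"
    have eq: "indicat_real ?A (c *\<^sub>R x) * \<zeta> (c *\<^sub>R x) = indicator (- ?B) x * \<zeta> (c *\<^sub>R x)" for x
      using c \<zeta>0[of "c *\<^sub>R x"] by (auto simp: indicator_def)
    have mA: "measure lborel ?A \<le> 2 * pi * (1 - c)"
    proof -
      have "measure lborel ?A = measure lborel ?B - measure lborel (ball (0::real \<times> real) c)"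
        using c emeasure_bounded_finite[of ?B] by (intro measure_Diff) (auto simp: top.not_eq_extremum)
      also have "\<dots> = pi * ((1 - c) * (1 + c))"
        using c by (simp add: measure_disk power2_eq_square algebra_simps)
      also have "\<dots> \<le> pi * ((1 - c) * 2)" using c by (intro mult_left_mono) auto
      finally show ?thesis by (simp add: algebra_simps)
    qed
    have Ai: "integrable lborel (indicat_real ?A)"
      by (rule integrable_indicator_bounded) (auto intro: bounded_subset[OF bounded_ball])
    have sq: "(indicat_real ?A x)\<^sup>2 = indicat_real ?A x" for x by (simp add: indicator_def)
    have "(\<integral>x. \<bar>indicat_real ?A x * \<zeta> x\<bar> \<partial>lborel) \<le> (\<integral>x. (indicat_real ?A x)\<^sup>2 \<partial>lborel) / (4 * \<eta>) + \<eta> * (\<integral>x. (\<zeta> x)\<^sup>2 \<partial>lborel)"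
      by (rule integral_mult_Young(2)) (use \<zeta>2 \<eta> Ai in \<open>auto simp: sq\<close>)
    also have "\<dots> \<le> (2 * pi * (1 - c)) / (4 * \<eta>) + \<eta> * K"
      unfolding sq using mA \<zeta>K \<eta> by (intro add_mono divide_right_mono mult_left_mono) auto
    also have "(2 * pi * (1 - c)) / (4 * \<eta>) = pi * (1 - c) / (2 * \<eta>)"
      using \<eta> by (simp add: divide_simps)
    finally have 1: "(\<integral>x. \<bar>indicat_real ?A x * \<zeta> x\<bar> \<partial>lborel) \<le> pi * (1 - c) / (2 * \<eta>) + \<eta> * K" .
    have ai: "integrable lborel (\<lambda>x. \<bar>indicat_real ?A x * \<zeta> x\<bar>)"
      using integrable_mult_indicator[OF _ \<zeta>i, of ?A] by (intro integrable_abs) simp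
    have "(\<integral>x. \<bar>indicat_real ?A x * \<zeta> x\<bar> \<partial>lborel) = c\<^sup>2 * (\<integral>x. \<bar>indicat_real ?A (c *\<^sub>R x) * \<zeta> (c *\<^sub>R x)\<bar> \<partial>lborel)"
      using integral_affine[OF ai, of c 0] c by simp
    then show ?thesis using 1 unfolding eq by (simp add: abs_mult)
  qed
  have T1: "\<bar>c\<^sup>2 * (\<integral>x. \<rho> (c *\<^sub>R ?T x) * (\<zeta> (c *\<^sub>R x) - \<zeta> x) \<partial>lborel)\<bar> \<le> C * (K * (1 - c)) + C * (pi * (1 - c) / (2 * \<eta>) + \<eta> * K)"
  proof -
    have bi: "integrable lborel (\<lambda>x. indicator ?B x * \<bar>\<zeta> (c *\<^sub>R x) - \<zeta> x\<bar>)"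
      using integrable_mult_indicator[of ?B lborel "\<lambda>x. \<bar>\<zeta> (c *\<^sub>R x) - \<zeta> x\<bar>"] \<zeta>i \<zeta>ci by simp
    have bo: "integrable lborel (\<lambda>x. indicator (- ?B) x * \<bar>\<zeta> (c *\<^sub>R x)\<bar>)"
      using integrable_mult_indicator[of "- ?B" lborel "\<lambda>x. \<bar>\<zeta> (c *\<^sub>R x)\<bar>"] \<zeta>ci by simp
    have "\<bar>\<integral>x. \<rho> (c *\<^sub>R ?T x) * (\<zeta> (c *\<^sub>R x) - \<zeta> x) \<partial>lborel\<bar> \<le> (\<integral>x. \<bar>\<rho> (c *\<^sub>R ?T x) * (\<zeta> (c *\<^sub>R x) - \<zeta> x)\<bar> \<partial>lborel)"
      by (rule integral_abs_bound)
    also have "\<dots> \<le> (\<integral>x. C * (indicator ?B x * \<bar>\<zeta> (c *\<^sub>R x) - \<zeta> x\<bar> + indicator (- ?B) x * \<bar>\<zeta> (c *\<^sub>R x)\<bar>) \<partial>lborel)"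
    proof (rule integral_mono)
      show "\<bar>\<rho> (c *\<^sub>R ?T x) * (\<zeta> (c *\<^sub>R x) - \<zeta> x)\<bar> \<le> C * (indicator ?B x * \<bar>\<zeta> (c *\<^sub>R x) - \<zeta> x\<bar> + indicator (- ?B) x * \<bar>\<zeta> (c *\<^sub>R x)\<bar>)" for x
        unfolding abs_mult using b[of "c *\<^sub>R ?T x"] \<zeta>0[of x] C
        by (intro mult_mono) (auto simp: indicator_def)
    qed (use i3 bi bo in auto)
    also have "\<dots> = C * (\<integral>x. indicator ?B x * \<bar>\<zeta> (c *\<^sub>R x) - \<zeta> x\<bar> \<partial>lborel) + C * (\<integral>x. indicator (- ?B) x * \<bar>\<zeta> (c *\<^sub>R x)\<bar> \<partial>lborel)"
      using bi bo by (simp add: algebra_simps)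
    finally have 1: "\<bar>\<integral>x. \<rho> (c *\<^sub>R ?T x) * (\<zeta> (c *\<^sub>R x) - \<zeta> x) \<partial>lborel\<bar> \<le> C * (\<integral>x. indicator ?B x * \<bar>\<zeta> (c *\<^sub>R x) - \<zeta> x\<bar> \<partial>lborel) + C * (\<integral>x. indicator (- ?B) x * \<bar>\<zeta> (c *\<^sub>R x)\<bar> \<partial>lborel)" (is "?X \<le> C * ?Y + C * ?Z") .
    have "\<bar>c\<^sup>2 * (\<integral>x. \<rho> (c *\<^sub>R ?T x) * (\<zeta> (c *\<^sub>R x) - \<zeta> x) \<partial>lborel)\<bar> = c\<^sup>2 * ?X" by (simp add: abs_mult)
    also have "\<dots> \<le> c\<^sup>2 * (C * ?Y + C * ?Z)" using 1 by (intro mult_left_mono) auto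
    also have "\<dots> = c\<^sup>2 * (C * ?Y) + C * (c\<^sup>2 * ?Z)" by (simp add: algebra_simps)
    also have "\<dots> \<le> 1 * (C * ?Y) + C * (pi * (1 - c) / (2 * \<eta>) + \<eta> * K)"
      using ring C csq by (intro add_mono mult_right_mono mult_left_mono) auto
    also have "?Y \<le> K * (1 - c)" using \<zeta>c by (simp add: set_lebesgue_integral_def)
    finally show ?thesis using C by (simp add: mult_left_mono)
  qed
  have "\<bar>c\<^sup>2 * (\<integral>x. \<rho> (c *\<^sub>R ?T x) * (\<zeta> (c *\<^sub>R x) - \<zeta> x) \<partial>lborel) + (\<integral>x. E (?T x) * \<zeta> x \<partial>lborel)\<bar>
     \<le> (C * (K * (1 - c)) + C * (pi * (1 - c) / (2 * \<eta>) + \<eta> * K)) + (C / (2 * \<eta>) * (\<integral>x. \<bar>E x\<bar> \<partial>lborel) + \<eta> * K)"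
    by (rule order_trans[OF abs_triangle_ineq add_mono[OF T1 T2]])
  then show ?thesis unfolding split by (simp add: E_def algebra_simps)
qed

lemma integrable_lborel_pair_dominated:
  fixes f :: "'a::euclidean_space \<times> 'b::euclidean_space \<Rightarrow> real"
  assumes [measurable]: "f \<in> borel_measurable (lborel \<Otimes>\<^sub>M lborel)"
    and u: "integrable lborel u" and v: "integrable lborel v"
    and le: "\<And>x y. \<bar>f (x, y)\<bar> \<le> u x * v y"
  shows "integrable (lborel \<Otimes>\<^sub>M lborel) f"
proof (rule lborel_pair.Fubini_integrable)
  have i: "integrable lborel (\<lambda>y. f (x, y))" for x
    by (rule Bochner_Integration.integrable_bound[where f="\<lambda>y. u x * v y"])
       (use v in \<open>auto intro!: AE_I2 order_trans[OF le abs_ge_self]\<close>)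
  then show "AE x in lborel. integrable lborel (\<lambda>y. f (x, y))" by simp
  have le': "(\<integral>y. \<bar>f (x, y)\<bar> \<partial>lborel) \<le> u x * (\<integral>y. v y \<partial>lborel)" for x
    using integral_mono[of lborel "\<lambda>y. \<bar>f (x, y)\<bar>" "\<lambda>y. u x * v y"] i v le by simp
  show "integrable lborel (\<lambda>x. \<integral>y. norm (f (x, y)) \<partial>lborel)"
  proof (rule Bochner_Integration.integrable_bound)
    show "integrable lborel (\<lambda>x. u x * (\<integral>y. v y \<partial>lborel))" using u by simp
    show "AE x in lborel. norm (\<integral>y. norm (f (x, y)) \<partial>lborel) \<le> norm (u x * (\<integral>y. v y \<partial>lborel))"
    proof (rule AE_I2)
      fix x show "norm (\<integral>y. norm (f (x, y)) \<partial>lborel) \<le> norm (u x * (\<integral>y. v y \<partial>lborel))"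
        using order_trans[OF le'[of x] abs_ge_self] by simp
    qed
  qed simp
qed simp

text \<open>Fubini moves the time integral onto \<open>\<rho>\<close>, giving \<open>W\<close>.
  Cancellation over full turns bounds \<open>W\<close> by \<open>C / norm x\<close>, and this is
  paired with the square integrable \<open>\<zeta>\<close>.\<close>

lemma twist_pairing_time_average:
  fixes \<rho> \<zeta> :: "real \<times> real \<Rightarrow> real"
  assumes [measurable]: "\<rho> \<in> borel_measurable borel" and b: "\<And>x. \<bar>\<rho> x\<bar> \<le> C"
    and mean: "AE x in lborel. (\<integral>a\<in>{0..<2*pi}. \<rho> (rot a x) \<partial>lborel) = 0"
    and \<zeta>: "dilation_regular K \<zeta>" and \<eta>: "\<eta> > 0" and S: "S > 0"
  shows "\<bar>\<integral>s\<in>{0<..S}. (\<integral>x. \<rho> (twist (t - s) x) * \<zeta> x \<partial>lborel) \<partial>lborel\<bar>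
    \<le> S * (K * \<eta> + C\<^sup>2 * pi / (2 * \<eta> * S))"
proof -
  have [measurable]: "\<zeta> \<in> borel_measurable borel" and \<zeta>0: "\<And>x. norm x \<ge> 1 \<Longrightarrow> \<zeta> x = 0"
    and \<zeta>2: "integrable lborel (\<lambda>x. (\<zeta> x)\<^sup>2)" and \<zeta>K: "(\<integral>x. (\<zeta> x)\<^sup>2 \<partial>lborel) \<le> K"
    using \<zeta> unfolding dilation_regular_def by auto
  have C: "C \<ge> 0" using b[of 0] by linarith
  let ?B = "ball (0::real \<times> real) 1"
  have Bsq: "(indicat_real ?B x)\<^sup>2 = indicat_real ?B x" for x by (simp add: indicator_def)
  have \<zeta>B: "indicat_real ?B x * \<zeta> x = \<zeta> x" for x using \<zeta>0[of x] by (auto simp: indicator_def)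
  have \<zeta>i: "integrable lborel \<zeta>"
    using integral_mult_Young(1)[of "indicat_real ?B" lborel \<zeta> 1] \<zeta>2 integrable_indicator_bounded[of ?B]
    by (simp add: Bsq \<zeta>B)
  define W where "W x = (\<integral>s\<in>{0<..S}. \<rho> (twist (t - s) x) \<partial>lborel)" for x
  have [measurable]: "W \<in> borel_measurable borel"
    unfolding W_def set_lebesgue_integral_def by measurable
  have W1: "\<bar>W x\<bar> \<le> C * S" for x
    unfolding W_def using set_integral_bounded[of "\<lambda>s. \<rho> (twist (t - s) x)" "{0<..S}" C] b S
    by (auto intro: bounded_subset[OF bounded_closed_interval[of 0 S]])
  have ae: "AE x in lborel. \<bar>W x\<bar> \<le> C / norm x"
    using mean AE_lborel_singleton[of 0]
  proof eventually_elim
    case (elim x)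
    then show ?case unfolding W_def using S b by (intro twist_time_average_bound) auto
  qed
  have "(\<integral>s\<in>{0<..S}. (\<integral>x. \<rho> (twist (t - s) x) * \<zeta> x \<partial>lborel) \<partial>lborel)
     = (\<integral>s. (\<integral>x. indicator {0<..S} s * (\<rho> (twist (t - s) x) * \<zeta> x) \<partial>lborel) \<partial>lborel)"
    unfolding set_lebesgue_integral_def by simp
  also have "\<dots> = (\<integral>x. (\<integral>s. indicator {0<..S} s * (\<rho> (twist (t - s) x) * \<zeta> x) \<partial>lborel) \<partial>lborel)"
  proof (rule lborel_pair.Fubini_integral)
    show "integrable (lborel \<Otimes>\<^sub>M lborel) (\<lambda>(x, s). indicator {0<..S} s * (\<rho> (twist (t - s) x) * \<zeta> x))"
    proof (rule integrable_lborel_pair_dominated)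
      show "integrable lborel (\<lambda>x. C * \<bar>\<zeta> x\<bar>)" using \<zeta>i by simp
      show "integrable lborel (indicat_real {0<..S})"
        by (rule integrable_indicator_bounded) (auto intro: bounded_subset[OF bounded_closed_interval[of 0 S]])
      show "\<bar>case (x, s) of (x, s) \<Rightarrow> indicator {0<..S} s * (\<rho> (twist (t - s) x) * \<zeta> x)\<bar> \<le> C * \<bar>\<zeta> x\<bar> * indicator {0<..S} s" for x s
        using b[of "twist (t - s) x"] by (auto simp: indicator_def abs_mult intro: mult_right_mono)
    qed measurable
  qed
  also have "\<dots> = (\<integral>x. W x * \<zeta> x \<partial>lborel)"
    unfolding W_def set_lebesgue_integral_def
    by (intro Bochner_Integration.integral_cong refl) (simp add: mult.assoc flip: integral_mult_left_zero)
  also have "\<dots> = (\<integral>x. (indicator ?B x * W x) * \<zeta> x \<partial>lborel)"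
    by (intro Bochner_Integration.integral_cong refl) (metis \<zeta>B mult.assoc mult.commute)
  finally have eq: "(\<integral>s\<in>{0<..S}. (\<integral>x. \<rho> (twist (t - s) x) * \<zeta> x \<partial>lborel) \<partial>lborel) = (\<integral>x. (indicator ?B x * W x) * \<zeta> x \<partial>lborel)" .
  \<comment> \<open>The square of \<open>C / norm x\<close> is not integrable at the origin of the
    plane, where circles make few turns. Within radius \<open>?r\<close> the trivial bound
    \<open>C * S\<close> is used, and outside it \<open>\<bar>W x\<bar> \<le> C * sqrt S\<close>.
    With this radius either region contributes \<open>pi * C\<^sup>2 * S\<close>.\<close>
  let ?r = "1 / sqrt S"
  have r: "?r > 0" "?r\<^sup>2 = 1 / S" using S by (auto simp: power_divide)
  have W2b: "(indicator ?B x * W x)\<^sup>2 \<le> (C * S)\<^sup>2 * indicat_real ?B x" for x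
    using power_mono[OF W1[of x], of 2] by (auto simp: indicator_def)
  have W2i: "integrable lborel (\<lambda>x. (indicator ?B x * W x)\<^sup>2)"
    by (rule Bochner_Integration.integrable_bound[where f="\<lambda>x. (C * S)\<^sup>2 * indicat_real ?B x"])
       (use W2b in \<open>auto intro!: AE_I2 integrable_mult_right integrable_indicator_bounded\<close>)
  have Ri: "integrable lborel (\<lambda>x. (C * S)\<^sup>2 * indicat_real (ball 0 ?r) x + (C\<^sup>2 * S) * indicat_real ?B x)"
    by (intro Bochner_Integration.integrable_add integrable_mult_right integrable_indicator_bounded) auto
  have "(\<integral>x. (indicator ?B x * W x)\<^sup>2 \<partial>lborel) \<le> (\<integral>x. (C * S)\<^sup>2 * indicat_real (ball 0 ?r) x + (C\<^sup>2 * S) * indicat_real ?B x \<partial>lborel)"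
  proof (rule integral_mono_AE[OF W2i Ri])
    show "AE x in lborel. (indicator ?B x * W x)\<^sup>2 \<le> (C * S)\<^sup>2 * indicat_real (ball 0 ?r) x + (C\<^sup>2 * S) * indicat_real ?B x"
      using ae
    proof eventually_elim
      case (elim x)
      show ?case
      proof (cases "x \<in> ball 0 ?r")
        case True
        have "(indicator ?B x * W x)\<^sup>2 \<le> (C * S)\<^sup>2 * indicat_real ?B x" by (rule W2b)
        also have "\<dots> \<le> (C * S)\<^sup>2 * indicat_real (ball 0 ?r) x + (C\<^sup>2 * S) * indicat_real ?B x"
          using True S by (auto simp: indicator_def)
        finally show ?thesis .
      next
        case False
        then have nx: "norm x \<ge> ?r" by simp
        have "C / norm x \<le> C / ?r" using nx r C by (intro divide_left_mono mult_pos_pos) auto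
        with elim have "\<bar>W x\<bar> \<le> C * sqrt S" by simp
        then have "(W x)\<^sup>2 \<le> (C * sqrt S)\<^sup>2" using power_mono[of "\<bar>W x\<bar>" "C * sqrt S" 2] by simp
        then have "(W x)\<^sup>2 \<le> C\<^sup>2 * S" using S by (simp add: power_mult_distrib)
        then show ?thesis using False by (simp add: indicator_def power_mult_distrib)
      qed
    qed
  qed
  also have "\<dots> = (C * S)\<^sup>2 * measure lborel (ball (0::real \<times> real) ?r) + C\<^sup>2 * S * measure lborel ?B"
    by (subst Bochner_Integration.integral_add) (auto intro!: integrable_mult_right integrable_indicator_bounded)
  also have "\<dots> = 2 * pi * C\<^sup>2 * S"
    using r S by (simp add: measure_disk power_mult_distrib power2_eq_square)
  finally have W2: "(\<integral>x. (indicator ?B x * W x)\<^sup>2 \<partial>lborel) \<le> 2 * pi * C\<^sup>2 * S" .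
  \<comment> \<open>The Young parameter \<open>S * \<eta>\<close> grows with \<open>S\<close>: after
    division by \<open>S\<close>, the \<open>\<zeta>\<close> term stays at \<open>K * \<eta>\<close>
    and the other decays like \<open>1 / S\<close>.\<close>
  have "\<bar>\<integral>x. (indicator ?B x * W x) * \<zeta> x \<partial>lborel\<bar> \<le> (\<integral>x. (indicator ?B x * W x)\<^sup>2 \<partial>lborel) / (4 * (S * \<eta>)) + (S * \<eta>) * (\<integral>x. (\<zeta> x)\<^sup>2 \<partial>lborel)"
    by (rule integral_mult_Young(3)) (use \<zeta>2 W2i \<eta> S in auto)
  also have "\<dots> \<le> (2 * pi * C\<^sup>2 * S) / (4 * (S * \<eta>)) + (S * \<eta>) * K"
    using W2 \<zeta>K \<eta> S by (intro add_mono divide_right_mono mult_left_mono) auto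
  also have "\<dots> = S * (K * \<eta> + C\<^sup>2 * pi / (2 * \<eta> * S))"
    using S \<eta> by (simp add: field_simps)
  finally show ?thesis unfolding eq .
qed

text \<open>The quantifier over \<open>\<zeta>\<close> stands inside the eventuality: one threshold
  serves the whole class. At time \<open>t\<close> the pairing is close to its values over the last
  \<open>S\<close> time units, and the average of these is small.\<close>

proposition uniform_weak_mixing:
  fixes \<rho> :: "real \<times> real \<Rightarrow> real"
  assumes [measurable]: "\<rho> \<in> borel_measurable borel" and b: "\<And>x. \<bar>\<rho> x\<bar> \<le> C"
    and supp: "\<And>x. norm x > 1 \<Longrightarrow> \<rho> x = 0"
    and mean: "AE x in lborel. (\<integral>a\<in>{0..<2*pi}. \<rho> (rot a x) \<partial>lborel) = 0" and e: "e > 0"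
  shows "\<forall>\<^sub>F t in at_top. \<forall>\<zeta>. dilation_regular K \<zeta> \<longrightarrow> \<bar>\<integral>x. \<rho> (twist t x) * \<zeta> x \<partial>lborel\<bar> \<le> e"
proof (cases "K \<ge> 0")
  case False
  have "\<not> dilation_regular K \<zeta>" for \<zeta>
  proof
    assume "dilation_regular K \<zeta>"
    then have "(\<integral>x. (\<zeta> x)\<^sup>2 \<partial>lborel) \<le> K" by (simp add: dilation_regular_def)
    moreover have "(\<integral>x. (\<zeta> x)\<^sup>2 \<partial>lborel) \<ge> 0" by simp
    ultimately show False using False by linarith
  qed
  then show ?thesis by simp
next
  case K: True
  have C: "C \<ge> 0" using b[of 0] by linarith
  \<comment> \<open>Order of choice: \<open>\<eta>\<close> from \<open>C\<close> and
    \<open>K\<close>, then \<open>S\<close> from \<open>\<eta>\<close>, then the tolerance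
    \<open>\<epsilon>\<close> for the dilations of \<open>\<rho>\<close> and its \<open>d\<close>,
    then \<open>m\<close>, and finally \<open>T\<close>. Four errors receive \<open>e / 5\<close>
    each. The added units keep denominators positive when \<open>C\<close> or \<open>K\<close> is
    0.\<close>
  define P where "P = (C + 2) * (K + 1)"
  have P: "P > 0" using C K by (simp add: P_def)
  define \<eta> where "\<eta> = e / (5 * P)"
  have \<eta>: "\<eta> > 0" using e P by (simp add: \<eta>_def)
  have \<eta>e: "(C + 2) * K * \<eta> \<le> e / 5"
  proof -
    have "(C + 2) * K * \<eta> \<le> (C + 2) * (K + 1) * \<eta>" using C K \<eta> by (intro mult_mono) auto
    also have "\<dots> = e / 5" using P unfolding P_def[symmetric] by (simp add: \<eta>_def)
    finally show ?thesis .
  qed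
  define S where "S = C\<^sup>2 * pi / (2 * \<eta>) / (e / 5) + 1"
  have S: "S > 0" unfolding S_def using \<eta> e by (intro add_nonneg_pos) auto
  have Se: "C\<^sup>2 * pi / (2 * \<eta> * S) \<le> e / 5"
  proof -
    have "C\<^sup>2 * pi / (2 * \<eta>) \<le> S * (e / 5)" using e by (simp add: S_def field_simps)
    then show ?thesis using S \<eta> by (simp add: field_simps)
  qed
  have C\<eta>: "C / (2 * \<eta>) \<ge> 0" using C \<eta> by simp
  define Q where "Q = C / (2 * \<eta>) + 1"
  have Q: "Q > 0" using C\<eta> by (simp add: Q_def)
  define \<epsilon> where "\<epsilon> = e / 5 / Q"
  have \<epsilon>: "\<epsilon> > 0" using e Q by (simp add: \<epsilon>_def)
  have \<epsilon>e: "C / (2 * \<eta>) * \<epsilon> \<le> e / 5"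
  proof -
    have "C / (2 * \<eta>) * \<epsilon> \<le> Q * \<epsilon>" using \<epsilon> by (intro mult_right_mono) (auto simp: Q_def)
    also have "\<dots> = e / 5" using Q by (simp add: \<epsilon>_def)
    finally show ?thesis .
  qed
  have \<rho>i: "integrable lborel \<rho>" by (rule integrable_bounded_support[OF _ b supp]) auto
  obtain d where d: "d > 0" "d \<le> 1/2"
    "\<And>c. 1 - d \<le> c \<Longrightarrow> c \<le> 1 \<Longrightarrow> (\<integral>x. \<bar>c\<^sup>2 * \<rho> (c *\<^sub>R x) - \<rho> x\<bar> \<partial>lborel) \<le> \<epsilon>"
    using dilation_L1_small[OF \<rho>i supp \<epsilon>] by blast
  define M where "M = C * K + C * pi / (2 * \<eta>)"
  have M: "M \<ge> 0" using C K \<eta> by (simp add: M_def)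
  define m where "m = min d (e / 5 / (M + 1))"
  have mp: "m > 0" using d e M by (auto simp: m_def)
  have md: "m \<le> d" "m \<le> e / 5 / (M + 1)" unfolding m_def by (rule min.cobounded1 min.cobounded2)+
  \<comment> \<open>For \<open>t \<ge> T\<close> a shift \<open>s \<le> S\<close> is the dilation by
    \<open>c = 1 - s / t\<close> with \<open>1 - c \<le> m\<close>.\<close>
  define T where "T = S / m"
  have T: "T > 0" using mp S by (simp add: T_def)
  have main: "\<bar>\<integral>x. \<rho> (twist t x) * \<zeta> x \<partial>lborel\<bar> \<le> e" if t: "t \<ge> T" and \<zeta>: "dilation_regular K \<zeta>" for t \<zeta>
  proof -
    define I where "I t = (\<integral>x. \<rho> (twist t x) * \<zeta> x \<partial>lborel)" for t
    have [measurable]: "\<zeta> \<in> borel_measurable borel" using \<zeta> by (simp add: dilation_regular_def)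
    have [measurable]: "I \<in> borel_measurable borel" unfolding I_def by measurable
    have t0: "t > 0" using t T by linarith
    have "S \<le> T * m" using mp by (simp add: T_def)
    also have "\<dots> \<le> t * m" using t mp by (intro mult_right_mono) auto
    finally have St: "S / t \<le> m" using t0 by (simp add: field_simps)
    define R where "R = (C + 1) * K * \<eta> + e / 5 + e / 5"
    have diff: "\<bar>I t - I (t - s)\<bar> \<le> R" if s: "0 < s" "s \<le> S" for s
    proof -
      define c where "c = 1 - s / t"
      have "s / t \<le> S / t" using s t0 by (simp add: divide_right_mono)
      then have "1 - c \<le> m" and c: "0 \<le> 1 - c" using St s t0 by (auto simp: c_def)
      with md have c: "1 - c \<le> d" "1 - c \<le> e / 5 / (M + 1)" "0 \<le> 1 - c" by linarith+
      then have c': "1/2 \<le> c" "c \<le> 1" using d by auto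
      have tc: "t * c = t - s" using t0 by (simp add: c_def algebra_simps)
      have "(1 - c) * M \<le> e / 5"
      proof -
        have "(1 - c) * M \<le> (e / 5 / (M + 1)) * (M + 1)" using c M e by (intro mult_mono) auto
        also have "\<dots> = e / 5" using M by (intro nonzero_divide_eq_eq[THEN iffD1, symmetric]) auto
        finally show ?thesis .
      qed
      moreover have "C / (2 * \<eta>) * (\<integral>x. \<bar>c\<^sup>2 * \<rho> (c *\<^sub>R x) - \<rho> x\<bar> \<partial>lborel) \<le> C / (2 * \<eta>) * \<epsilon>"
        using d(3)[of c] c c' C\<eta> by (intro mult_left_mono) auto
      moreover have "\<bar>I t - I (t * c)\<bar> \<le> (C + 1) * K * \<eta> + C * K * (1 - c) + C * pi * (1 - c) / (2 * \<eta>)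
         + C / (2 * \<eta>) * (\<integral>x. \<bar>c\<^sup>2 * \<rho> (c *\<^sub>R x) - \<rho> x\<bar> \<partial>lborel)"
        unfolding I_def by (rule twist_pairing_slow_variation[OF _ b supp \<zeta> \<eta> t0 c']) auto
      moreover have "C * K * (1 - c) + C * pi * (1 - c) / (2 * \<eta>) = (1 - c) * M"
        by (simp add: M_def algebra_simps)
      ultimately show ?thesis unfolding tc R_def using \<epsilon>e by linarith
    qed
    \<comment> \<open>Supplies the integrability of the pairing in time, without which its integral
      over the window could not be split.\<close>
    have Ib: "\<bar>I (t - s)\<bar> \<le> \<bar>I t\<bar> + R" if "s \<in> {0<..S}" for s
      using diff[of s] that by auto
    have bS: "bounded {0<..S}" by (rule bounded_subset[OF bounded_closed_interval[of 0 S]]) auto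
    have "set_integrable lborel {0<..S} (\<lambda>s. I (t - s))"
      by (rule integrable_bounded_on[OF _ _ bS Ib]) auto
    moreover have ci: "set_integrable lborel {0<..S} (\<lambda>s. I t)"
      by (rule integrable_bounded_on[OF _ _ bS, where C="\<bar>I t\<bar>"]) auto
    ultimately have "(\<integral>s\<in>{0<..S}. I t - I (t - s) \<partial>lborel) = S * I t - (\<integral>s\<in>{0<..S}. I (t - s) \<partial>lborel)"
      using S by (subst set_integral_diff) (auto simp: set_integral_const)
    moreover have "\<bar>\<integral>s\<in>{0<..S}. I t - I (t - s) \<partial>lborel\<bar> \<le> R * measure lborel {0<..S}"
      by (rule set_integral_bounded[OF _ _ bS]) (use diff in auto)
    moreover have "\<bar>\<integral>s\<in>{0<..S}. I (t - s) \<partial>lborel\<bar> \<le> S * (K * \<eta> + C\<^sup>2 * pi / (2 * \<eta> * S))"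
      unfolding I_def by (rule twist_pairing_time_average[OF _ b mean \<zeta> \<eta> S]) auto
    ultimately have "\<bar>S * I t\<bar> \<le> S * (R + (K * \<eta> + C\<^sup>2 * pi / (2 * \<eta> * S)))"
      using S by (simp add: algebra_simps)
    then have "\<bar>I t\<bar> \<le> R + (K * \<eta> + C\<^sup>2 * pi / (2 * \<eta> * S))"
      using S by (simp add: abs_mult)
    also have "\<dots> = (C + 2) * K * \<eta> + e / 5 + e / 5 + C\<^sup>2 * pi / (2 * \<eta> * S)"
      by (simp add: R_def algebra_simps)
    also have "\<dots> \<le> e" using \<eta>e Se e by linarith
    finally show ?thesis by (simp add: I_def)
  qed
  show ?thesis using eventually_ge_at_top[of T] by eventually_elim (use main in blast)
qed

section \<open>Geometric mixing\<close>

lemma transport_eq_twist: "transport \<rho> t x = \<rho> (twist t x)"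
  by (simp add: transport_def twist_def)

lemma Linf_norm_transport:
  assumes [measurable]: "\<rho> \<in> borel_measurable borel"
  shows "Linf_norm (transport \<rho> t) = Linf_norm \<rho>"
proof -
  have "(AE x in lborel. ereal \<bar>\<rho> (twist t x)\<bar> \<le> z) \<longleftrightarrow> (AE x in lborel. ereal \<bar>\<rho> x\<bar> \<le> z)" for z
    using AE_distr_iff[of "twist t" lborel borel "\<lambda>x. ereal \<bar>\<rho> x\<bar> \<le> z"] unfolding distr_twist by simp
  then show ?thesis
    unfolding Linf_norm_def transport_eq_twist by (simp add: esssup_eq_AE)
qed

text \<open>A dilation by \<open>c\<close> moves points of the unit disk by at most
  \<open>h = 1 - c\<close>, so the indicator changes only in an annulus of half-width
  \<open>h\<close> around the circle about \<open>x\<close>. Its area depends on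
  \<open>\<epsilon>\<close> and \<open>h\<close> but not on the centre, hence one constant for all
  centres.\<close>

lemma disk_dilation_regular:
  assumes "\<epsilon> > 0"
  shows "dilation_regular (4 * pi * (\<epsilon> + 1)) (indicat_real (ball x \<epsilon> \<inter> ball 0 1))"
proof -
  let ?\<zeta> = "indicat_real (ball x \<epsilon> \<inter> ball 0 1)"
  have bdd: "bounded (ball x \<epsilon> \<inter> ball 0 1)" by (rule bounded_subset[OF bounded_ball]) auto
  have sq: "(?\<zeta> y)\<^sup>2 = ?\<zeta> y" for y by (simp add: indicator_def)
  have i: "integrable lborel ?\<zeta>" by (rule integrable_indicator_bounded[OF _ bdd]) auto
  have "measure lborel (ball x \<epsilon> \<inter> ball 0 1) \<le> measure lborel (ball (0::real \<times> real) 1)"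
    using emeasure_bounded_finite[of "ball (0::real \<times> real) 1"] by (intro measure_mono_fmeasurable) (auto simp: fmeasurable_def)
  also have "\<dots> = pi * 1" by (simp add: measure_disk)
  also have "\<dots> \<le> 4 * pi * (\<epsilon> + 1)" using assms by (simp add: algebra_simps)
  finally have K: "(\<integral>y. (?\<zeta> y)\<^sup>2 \<partial>lborel) \<le> 4 * pi * (\<epsilon> + 1)"
    unfolding sq by simp
  have "(\<integral>y\<in>ball 0 1. \<bar>?\<zeta> (c *\<^sub>R y) - ?\<zeta> y\<bar> \<partial>lborel) \<le> 4 * pi * (\<epsilon> + 1) * (1 - c)" if c: "1/2 \<le> c" "c \<le> 1" for c
  proof -
    define h where "h = 1 - c"
    have h: "0 \<le> h" "h \<le> 1/2" using c by (auto simp: h_def)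
    let ?A = "ball x (\<epsilon> + h) - ball x (\<epsilon> - h)"
    have bA: "bounded ?A" by (rule bounded_subset[OF bounded_ball]) auto
    have le: "indicat_real (ball 0 1) y *\<^sub>R \<bar>?\<zeta> (c *\<^sub>R y) - ?\<zeta> y\<bar> \<le> indicat_real ?A y" for y
    proof (cases "y \<in> ball 0 1 \<and> ?\<zeta> (c *\<^sub>R y) \<noteq> ?\<zeta> y")
      case True
      then have y: "norm y < 1" by simp
      have "c * norm y \<le> 1 * norm y" using c by (intro mult_right_mono) auto
      then have cy: "c *\<^sub>R y \<in> ball 0 1" using y c by auto
      have "dist (c *\<^sub>R y) y = norm (h *\<^sub>R y)" by (simp add: dist_norm h_def scaleR_diff_left norm_minus_commute)
      also have "\<dots> \<le> h" using h y mult_left_mono[of "norm y" 1 h] by simp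
      finally have d: "dist (c *\<^sub>R y) y \<le> h" .
      have "(c *\<^sub>R y \<in> ball x \<epsilon>) \<noteq> (y \<in> ball x \<epsilon>)" using True cy y by (auto simp: indicator_def split: if_splits)
      then have "y \<in> ?A"
        using d dist_triangle[of x y "c *\<^sub>R y"] dist_triangle[of x "c *\<^sub>R y" y] by (auto simp: dist_commute)
      then show ?thesis by (auto simp: indicator_def)
    next
      case False
      then show ?thesis by (auto simp: indicator_def)
    qed
    have "(\<integral>y\<in>ball 0 1. \<bar>?\<zeta> (c *\<^sub>R y) - ?\<zeta> y\<bar> \<partial>lborel) \<le> (\<integral>y. indicat_real ?A y \<partial>lborel)"
      unfolding set_lebesgue_integral_def
    proof (rule integral_mono)
      show Ai: "integrable lborel (indicat_real ?A)" by (rule integrable_indicator_bounded[OF _ bA]) auto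
      show "integrable lborel (\<lambda>y. indicat_real (ball 0 1) y *\<^sub>R \<bar>?\<zeta> (c *\<^sub>R y) - ?\<zeta> y\<bar>)"
      proof (rule Bochner_Integration.integrable_bound[OF Ai])
        show "(\<lambda>y. indicat_real (ball 0 1) y *\<^sub>R \<bar>?\<zeta> (c *\<^sub>R y) - ?\<zeta> y\<bar>) \<in> borel_measurable lborel"
          by measurable
        show "AE y in lborel. norm (indicat_real (ball 0 1) y *\<^sub>R \<bar>?\<zeta> (c *\<^sub>R y) - ?\<zeta> y\<bar>) \<le> norm (indicat_real ?A y)"
          using le by (intro AE_I2) (simp add: abs_mult)
      qed
      show "indicat_real (ball 0 1) y *\<^sub>R \<bar>?\<zeta> (c *\<^sub>R y) - ?\<zeta> y\<bar> \<le> indicat_real ?A y" for y by (rule le)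
    qed
    also have "\<dots> = measure lborel ?A" by simp
    also have "\<dots> = measure lborel (ball x (\<epsilon> + h)) - measure lborel (ball x (\<epsilon> - h))"
      using h emeasure_bounded_finite[of "ball x (\<epsilon> + h)"] by (intro measure_Diff) (auto simp: top.not_eq_extremum)
    also have "\<dots> \<le> 4 * pi * (\<epsilon> + 1) * h"
    proof (cases "\<epsilon> - h \<ge> 0")
      case True
      then have "measure lborel (ball x (\<epsilon> + h)) - measure lborel (ball x (\<epsilon> - h)) = 4 * pi * \<epsilon> * h"
        using assms h by (simp add: measure_disk power2_eq_square algebra_simps)
      also have "\<dots> \<le> 4 * pi * (\<epsilon> + 1) * h" using h assms by (intro mult_right_mono) auto
      finally show ?thesis .
    next
      \<comment> \<open>The inner disk is empty here, and \<open>\<epsilon> + h < 2 * h\<close>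
        makes the quadratic area linear in \<open>h\<close>.\<close>
      case False
      then have "measure lborel (ball x (\<epsilon> + h)) - measure lborel (ball x (\<epsilon> - h)) = pi * ((\<epsilon> + h) * (\<epsilon> + h))"
        using assms h by (simp add: measure_disk power2_eq_square)
      also have "\<dots> \<le> pi * ((\<epsilon> + 1) * (4 * h))"
        using False h assms by (intro mult_left_mono mult_mono) auto
      finally show ?thesis by (simp add: algebra_simps)
    qed
    finally show ?thesis by (simp add: h_def)
  qed
  moreover have "?\<zeta> y = 0" if "norm y \<ge> 1" for y using that by simp
  ultimately show ?thesis using K i unfolding dilation_regular_def sq
    by (intro conjI allI impI) auto
qed

text \<open>Regular test functions vanish on the unit circle, whereas \<open>\<rho>\<close> is known
  to vanish only beyond it.\<close>

lemma AE_not_unit_circle: "AE x in lborel. norm (x::real \<times> real) \<noteq> 1"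
proof -
  have "sphere (0::real \<times> real) 1 \<in> null_sets lebesgue"
    using negligible_sphere by (simp add: negligible_iff_null_sets)
  then have "AE x::real \<times> real in lebesgue. x \<notin> sphere 0 1" by (rule AE_not_in)
  then show ?thesis by (simp add: AE_completion_iff)
qed

text \<open>Since \<open>mix_geo\<close> is an infimum, it suffices that the single radius
  \<open>e / 2\<close> eventually becomes admissible. For a fixed radius the disks form one regular
  class.\<close>

lemma mix_geo_transport_tendsto_0:
  assumes [measurable]: "\<rho>0 \<in> borel_measurable borel" "\<rho> \<in> borel_measurable borel"
    and eq: "AE x in lborel. \<rho>0 x = \<rho> x" and b: "\<And>x. \<bar>\<rho> x\<bar> \<le> C"
    and supp: "\<And>x. norm x > 1 \<Longrightarrow> \<rho> x = 0"
    and mean: "AE x in lborel. (\<integral>a\<in>{0..<2*pi}. \<rho> (rot a x) \<partial>lborel) = 0"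
    and \<kappa>: "0 < \<kappa>"
  shows "((\<lambda>t. mix_geo \<kappa> (transport \<rho>0 t)) \<longlongrightarrow> 0) at_top"
proof (rule tendstoI)
  fix e :: real assume e: "e > 0"
  define \<epsilon> where "\<epsilon> = e / 2"
  have \<epsilon>: "\<epsilon> > 0" "\<epsilon> < e" using e by (auto simp: \<epsilon>_def)
  have int_eq: "(\<integral>y\<in>ball x \<epsilon>. transport \<rho>0 t y \<partial>lborel) = (\<integral>y. \<rho> (twist t y) * indicat_real (ball x \<epsilon> \<inter> ball 0 1) y \<partial>lborel)" for x t
    unfolding set_lebesgue_integral_def transport_eq_twist
  proof (rule integral_cong_AE)
    show "AE y in lborel. indicat_real (ball x \<epsilon>) y *\<^sub>R \<rho>0 (twist t y) = \<rho> (twist t y) * indicat_real (ball x \<epsilon> \<inter> ball 0 1) y"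
      using AE_twist[OF eq, of t] AE_not_unit_circle
    proof eventually_elim
      case (elim y)
      show ?case
      proof (cases "norm y < 1")
        case True
        with elim show ?thesis by (simp add: indicator_def)
      next
        case False
        with elim have "\<rho> (twist t y) = 0" by (intro supp) simp
        with elim show ?thesis by simp
      qed
    qed
  qed measurable
  have ev: "\<forall>\<^sub>F t in at_top. \<forall>x. ereal \<bar>(\<integral>y\<in>ball x \<epsilon>. transport \<rho>0 t y \<partial>lborel) / measure lborel (ball x \<epsilon>)\<bar>
        \<le> ereal \<kappa> * Linf_norm (transport \<rho>0 t)"
  proof (cases "Linf_norm \<rho>0 > 0")
    case True
    \<comment> \<open>\<open>Linf_norm\<close> is extended real valued; a positive real
      \<open>l\<close> below it gives a real tolerance. It serves for all times because the twist
      preserves the norm.\<close>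
    then obtain l where l: "0 < ereal l" "ereal l < Linf_norm \<rho>0" using ereal_dense2 by blast
    define e' where "e' = \<kappa> * l * (pi * \<epsilon>\<^sup>2)"
    have "e' > 0" using \<kappa> l \<epsilon> by (simp add: e'_def)
    have "\<forall>\<^sub>F t in at_top. \<forall>\<zeta>. dilation_regular (4 * pi * (\<epsilon> + 1)) \<zeta> \<longrightarrow> \<bar>\<integral>x. \<rho> (twist t x) * \<zeta> x \<partial>lborel\<bar> \<le> e'"
      by (rule uniform_weak_mixing[OF _ b supp mean \<open>e' > 0\<close>]) auto
    then show ?thesis
    proof eventually_elim
      case (elim t)
      show ?case
      proof
        fix x :: "real \<times> real"
        have "\<bar>\<integral>y\<in>ball x \<epsilon>. transport \<rho>0 t y \<partial>lborel\<bar> \<le> e'"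
          unfolding int_eq using elim disk_dilation_regular[OF \<epsilon>(1)] by blast
        then have "\<bar>(\<integral>y\<in>ball x \<epsilon>. transport \<rho>0 t y \<partial>lborel) / measure lborel (ball x \<epsilon>)\<bar> \<le> \<kappa> * l"
          using \<epsilon> by (simp add: measure_disk e'_def field_simps)
        then have "ereal \<bar>(\<integral>y\<in>ball x \<epsilon>. transport \<rho>0 t y \<partial>lborel) / measure lborel (ball x \<epsilon>)\<bar> \<le> ereal \<kappa> * ereal l"
          by simp
        also have "\<dots> \<le> ereal \<kappa> * Linf_norm \<rho>0" using \<kappa> l by (intro ereal_mult_left_mono) auto
        finally show "ereal \<bar>(\<integral>y\<in>ball x \<epsilon>. transport \<rho>0 t y \<partial>lborel) / measure lborel (ball x \<epsilon>)\<bar> \<le> ereal \<kappa> * Linf_norm (transport \<rho>0 t)"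
          by (simp add: Linf_norm_transport)
      qed
    qed
  next
    \<comment> \<open>With norm 0 the tolerance is 0 and mixing gives too little, but then
      \<open>\<rho>\<close> vanishes almost everywhere and all averages are exactly 0.\<close>
    case False
    have "AE x in lborel. ereal \<bar>\<rho>0 x\<bar> \<le> Linf_norm \<rho>0" unfolding Linf_norm_def by (rule esssup_AE)
    with eq have "AE x in lborel. \<rho> x = 0"
    proof eventually_elim
      case (elim x)
      then have "ereal \<bar>\<rho>0 x\<bar> \<le> 0" using False by (meson not_less order_trans)
      then show ?case using elim(1) by simp
    qed
    then have z: "AE x in lborel. \<rho> (twist t x) = 0" for t by (rule AE_twist)
    have "(\<integral>y\<in>ball x \<epsilon>. transport \<rho>0 t y \<partial>lborel) = 0" for x t
      unfolding int_eq
      by (rule integral_eq_zero_AE) (use z[of t] in \<open>eventually_elim, simp\<close>)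
    moreover have "Linf_norm \<rho>0 \<ge> 0"
    proof -
      have "(0::ereal) = esssup lborel (\<lambda>x::real \<times> real. 0)" by (subst esssup_const) auto
      also have "\<dots> \<le> Linf_norm \<rho>0" unfolding Linf_norm_def by (rule esssup_mono) auto
      finally show ?thesis .
    qed
    ultimately show ?thesis using \<kappa> by (simp add: Linf_norm_transport zero_ereal_def[symmetric])
  qed
  then show "\<forall>\<^sub>F t in at_top. dist (mix_geo \<kappa> (transport \<rho>0 t)) 0 < e"
  proof eventually_elim
    case (elim t)
    let ?A = "{\<epsilon>. \<epsilon> > 0 \<and> (\<forall>x. ereal \<bar>(\<integral>y\<in>ball x \<epsilon>. transport \<rho>0 t y \<partial>lborel) / measure lborel (ball x \<epsilon>)\<bar>
        \<le> ereal \<kappa> * Linf_norm (transport \<rho>0 t))}"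
    \<comment> \<open>Membership is also what makes \<open>Inf ?A \<ge> 0\<close> provable: the
      infimum of an empty set of reals carries no information.\<close>
    have mem: "\<epsilon> \<in> ?A" using elim \<epsilon> by simp
    have "Inf ?A \<ge> 0" using mem by (intro cInf_greatest) auto
    moreover have "Inf ?A \<le> \<epsilon>" using mem by (intro cInf_lower bdd_belowI[of _ 0]) auto
    ultimately show ?case using \<epsilon> by (simp add: mix_geo_def)
  qed
qed

section \<open>Smooth bump functions\<close>

text \<open>For \<open>k = 0\<close> this is the classical smooth function that is flat at 0. The
  powers are included so that derivatives are linear combinations of members of the family.\<close>

definition flat_exp :: "nat \<Rightarrow> real \<Rightarrow> real" where
  "flat_exp k x = (if x > 0 then exp (- inverse x) / x ^ k else 0)"

lemma flat_exp_tendsto_0: "(flat_exp k \<longlongrightarrow> 0) (at 0)"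
proof (rule filterlim_split_at)
  have "\<forall>\<^sub>F x in at_left 0. flat_exp k x = 0"
    by (auto simp: eventually_at_filter flat_exp_def)
  then show "(flat_exp k \<longlongrightarrow> 0) (at_left 0)" by (rule tendsto_eventually)
  have "((\<lambda>x::real. inverse x ^ k / exp (inverse x)) \<longlongrightarrow> 0) (at_right 0)"
    by (rule filterlim_compose[OF tendsto_power_div_exp_0 filterlim_inverse_at_top_right])
  then show "(flat_exp k \<longlongrightarrow> 0) (at_right 0)"
  proof (rule Lim_transform_eventually)
    show "\<forall>\<^sub>F x in at_right 0. inverse x ^ k / exp (inverse x) = flat_exp k x"
      by (auto simp: eventually_at_filter flat_exp_def exp_minus power_inverse divide_inverse)
  qed
qed

lemma has_real_derivative_flat_exp:
  "(flat_exp k has_real_derivative flat_exp (k + 2) x - real k * flat_exp (k + 1) x) (at x)"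
proof -
  consider "x > 0" | "x < 0" | "x = 0" by linarith
  then show ?thesis
  proof cases
    case 1
    have ev: "\<forall>\<^sub>F y in nhds x. flat_exp k y = exp (- inverse y) / y ^ k"
      using eventually_nhds_in_open[of "{0<..}" x] 1 by (auto elim!: eventually_mono simp: flat_exp_def)
    have "((\<lambda>y. exp (- inverse y) * inverse (y ^ k)) has_real_derivative
        exp (- inverse x) * inverse (x\<^sup>2) * inverse (x ^ k) + exp (- inverse x) * (- (real k * x ^ (k - 1)) * inverse (x ^ k * x ^ k))) (at x)"
      using 1 by (auto intro!: derivative_eq_intros simp: power2_eq_square)
    also have "exp (- inverse x) * inverse (x\<^sup>2) * inverse (x ^ k) + exp (- inverse x) * (- (real k * x ^ (k - 1)) * inverse (x ^ k * x ^ k))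
        = flat_exp (k + 2) x - real k * flat_exp (k + 1) x"
      using 1 by (cases k) (auto simp: flat_exp_def field_simps power2_eq_square)
    finally show ?thesis
      using DERIV_cong_ev[OF refl ev refl] by (simp add: divide_inverse)
  next
    case 2
    have ev: "\<forall>\<^sub>F y in nhds x. flat_exp k y = 0"
      using eventually_nhds_in_open[of "{..<0}" x] 2 by (auto elim!: eventually_mono simp: flat_exp_def)
    have "flat_exp (k + 2) x - real k * flat_exp (k + 1) x = 0"
      using 2 by (simp add: flat_exp_def)
    then show ?thesis
      using DERIV_cong_ev[OF refl ev refl, of 0] by simp
  next
    case 3
    \<comment> \<open>At 0 the difference quotient of \<open>flat_exp k\<close> is
      \<open>flat_exp (k + 1)\<close> itself, so the limit is already known.\<close>
    have "(\<lambda>h. (flat_exp k (0 + h) - flat_exp k 0) / h) = flat_exp (k + 1)"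
      by (auto simp: fun_eq_iff flat_exp_def)
    then show ?thesis
      using flat_exp_tendsto_0[of "k + 1"] 3 by (simp add: DERIV_def flat_exp_def[of _ 0])
  qed
qed

text \<open>An algebra of functions closed under partial derivatives, hence contained in \<open>smooth2\<close>
  by coinduction, that contains compactly supported functions.\<close>
inductive bump_algebra :: "(real \<times> real \<Rightarrow> real) \<Rightarrow> bool" where
  const: "bump_algebra (\<lambda>z. c)"
| flat: "bump_algebra (\<lambda>z. flat_exp k (a * fst z + b * snd z + c))"
| add: "bump_algebra f \<Longrightarrow> bump_algebra g \<Longrightarrow> bump_algebra (\<lambda>z. f z + g z)"
| mult: "bump_algebra f \<Longrightarrow> bump_algebra g \<Longrightarrow> bump_algebra (\<lambda>z. f z * g z)"

lemma bump_algebra_derivative: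
  assumes "bump_algebra f"
  obtains f1 f2 where "bump_algebra f1" "bump_algebra f2"
    "\<And>z. (f has_derivative (\<lambda>h. fst h * f1 z + snd h * f2 z)) (at z)"
proof -
  have "\<exists>f1 f2. bump_algebra f1 \<and> bump_algebra f2 \<and> (\<forall>z. (f has_derivative (\<lambda>h. fst h * f1 z + snd h * f2 z)) (at z))"
    using assms
  proof induction
    case (const c)
    then show ?case by (intro exI[of _ "\<lambda>z. 0"]) (auto intro: bump_algebra.const)
  next
    case (flat k a b c)
    let ?l = "\<lambda>z::real \<times> real. a * fst z + b * snd z + c"
    let ?d = "\<lambda>z. flat_exp (k + 2) (?l z) + (- real k) * flat_exp (k + 1) (?l z)"
    have d: "bump_algebra ?d"
      by (rule bump_algebra.add[OF bump_algebra.flat bump_algebra.mult[OF bump_algebra.const bump_algebra.flat]])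
    have "((\<lambda>z. flat_exp k (?l z)) has_derivative (\<lambda>h. fst h * (a * ?d z) + snd h * (b * ?d z))) (at z)" for z
    proof -
      have "(?l has_derivative (\<lambda>h. a * fst h + b * snd h)) (at z)"
        by (auto intro!: derivative_eq_intros)
      from has_derivative_compose[OF this has_field_derivative_imp_has_derivative[OF has_real_derivative_flat_exp]]
      show ?thesis by (rule has_derivative_eq_rhs) (simp add: fun_eq_iff algebra_simps)
    qed
    moreover have "bump_algebra (\<lambda>z. a * ?d z)" "bump_algebra (\<lambda>z. b * ?d z)"
      by (rule bump_algebra.mult[OF bump_algebra.const d])+
    ultimately show ?case by blast
  next
    case (add f g)
    then obtain f1 f2 g1 g2 where *: "bump_algebra f1" "bump_algebra f2" "bump_algebra g1" "bump_algebra g2"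
      "\<And>z. (f has_derivative (\<lambda>h. fst h * f1 z + snd h * f2 z)) (at z)"
      "\<And>z. (g has_derivative (\<lambda>h. fst h * g1 z + snd h * g2 z)) (at z)" by blast
    have "((\<lambda>z. f z + g z) has_derivative (\<lambda>h. fst h * (f1 z + g1 z) + snd h * (f2 z + g2 z))) (at z)" for z
      by (rule has_derivative_eq_rhs[OF has_derivative_add[OF *(5,6)]]) (simp add: fun_eq_iff algebra_simps)
    then show ?case using bump_algebra.add[OF *(1,3)] bump_algebra.add[OF *(2,4)] by blast
  next
    case (mult f g)
    then obtain f1 f2 g1 g2 where *: "bump_algebra f1" "bump_algebra f2" "bump_algebra g1" "bump_algebra g2"
      "\<And>z. (f has_derivative (\<lambda>h. fst h * f1 z + snd h * f2 z)) (at z)"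
      "\<And>z. (g has_derivative (\<lambda>h. fst h * g1 z + snd h * g2 z)) (at z)" by blast
    have "((\<lambda>z. f z * g z) has_derivative (\<lambda>h. fst h * (f1 z * g z + f z * g1 z) + snd h * (f2 z * g z + f z * g2 z))) (at z)" for z
      by (rule has_derivative_eq_rhs[OF has_derivative_mult[OF *(5,6)]]) (simp add: fun_eq_iff algebra_simps)
    moreover have "bump_algebra (\<lambda>z. f1 z * g z + f z * g1 z)" "bump_algebra (\<lambda>z. f2 z * g z + f z * g2 z)"
      by (rule bump_algebra.add[OF bump_algebra.mult[OF *(1) mult.hyps(2)] bump_algebra.mult[OF mult.hyps(1) *(3)]])
         (rule bump_algebra.add[OF bump_algebra.mult[OF *(2) mult.hyps(2)] bump_algebra.mult[OF mult.hyps(1) *(4)]])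
    ultimately show ?case by blast
  qed
  then show ?thesis using that by blast
qed

lemma frechet_derivative_partials:
  fixes f :: "real \<times> real \<Rightarrow> real"
  assumes "(f has_derivative (\<lambda>h. fst h * f1 + snd h * f2)) (at z)"
  shows "frechet_derivative f (at z) (1, 0) = f1" "frechet_derivative f (at z) (0, 1) = f2"
  using frechet_derivative_at[OF assms, symmetric] by simp_all

lemma bump_algebra_smooth2: "bump_algebra f \<Longrightarrow> smooth2 f"
proof (coinduction arbitrary: f)
  case smooth2
  then obtain f1 f2 where f: "bump_algebra f1" "bump_algebra f2"
    "\<And>z. (f has_derivative (\<lambda>h. fst h * f1 z + snd h * f2 z)) (at z)"
    using bump_algebra_derivative by blast
  have "(\<lambda>x. frechet_derivative f (at x) (1, 0)) = f1" "(\<lambda>x. frechet_derivative f (at x) (0, 1)) = f2"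
    using frechet_derivative_partials[OF f(3)] by auto
  then show ?case using f by (auto simp: differentiable_def)
qed

lemma bump_algebra_continuous:
  assumes "bump_algebra f"
  shows "continuous_on UNIV f"
proof -
  obtain f1 f2 where "\<And>z. (f has_derivative (\<lambda>h. fst h * f1 z + snd h * f2 z)) (at z)"
    using bump_algebra_derivative[OF assms] by blast
  then show ?thesis
    by (intro continuous_at_imp_continuous_on ballI has_derivative_continuous)
qed

text \<open>Makes the reflected kernel \<open>\<lambda>w. \<phi> (p - w)\<close> a smooth test
  function; the general affine arguments in \<open>flat\<close> are what allows it.\<close>

lemma bump_algebra_reflect:
  assumes "bump_algebra f"
  shows "bump_algebra (\<lambda>w. f (p - w))"
  using assms
proof induction
  case (flat k a b c)
  have "(\<lambda>w. flat_exp k (a * fst (p - w) + b * snd (p - w) + c))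
    = (\<lambda>w. flat_exp k ((- a) * fst w + (- b) * snd w + (a * fst p + b * snd p + c)))"
    by (simp add: fun_eq_iff algebra_simps)
  then show ?case by (simp only: bump_algebra.flat)
qed (rule bump_algebra.const bump_algebra.add bump_algebra.mult; assumption)+

text \<open>The algebra offers affine arguments only, so the bump lives on a square: four one-sided
  factors confine both coordinates to absolute value below \<open>\<delta>/2\<close>, and
  \<open>norm z\<close> is at most the sum of these absolute values.\<close>

lemma mollifier_exists:
  assumes \<delta>: "\<delta> > 0"
  obtains \<phi> where "bump_algebra \<phi>" "\<And>z. \<phi> z \<ge> 0" "\<And>z. norm z \<ge> \<delta> \<Longrightarrow> \<phi> z = 0"
    "integrable lborel \<phi>" "(\<integral>z. \<phi> z \<partial>lborel) = 1"
proof -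
  define b where "b z = flat_exp 0 (1 * fst z + 0 * snd z + \<delta>/2) * flat_exp 0 ((-1) * fst z + 0 * snd z + \<delta>/2)
     * (flat_exp 0 (0 * fst z + 1 * snd z + \<delta>/2) * flat_exp 0 (0 * fst z + (-1) * snd z + \<delta>/2))" for z :: "real \<times> real"
  have b: "bump_algebra b" unfolding b_def
    by (rule bump_algebra.mult[OF bump_algebra.mult[OF bump_algebra.flat bump_algebra.flat]
          bump_algebra.mult[OF bump_algebra.flat bump_algebra.flat]])
  have nn: "b z \<ge> 0" for z by (simp add: b_def flat_exp_def)
  have supp: "b z = 0" if "norm z \<ge> \<delta>" for z
  proof -
    have "norm z \<le> \<bar>fst z\<bar> + \<bar>snd z\<bar>" using norm_Pair_le[of "fst z" "snd z"] by simp
    then have "\<bar>fst z\<bar> \<ge> \<delta>/2 \<or> \<bar>snd z\<bar> \<ge> \<delta>/2" using that by linarith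
    then show ?thesis by (auto simp: b_def flat_exp_def)
  qed
  have [measurable]: "b \<in> borel_measurable borel"
    by (rule borel_measurable_continuous_onI[OF bump_algebra_continuous[OF b]])
  have "(\<lambda>z. indicator (cball 0 \<delta>) z *\<^sub>R b z) = b" using supp by (auto simp: fun_eq_iff indicator_def)
  moreover have "integrable lborel (\<lambda>z. indicator (cball 0 \<delta>) z *\<^sub>R b z)"
    by (rule borel_integrable_compact) (auto intro: continuous_on_subset[OF bump_algebra_continuous[OF b]])
  ultimately have i: "integrable lborel b" by simp
  have "(\<integral>z. b z \<partial>lborel) \<noteq> 0"
  proof
    assume "(\<integral>z. b z \<partial>lborel) = 0"
    then have ae: "AE z in lborel. b z = 0" using integral_nonneg_eq_0_iff_AE[OF i] nn by auto
    have pos: "b z > 0" if "z \<in> ball 0 (\<delta>/2)" for z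
    proof -
      have "\<bar>fst z\<bar> \<le> norm z" "\<bar>snd z\<bar> \<le> norm z"
        using norm_fst_le[of "fst z" "snd z"] norm_snd_le[of "snd z" "fst z"] by auto
      then have "\<bar>fst z\<bar> < \<delta>/2" "\<bar>snd z\<bar> < \<delta>/2" using that by auto
      then show ?thesis by (simp add: b_def flat_exp_def abs_less_iff)
    qed
    have "AE z in lborel. z \<notin> ball (0::real \<times> real) (\<delta>/2)"
      using ae by eventually_elim (use pos in force)
    then have "emeasure lborel (ball (0::real \<times> real) (\<delta>/2)) = 0"
      by (subst (asm) AE_iff_measurable[of "ball 0 (\<delta>/2)"]) auto
    then have "measure lborel (ball (0::real \<times> real) (\<delta>/2)) = 0" by (simp add: measure_def)
    then show False using \<delta> by simp
  qed
  moreover have "(\<integral>z. b z \<partial>lborel) \<ge> 0" using nn by simp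
  ultimately have pos: "(\<integral>z. b z \<partial>lborel) > 0" by linarith
  let ?c = "1 / (\<integral>z. b z \<partial>lborel)"
  show ?thesis
  proof
    show "bump_algebra (\<lambda>z. ?c * b z)" by (rule bump_algebra.mult[OF bump_algebra.const b])
    show "?c * b z \<ge> 0" for z using nn pos by simp
    show "?c * b z = 0" if "norm z \<ge> \<delta>" for z using supp[OF that] by simp
    show "integrable lborel (\<lambda>z. ?c * b z)" using i by simp
    show "(\<integral>z. ?c * b z \<partial>lborel) = 1" using pos by simp
  qed
qed

section \<open>Mollification of Sobolev functions\<close>

lemma nn_integral_reflect:
  fixes f :: "real \<times> real \<Rightarrow> ennreal"
  assumes [measurable]: "f \<in> borel_measurable borel"
  shows "(\<integral>\<^sup>+x. f (p - x) \<partial>lborel) = (\<integral>\<^sup>+x. f x \<partial>lborel)"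
  by (subst (2) lborel_affine[of "-1" p]) (simp_all add: nn_integral_density nn_integral_distr)

lemma square_integrable_on_disk:
  fixes f :: "real \<times> real \<Rightarrow> real"
  assumes [measurable]: "f \<in> borel_measurable borel"
    and i: "integrable lborel (\<lambda>x. (indicator (ball 0 1) x * f x)\<^sup>2)"
  shows "integrable lborel (\<lambda>x. indicator (ball 0 1) x * f x)"
proof -
  have sq: "(indicat_real (ball 0 1) x)\<^sup>2 = indicat_real (ball 0 1) x" for x :: "real \<times> real"
    by (simp add: indicator_def)
  have "integrable lborel (\<lambda>x. indicat_real (ball 0 1) x * (indicat_real (ball 0 1) x * f x))"
    using i integrable_indicator_bounded[of "ball (0::real \<times> real) 1"]
    by (intro integral_mult_Young(1)[of _ _ _ 1]) (auto simp: sq)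
  then show ?thesis by (simp add: mult.assoc[symmetric] power2_eq_square[symmetric] sq)
qed

text \<open>\<open>X\<close> and \<open>G\<close> extend \<open>\<xi>\<close> and
  \<open>norm (g w)\<close> by zero, which destroys the weak gradient across the unit circle. The
  mollification \<open>U\<close> of \<open>X\<close> is therefore differentiated only at points
  \<open>p\<close> with \<open>norm p + \<delta> < 1\<close>, and there the mollification
  \<open>N\<close> of \<open>G\<close> dominates its gradient.\<close>

locale mollified_H1 =
  fixes \<xi> :: "real \<times> real \<Rightarrow> real" and g :: "real \<times> real \<Rightarrow> real \<times> real"
    and \<phi> :: "real \<times> real \<Rightarrow> real" and \<delta> :: real
  assumes \<xi>m [measurable]: "\<xi> \<in> borel_measurable borel" and gm [measurable]: "g \<in> borel_measurable borel"
    and \<xi>2: "set_integrable lborel (ball 0 1) (\<lambda>x. (\<xi> x)\<^sup>2)"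
    and g2: "set_integrable lborel (ball 0 1) (\<lambda>x. (norm (g x))\<^sup>2)"
    and g_le: "(\<integral>x\<in>ball 0 1. (norm (g x))\<^sup>2 \<partial>lborel) \<le> 1"
    and wg: "weak_grad (ball 0 1) \<xi> g"
    and \<phi>: "bump_algebra \<phi>" and \<phi>_nn: "\<And>z. \<phi> z \<ge> 0" and \<phi>_supp: "\<And>z. norm z \<ge> \<delta> \<Longrightarrow> \<phi> z = 0"
    and \<phi>_int: "integrable lborel \<phi>" and \<phi>_1: "(\<integral>z. \<phi> z \<partial>lborel) = 1"
    and \<delta>: "\<delta> > 0" "\<delta> \<le> 1/2"
begin

definition X :: "real \<times> real \<Rightarrow> real" where "X w = indicator (ball 0 1) w * \<xi> w"
definition G :: "real \<times> real \<Rightarrow> real" where "G w = indicator (ball 0 1) w * norm (g w)"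
definition U :: "real \<times> real \<Rightarrow> real" where "U p = (\<integral>w. X w * \<phi> (p - w) \<partial>lborel)"
definition N :: "real \<times> real \<Rightarrow> real" where "N p = (\<integral>w. G w * \<phi> (p - w) \<partial>lborel)"

lemma \<phi>_measurable [measurable]: "\<phi> \<in> borel_measurable borel"
  by (rule borel_measurable_continuous_onI[OF bump_algebra_continuous[OF \<phi>]])

lemma XG_measurable [measurable]: "X \<in> borel_measurable borel" "G \<in> borel_measurable borel"
  unfolding X_def G_def by measurable

lemma UN_measurable [measurable]: "U \<in> borel_measurable borel" "N \<in> borel_measurable borel"
  unfolding U_def N_def by measurable

lemma ind_sq: "(indicator (ball 0 1) x * (y::real))\<^sup>2 = indicator (ball 0 1) x *\<^sub>R y\<^sup>2"
  by (simp add: indicator_def)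

lemma X_integrable: "integrable lborel X"
  unfolding X_def using \<xi>2 by (intro square_integrable_on_disk) (auto simp: ind_sq set_integrable_def)

lemma G2_integrable: "integrable lborel (\<lambda>w. (G w)\<^sup>2)"
  unfolding G_def using g2 by (simp add: ind_sq set_integrable_def)

lemma G_integrable: "integrable lborel G"
  unfolding G_def using g2 by (intro square_integrable_on_disk) (auto simp: ind_sq set_integrable_def)

lemma G2_le: "(\<integral>w. (G w)\<^sup>2 \<partial>lborel) \<le> 1"
  using g_le unfolding G_def by (simp add: ind_sq set_lebesgue_integral_def)

lemma G_nonneg: "G w \<ge> 0"
  by (simp add: G_def)

lemma \<phi>_bounded: obtains D where "\<And>z. \<bar>\<phi> z\<bar> \<le> D"
proof -
  have "compact (\<phi> ` cball 0 \<delta>)"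
    by (intro compact_continuous_image continuous_on_subset[OF bump_algebra_continuous[OF \<phi>]]) auto
  then have "bounded (\<phi> ` cball 0 \<delta>)" by (rule compact_imp_bounded)
  then obtain D where "\<forall>y\<in>\<phi> ` cball 0 \<delta>. norm y \<le> D" unfolding bounded_iff ..
  then have D: "norm (\<phi> z) \<le> D" if "z \<in> cball 0 \<delta>" for z using that by blast
  have "\<bar>\<phi> z\<bar> \<le> D" for z
  proof (cases "z \<in> cball 0 \<delta>")
    case True then show ?thesis using D by auto
  next
    case False
    then have "\<phi> z = 0" by (intro \<phi>_supp) simp
    moreover have "D \<ge> 0" using order_trans[OF norm_ge_zero D[of 0]] \<delta> by simp
    ultimately show ?thesis by simp
  qed
  then show ?thesis using that by blast
qed

lemma integrable_mult_\<phi>: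
  assumes f: "integrable lborel f"
  shows "integrable lborel (\<lambda>w. f w * \<phi> (p - w))"
proof -
  obtain D where D: "\<And>z. \<bar>\<phi> z\<bar> \<le> D" using \<phi>_bounded by blast
  have [measurable]: "f \<in> borel_measurable borel" using f by simp
  show ?thesis
  proof (rule Bochner_Integration.integrable_bound)
    show "integrable lborel (\<lambda>w. D * \<bar>f w\<bar>)" using f by simp
    show "AE w in lborel. norm (f w * \<phi> (p - w)) \<le> norm (D * \<bar>f w\<bar>)"
    proof (rule AE_I2)
      fix w
      have "\<bar>f w\<bar> * \<bar>\<phi> (p - w)\<bar> \<le> \<bar>f w\<bar> * \<bar>D\<bar>" using D[of "p - w"] by (intro mult_left_mono) auto
      then show "norm (f w * \<phi> (p - w)) \<le> norm (D * \<bar>f w\<bar>)" by (simp add: abs_mult mult.commute)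
    qed
  qed measurable
qed

lemma nn_integral_\<phi>: "(\<integral>\<^sup>+w. ennreal (\<phi> (p - w)) \<partial>lborel) = 1"
  using nn_integral_reflect[of "\<lambda>w. ennreal (\<phi> w)" p] nn_integral_eq_integral[OF \<phi>_int] \<phi>_nn \<phi>_1 by simp

lemma nn_integral_\<phi>': "(\<integral>\<^sup>+p. ennreal (\<phi> (p - w)) \<partial>lborel) = 1"
  using nn_integral_translate[of "\<lambda>p. ennreal (\<phi> p)" "- w"] nn_integral_eq_integral[OF \<phi>_int] \<phi>_nn \<phi>_1 by simp

lemma \<phi>_reflect: "integrable lborel (\<lambda>w. \<phi> (p - w))" "(\<integral>w. \<phi> (p - w) \<partial>lborel) = 1"
proof -
  show "integrable lborel (\<lambda>w. \<phi> (p - w))"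
    using nn_integral_\<phi>[of p] \<phi>_nn by (simp add: integrable_iff_bounded)
  show "(\<integral>w. \<phi> (p - w) \<partial>lborel) = 1"
    using nn_integral_\<phi>[of p] \<phi>_nn by (subst integral_eq_nn_integral) auto
qed

lemma N_nonneg: "N p \<ge> 0"
  unfolding N_def using G_nonneg \<phi>_nn by (intro integral_nonneg_AE) auto

text \<open>Averaging against a probability density does not increase the \<open>L^2\<close> norm:
  the kernel is split as a product of two square roots for Cauchy-Schwarz, and then integrated out
  in \<open>p\<close>.\<close>

lemma N_square: "(\<integral>\<^sup>+p. ennreal ((N p)\<^sup>2) \<partial>lborel) \<le> 1"
proof -
  have "ennreal ((N p)\<^sup>2) \<le> (\<integral>\<^sup>+w. ennreal ((G w)\<^sup>2) * ennreal (\<phi> (p - w)) \<partial>lborel)" for p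
  proof -
    have "ennreal (N p) = (\<integral>\<^sup>+w. ennreal (G w * \<phi> (p - w)) \<partial>lborel)"
      unfolding N_def using G_nonneg \<phi>_nn by (intro nn_integral_eq_integral[symmetric] integrable_mult_\<phi> G_integrable) auto
    also have "\<dots> = (\<integral>\<^sup>+w. ennreal (G w * sqrt (\<phi> (p - w))) * ennreal (sqrt (\<phi> (p - w))) \<partial>lborel)"
      using G_nonneg \<phi>_nn by (intro nn_integral_cong) (simp add: ennreal_mult'[symmetric] mult.assoc)
    finally have "(ennreal (N p))\<^sup>2 = (\<integral>\<^sup>+w. ennreal (G w * sqrt (\<phi> (p - w))) * ennreal (sqrt (\<phi> (p - w))) \<partial>lborel)\<^sup>2"
      by simp
    also have "\<dots> \<le> (\<integral>\<^sup>+w. (ennreal (G w * sqrt (\<phi> (p - w))))\<^sup>2 \<partial>lborel) * (\<integral>\<^sup>+w. (ennreal (sqrt (\<phi> (p - w))))\<^sup>2 \<partial>lborel)"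
      by (rule Cauchy_Schwarz_nn_integral) measurable
    also have "(\<integral>\<^sup>+w. (ennreal (sqrt (\<phi> (p - w))))\<^sup>2 \<partial>lborel) = 1"
      using \<phi>_nn nn_integral_\<phi>[of p] by (simp add: ennreal_power)
    also have "(\<integral>\<^sup>+w. (ennreal (G w * sqrt (\<phi> (p - w))))\<^sup>2 \<partial>lborel) = (\<integral>\<^sup>+w. ennreal ((G w)\<^sup>2) * ennreal (\<phi> (p - w)) \<partial>lborel)"
      using G_nonneg \<phi>_nn by (intro nn_integral_cong) (simp add: ennreal_power ennreal_mult'[symmetric] power_mult_distrib)
    finally show ?thesis using N_nonneg by (simp add: ennreal_power)
  qed
  then have "(\<integral>\<^sup>+p. ennreal ((N p)\<^sup>2) \<partial>lborel) \<le> (\<integral>\<^sup>+p. (\<integral>\<^sup>+w. ennreal ((G w)\<^sup>2) * ennreal (\<phi> (p - w)) \<partial>lborel) \<partial>lborel)"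
    by (intro nn_integral_mono)
  also have "\<dots> = (\<integral>\<^sup>+w. (\<integral>\<^sup>+p. ennreal ((G w)\<^sup>2) * ennreal (\<phi> (p - w)) \<partial>lborel) \<partial>lborel)"
    by (rule pair_sigma_finite.Fubini') (unfold_locales, measurable)
  also have "\<dots> = (\<integral>\<^sup>+w. ennreal ((G w)\<^sup>2) \<partial>lborel)"
    by (simp add: nn_integral_cmult nn_integral_\<phi>')
  also have "\<dots> = ennreal (\<integral>w. (G w)\<^sup>2 \<partial>lborel)"
    by (intro nn_integral_eq_integral G2_integrable) auto
  also have "\<dots> \<le> 1" using G2_le by simp
  finally show ?thesis .
qed

text \<open>This bound varies with \<open>\<xi>\<close> and the kernel. It secures integrability
  only and never enters the constant \<open>K\<close>.\<close>

lemma U_bounded: obtains D where "\<And>p. \<bar>U p\<bar> \<le> D"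
proof -
  obtain D where D: "\<And>z. \<bar>\<phi> z\<bar> \<le> D" using \<phi>_bounded by blast
  have "\<bar>U p\<bar> \<le> (\<integral>w. \<bar>X w\<bar> * D \<partial>lborel)" for p
    unfolding U_def
  proof (rule order_trans[OF integral_abs_bound], rule integral_mono)
    show "\<bar>X w * \<phi> (p - w)\<bar> \<le> \<bar>X w\<bar> * D" for w
      unfolding abs_mult using D by (intro mult_left_mono) auto
  qed (use X_integrable integrable_mult_\<phi>[OF X_integrable] in auto)
  then show ?thesis using that by blast
qed

text \<open>The difference is an average over \<open>z\<close>, with weight \<open>\<phi> z\<close>,
  of changes of \<open>X\<close> under a dilation combined with a translation by \<open>- z\<close>;
  each of them is small in \<open>L^1\<close> by assumption.\<close>

lemma U_approx:
  assumes small: "\<And>z. norm z \<le> \<delta> \<Longrightarrow> (\<integral>x. \<bar>X (z + (1 - \<delta>) *\<^sub>R x) - X x\<bar> \<partial>lborel) \<le> e" and e: "e \<ge> 0"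
  shows "(\<integral>\<^sup>+x. ennreal \<bar>U ((1 - \<delta>) *\<^sub>R x) - X x\<bar> \<partial>lborel) \<le> ennreal e"
proof -
  let ?c = "1 - \<delta>"
  have "ennreal \<bar>U (?c *\<^sub>R x) - X x\<bar> \<le> (\<integral>\<^sup>+z. ennreal \<bar>X (?c *\<^sub>R x - z) - X x\<bar> * ennreal (\<phi> z) \<partial>lborel)" for x
  proof -
    let ?p = "?c *\<^sub>R x"
    have i: "integrable lborel (\<lambda>w. (X w - X x) * \<phi> (?p - w))"
      using integrable_mult_\<phi>[OF X_integrable, of ?p] \<phi>_reflect(1)[of ?p] by (simp add: left_diff_distrib)
    have "U ?p - X x = (\<integral>w. X w * \<phi> (?p - w) \<partial>lborel) - X x * (\<integral>w. \<phi> (?p - w) \<partial>lborel)"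
      by (simp add: U_def \<phi>_reflect)
    also have "\<dots> = (\<integral>w. (X w - X x) * \<phi> (?p - w) \<partial>lborel)"
      using integrable_mult_\<phi>[OF X_integrable, of ?p] \<phi>_reflect(1)[of ?p] by (simp add: left_diff_distrib)
    finally have "ennreal \<bar>U ?p - X x\<bar> \<le> (\<integral>\<^sup>+w. ennreal (norm ((X w - X x) * \<phi> (?p - w))) \<partial>lborel)"
      using integral_norm_bound_ennreal[OF i] by simp
    also have "\<dots> = (\<integral>\<^sup>+w. ennreal \<bar>X (?p - (?p - w)) - X x\<bar> * ennreal (\<phi> (?p - w)) \<partial>lborel)"
      using \<phi>_nn by (intro nn_integral_cong) (simp add: abs_mult ennreal_mult)
    also have "\<dots> = (\<integral>\<^sup>+z. ennreal \<bar>X (?p - z) - X x\<bar> * ennreal (\<phi> z) \<partial>lborel)"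
      by (rule nn_integral_reflect) measurable
    finally show ?thesis .
  qed
  then have "(\<integral>\<^sup>+x. ennreal \<bar>U (?c *\<^sub>R x) - X x\<bar> \<partial>lborel) \<le> (\<integral>\<^sup>+x. (\<integral>\<^sup>+z. ennreal \<bar>X (?c *\<^sub>R x - z) - X x\<bar> * ennreal (\<phi> z) \<partial>lborel) \<partial>lborel)"
    by (intro nn_integral_mono)
  also have "\<dots> = (\<integral>\<^sup>+z. (\<integral>\<^sup>+x. ennreal \<bar>X (?c *\<^sub>R x - z) - X x\<bar> * ennreal (\<phi> z) \<partial>lborel) \<partial>lborel)"
    by (rule pair_sigma_finite.Fubini') (unfold_locales, measurable)
  also have "\<dots> \<le> (\<integral>\<^sup>+z. ennreal e * ennreal (\<phi> z) \<partial>lborel)"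
  proof (rule nn_integral_mono)
    fix z :: "real \<times> real"
    show "(\<integral>\<^sup>+x. ennreal \<bar>X (?c *\<^sub>R x - z) - X x\<bar> * ennreal (\<phi> z) \<partial>lborel) \<le> ennreal e * ennreal (\<phi> z)"
    proof (cases "norm z \<ge> \<delta>")
      case True
      then show ?thesis by (simp add: \<phi>_supp)
    next
      case False
      have c: "?c > 0" using \<delta> by simp
      have "(\<integral>\<^sup>+x. ennreal \<bar>X (?c *\<^sub>R x - z) - X x\<bar> \<partial>lborel) = ennreal (\<integral>x. \<bar>X (- z + ?c *\<^sub>R x) - X x\<bar> \<partial>lborel)"
        using integrable_affine[OF X_integrable c, of "- z"] X_integrable
        by (subst nn_integral_eq_integral[symmetric]) auto
      also have "\<dots> \<le> ennreal e" using small[of "- z"] False by (intro ennreal_leI) auto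
      finally show ?thesis by (subst nn_integral_multc) (auto intro: mult_right_mono)
    qed
  qed
  also have "\<dots> = ennreal e"
    using nn_integral_eq_integral[OF \<phi>_int] \<phi>_nn \<phi>_1 by (simp add: nn_integral_cmult)
  finally show ?thesis .
qed

text \<open>Differentiating the reflected kernel in \<open>w\<close> produces a minus sign, which
  cancels the one in the definition of the weak gradient. The condition on \<open>p\<close> keeps
  the support of the kernel compactly inside the disk.\<close>

lemma weak_grad_mollified:
  assumes p: "norm p + \<delta> < 1"
    and d: "\<And>z. (\<phi> has_derivative (\<lambda>h. fst h * \<phi>1 z + snd h * \<phi>2 z)) (at z)"
  shows "(\<integral>w. X w * \<phi>1 (p - w) \<partial>lborel) = (\<integral>w. indicator (ball 0 1) w * (fst (g w) * \<phi> (p - w)) \<partial>lborel)"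
    and "(\<integral>w. X w * \<phi>2 (p - w) \<partial>lborel) = (\<integral>w. indicator (ball 0 1) w * (snd (g w) * \<phi> (p - w)) \<partial>lborel)"
proof -
  let ?f = "\<lambda>w. \<phi> (p - w)"
  have sub: "closure {w. ?f w \<noteq> 0} \<subseteq> cball p \<delta>"
  proof (rule closure_minimal)
    show "{w. ?f w \<noteq> 0} \<subseteq> cball p \<delta>"
      using \<phi>_supp[of "p - w" for w] by (auto simp: dist_norm intro: ccontr)
  qed simp
  have "cball p \<delta> \<subseteq> ball 0 1"
  proof
    fix w assume "w \<in> cball p \<delta>"
    then have "norm (p - w) \<le> \<delta>" by (simp add: dist_norm)
    moreover have "norm w \<le> norm p + norm (p - w)" using norm_triangle_ineq4[of p "p - w"] by simp
    ultimately show "w \<in> ball 0 1" using p by simp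
  qed
  moreover have "compact (closure {w. ?f w \<noteq> 0})"
    using compact_Int_closed[OF compact_cball closed_closure, of p \<delta> "{w. ?f w \<noteq> 0}"] sub by (simp add: Int_absorb1)
  ultimately have t: "test_fun (ball 0 1) ?f"
    unfolding test_fun_def using sub bump_algebra_smooth2[OF bump_algebra_reflect[OF \<phi>]] by blast
  have D: "(?f has_derivative (\<lambda>h. fst h * (- \<phi>1 (p - w)) + snd h * (- \<phi>2 (p - w)))) (at w)" for w
  proof -
    have "((\<lambda>w. p - w) has_derivative (\<lambda>h. - h)) (at w)" by (auto intro!: derivative_eq_intros)
    from has_derivative_compose[OF this d] show ?thesis by simp
  qed
  note fd = frechet_derivative_partials[OF D]
  from wg t have
    "(\<integral>x\<in>ball 0 1. \<xi> x * frechet_derivative ?f (at x) (1, 0) \<partial>lborel) = - (\<integral>x\<in>ball 0 1. fst (g x) * ?f x \<partial>lborel)"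
    "(\<integral>x\<in>ball 0 1. \<xi> x * frechet_derivative ?f (at x) (0, 1) \<partial>lborel) = - (\<integral>x\<in>ball 0 1. snd (g x) * ?f x \<partial>lborel)"
    unfolding weak_grad_def by blast+
  then show "(\<integral>w. X w * \<phi>1 (p - w) \<partial>lborel) = (\<integral>w. indicator (ball 0 1) w * (fst (g w) * \<phi> (p - w)) \<partial>lborel)"
    "(\<integral>w. X w * \<phi>2 (p - w) \<partial>lborel) = (\<integral>w. indicator (ball 0 1) w * (snd (g w) * \<phi> (p - w)) \<partial>lborel)"
    unfolding fd set_lebesgue_integral_def X_def by (simp_all add: mult.assoc)
qed

text \<open>The left side is the derivative of \<open>U\<close> at \<open>p\<close> in direction
  \<open>v\<close> once \<open>weak_grad_mollified\<close> applies; Cauchy-Schwarz in the plane is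
  used under the integral.\<close>

lemma gradient_pairing_le_N:
  assumes v: "norm v \<le> 1"
  shows "\<bar>fst v * (\<integral>w. indicator (ball 0 1) w * (fst (g w) * \<phi> (p - w)) \<partial>lborel)
     + snd v * (\<integral>w. indicator (ball 0 1) w * (snd (g w) * \<phi> (p - w)) \<partial>lborel)\<bar> \<le> N p"
proof -
  let ?B = "ball (0::real \<times> real) 1"
  have i: "integrable lborel (\<lambda>w. indicator ?B w * (f w * \<phi> (p - w)))"
    if [measurable]: "f \<in> borel_measurable borel" and le: "\<And>w. \<bar>f w\<bar> \<le> norm (g w)" for f
  proof (rule Bochner_Integration.integrable_bound[OF integrable_mult_\<phi>[OF G_integrable, of p]])
    show "AE w in lborel. norm (indicat_real ?B w * (f w * \<phi> (p - w))) \<le> norm (G w * \<phi> (p - w))"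
    proof (rule AE_I2)
      fix w
      have "\<bar>f w\<bar> * \<bar>\<phi> (p - w)\<bar> \<le> norm (g w) * \<bar>\<phi> (p - w)\<bar>" using le by (intro mult_right_mono) auto
      then show "norm (indicat_real ?B w * (f w * \<phi> (p - w))) \<le> norm (G w * \<phi> (p - w))"
        by (simp add: indicator_def G_def abs_mult)
    qed
  qed measurable
  have i1: "integrable lborel (\<lambda>w. indicator ?B w * (fst (g w) * \<phi> (p - w)))"
  proof (rule i)
    show "\<bar>fst (g w)\<bar> \<le> norm (g w)" for w using norm_fst_le[of "fst (g w)" "snd (g w)"] by simp
  qed measurable
  have i2: "integrable lborel (\<lambda>w. indicator ?B w * (snd (g w) * \<phi> (p - w)))"
  proof (rule i)
    show "\<bar>snd (g w)\<bar> \<le> norm (g w)" for w using norm_snd_le[of "snd (g w)" "fst (g w)"] by simp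
  qed measurable
  have "fst v * (\<integral>w. indicator ?B w * (fst (g w) * \<phi> (p - w)) \<partial>lborel)
     + snd v * (\<integral>w. indicator ?B w * (snd (g w) * \<phi> (p - w)) \<partial>lborel)
     = (\<integral>w. fst v * (indicator ?B w * (fst (g w) * \<phi> (p - w))) + snd v * (indicator ?B w * (snd (g w) * \<phi> (p - w))) \<partial>lborel)"
    using i1 i2 by simp
  also have "\<bar>\<dots>\<bar> \<le> N p"
    unfolding N_def
  proof (rule order_trans[OF integral_abs_bound], rule integral_mono)
    fix w
    have "\<bar>fst v * fst (g w) + snd v * snd (g w)\<bar> \<le> norm v * norm (g w)"
      using Cauchy_Schwarz_ineq2[of v "g w"] by (simp add: inner_prod_def)
    also have "\<dots> \<le> 1 * norm (g w)" using v by (intro mult_right_mono) auto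
    finally have le: "\<bar>fst v * fst (g w) + snd v * snd (g w)\<bar> \<le> norm (g w)" by simp
    have "\<bar>fst v * (indicator ?B w * (fst (g w) * \<phi> (p - w))) + snd v * (indicator ?B w * (snd (g w) * \<phi> (p - w)))\<bar>
       = \<bar>indicator ?B w * (fst v * fst (g w) + snd v * snd (g w)) * \<phi> (p - w)\<bar>"
      by (simp add: algebra_simps)
    also have "\<dots> = indicator ?B w * \<bar>fst v * fst (g w) + snd v * snd (g w)\<bar> * \<phi> (p - w)"
      using \<phi>_nn by (simp add: abs_mult)
    also have "\<dots> \<le> indicator ?B w * norm (g w) * \<phi> (p - w)"
      using le \<phi>_nn by (intro mult_right_mono mult_left_mono) auto
    finally show "\<bar>fst v * (indicator ?B w * (fst (g w) * \<phi> (p - w))) + snd v * (indicator ?B w * (snd (g w) * \<phi> (p - w)))\<bar> \<le> G w * \<phi> (p - w)"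
      by (simp add: G_def)
  next
    show "integrable lborel (\<lambda>w. \<bar>fst v * (indicator ?B w * (fst (g w) * \<phi> (p - w))) + snd v * (indicator ?B w * (snd (g w) * \<phi> (p - w)))\<bar>)"
      using i1 i2 by simp
    show "integrable lborel (\<lambda>w. G w * \<phi> (p - w))" by (rule integrable_mult_\<phi>[OF G_integrable])
  qed
  finally show ?thesis .
qed

text \<open>The fundamental theorem of calculus is applied to the kernel along the curve for each
  fixed \<open>w\<close>, and Fubini brings the curve integral outside. This stands in for
  differentiating \<open>U\<close> under the integral sign.\<close>

lemma U_path_diff:
  assumes d\<gamma>: "\<And>\<tau>. (\<gamma> has_vector_derivative \<gamma>' \<tau>) (at \<tau>)" and c\<gamma>': "continuous_on UNIV \<gamma>'"
    and ab: "a \<le> b" and inside: "\<And>\<tau>. \<tau> \<in> {a..b} \<Longrightarrow> norm (\<gamma> \<tau>) + \<delta> < 1"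
    and speed: "\<And>\<tau>. \<tau> \<in> {a..b} \<Longrightarrow> norm (\<gamma>' \<tau>) \<le> 1"
  shows "ennreal \<bar>U (\<gamma> b) - U (\<gamma> a)\<bar> \<le> (\<integral>\<^sup>+\<tau>\<in>{a..b}. ennreal (N (\<gamma> \<tau>)) \<partial>lborel)"
proof -
  have c\<gamma>: "continuous_on UNIV \<gamma>"
    using d\<gamma> by (auto intro!: continuous_at_imp_continuous_on has_vector_derivative_continuous)
  obtain \<phi>1 \<phi>2 where 1: "bump_algebra \<phi>1" and 2: "bump_algebra \<phi>2"
    and d\<phi>: "\<And>z. (\<phi> has_derivative (\<lambda>h. fst h * \<phi>1 z + snd h * \<phi>2 z)) (at z)"
    using bump_algebra_derivative[OF \<phi>] by blast
  note c1 = bump_algebra_continuous[OF 1] and c2 = bump_algebra_continuous[OF 2]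
  have [measurable]: "\<phi>1 \<in> borel_measurable borel" "\<phi>2 \<in> borel_measurable borel"
    "\<gamma> \<in> borel_measurable borel" "\<gamma>' \<in> borel_measurable borel"
    using c1 c2 c\<gamma> c\<gamma>' by (auto intro: borel_measurable_continuous_onI)
  have bdd: "\<exists>D. \<forall>z\<in>cball 0 2. \<bar>f z\<bar> \<le> D" if "continuous_on UNIV f" for f :: "real \<times> real \<Rightarrow> real"
  proof -
    have "compact (f ` cball 0 2)"
      by (intro compact_continuous_image continuous_on_subset[OF that]) auto
    then have "bounded (f ` cball 0 2)" by (rule compact_imp_bounded)
    then show ?thesis unfolding bounded_iff by simp
  qed
  \<comment> \<open>Radius 2 suffices: the curve stays in the unit disk and \<open>X\<close>
    vanishes outside it, so only \<open>norm (\<gamma> \<tau> - w) \<le> 2\<close> matters.\<close>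
  obtain D1 where D1: "\<And>z. norm z \<le> 2 \<Longrightarrow> \<bar>\<phi>1 z\<bar> \<le> D1" 
    using bdd[OF c1] unfolding Ball_def mem_cball_0 by blast
  obtain D2 where D2: "\<And>z. norm z \<le> 2 \<Longrightarrow> \<bar>\<phi>2 z\<bar> \<le> D2" 
    using bdd[OF c2] unfolding Ball_def mem_cball_0 by blast
  define \<psi> where "\<psi> \<tau> w = fst (\<gamma>' \<tau>) * \<phi>1 (\<gamma> \<tau> - w) + snd (\<gamma>' \<tau>) * \<phi>2 (\<gamma> \<tau> - w)" for \<tau> w
  have ftc: "(\<integral>\<tau>. indicator {a..b} \<tau> *\<^sub>R \<psi> \<tau> w \<partial>lborel) = \<phi> (\<gamma> b - w) - \<phi> (\<gamma> a - w)" for w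
  proof (rule integral_FTC_atLeastAtMost[OF ab])
    fix \<tau> :: real
    have "((\<lambda>\<tau>. \<gamma> \<tau> - w) has_derivative (\<lambda>h. h *\<^sub>R \<gamma>' \<tau>)) (at \<tau> within {a..b})"
      using has_vector_derivative_at_within[OF has_vector_derivative_diff[OF d\<gamma>[of \<tau>] has_vector_derivative_const[of w]]]
      by (simp add: has_vector_derivative_def)
    from has_derivative_compose[OF this d\<phi>]
    show "((\<lambda>\<tau>. \<phi> (\<gamma> \<tau> - w)) has_vector_derivative \<psi> \<tau> w) (at \<tau> within {a..b})"
      unfolding has_vector_derivative_def \<psi>_def by (rule has_derivative_eq_rhs) (simp add: fun_eq_iff algebra_simps)
  next
    show "continuous_on {a..b} (\<lambda>\<tau>. \<psi> \<tau> w)"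
      unfolding \<psi>_def
      by (intro continuous_intros continuous_on_compose2[OF c1] continuous_on_compose2[OF c2]
          continuous_on_subset[OF c\<gamma>] continuous_on_subset[OF c\<gamma>']) auto
  qed
  have dom: "\<bar>X w * (indicator {a..b} \<tau> * \<psi> \<tau> w)\<bar> \<le> (\<bar>X w\<bar> * (D1 + D2)) * indicator {a..b} \<tau>" for w \<tau>
  proof (cases "\<tau> \<in> {a..b} \<and> w \<in> ball 0 1")
    case True
    then have "norm (\<gamma> \<tau> - w) \<le> 2"
      using norm_triangle_ineq4[of "\<gamma> \<tau>" w] inside[of \<tau>] \<delta> by auto
    note D = D1[OF this] D2[OF this]
    have "\<bar>fst (\<gamma>' \<tau>)\<bar> \<le> 1" "\<bar>snd (\<gamma>' \<tau>)\<bar> \<le> 1"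
      using speed[of \<tau>] True norm_fst_le[of "fst (\<gamma>' \<tau>)" "snd (\<gamma>' \<tau>)"] norm_snd_le[of "snd (\<gamma>' \<tau>)" "fst (\<gamma>' \<tau>)"] by auto
    then have "\<bar>fst (\<gamma>' \<tau>)\<bar> * \<bar>\<phi>1 (\<gamma> \<tau> - w)\<bar> \<le> 1 * D1" "\<bar>snd (\<gamma>' \<tau>)\<bar> * \<bar>\<phi>2 (\<gamma> \<tau> - w)\<bar> \<le> 1 * D2"
      using mult_mono[OF _ D(1), of "\<bar>fst (\<gamma>' \<tau>)\<bar>" 1] mult_mono[OF _ D(2), of "\<bar>snd (\<gamma>' \<tau>)\<bar>" 1] by auto
    then have "\<bar>fst (\<gamma>' \<tau>) * \<phi>1 (\<gamma> \<tau> - w)\<bar> \<le> D1" "\<bar>snd (\<gamma>' \<tau>) * \<phi>2 (\<gamma> \<tau> - w)\<bar> \<le> D2"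
      by (simp_all add: abs_mult)
    then have "\<bar>\<psi> \<tau> w\<bar> \<le> D1 + D2" unfolding \<psi>_def by linarith
    then show ?thesis using True by (simp add: abs_mult mult_left_mono)
  next
    case False
    then show ?thesis by (auto simp: X_def indicator_def)
  qed
  have "U (\<gamma> b) - U (\<gamma> a) = (\<integral>w. X w * (\<phi> (\<gamma> b - w) - \<phi> (\<gamma> a - w)) \<partial>lborel)"
    unfolding U_def using integrable_mult_\<phi>[OF X_integrable] by (simp add: right_diff_distrib)
  also have "\<dots> = (\<integral>w. (\<integral>\<tau>. X w * (indicator {a..b} \<tau> * \<psi> \<tau> w) \<partial>lborel) \<partial>lborel)"
    by (simp add: ftc[symmetric])
  also have "\<dots> = (\<integral>\<tau>. (\<integral>w. X w * (indicator {a..b} \<tau> * \<psi> \<tau> w) \<partial>lborel) \<partial>lborel)"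
  proof (rule lborel_pair.Fubini_integral[symmetric])
    show "integrable (lborel \<Otimes>\<^sub>M lborel) (\<lambda>(w, \<tau>). X w * (indicator {a..b} \<tau> * \<psi> \<tau> w))"
    proof (rule integrable_lborel_pair_dominated)
      show "(\<lambda>(w, \<tau>). X w * (indicator {a..b} \<tau> * \<psi> \<tau> w)) \<in> borel_measurable (lborel \<Otimes>\<^sub>M lborel)"
        unfolding \<psi>_def by measurable
      show "integrable lborel (\<lambda>w. \<bar>X w\<bar> * (D1 + D2))" using X_integrable by simp
      show "integrable lborel (indicat_real {a..b})" by (rule integrable_indicator_bounded) auto
    qed (use dom in simp)
  qed
  also have "\<dots> = (\<integral>\<tau>. indicator {a..b} \<tau> * (\<integral>w. X w * \<psi> \<tau> w \<partial>lborel) \<partial>lborel)"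
    by (intro Bochner_Integration.integral_cong refl) (simp add: mult.left_commute flip: integral_mult_right_zero)
  finally have eq: "U (\<gamma> b) - U (\<gamma> a) = (\<integral>\<tau>. indicator {a..b} \<tau> * (\<integral>w. X w * \<psi> \<tau> w \<partial>lborel) \<partial>lborel)" .
  have inner: "\<bar>\<integral>w. X w * \<psi> \<tau> w \<partial>lborel\<bar> \<le> N (\<gamma> \<tau>)" if \<tau>: "\<tau> \<in> {a..b}" for \<tau>
  proof -
    have b': "integrable lborel (\<lambda>w. X w * f (\<gamma> \<tau> - w))"
      if [measurable]: "f \<in> borel_measurable borel" and D: "\<And>z. norm z \<le> 2 \<Longrightarrow> \<bar>f z\<bar> \<le> D" for f D
    proof (rule Bochner_Integration.integrable_bound)
      show "integrable lborel (\<lambda>w. X w * D)" using X_integrable by simp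
      show "AE w in lborel. norm (X w * f (\<gamma> \<tau> - w)) \<le> norm (X w * D)"
      proof (rule AE_I2)
        fix w
        show "norm (X w * f (\<gamma> \<tau> - w)) \<le> norm (X w * D)"
        proof (cases "w \<in> ball 0 1")
          case True
          then have "norm (\<gamma> \<tau> - w) \<le> 2"
            using norm_triangle_ineq4[of "\<gamma> \<tau>" w] inside[OF \<tau>] \<delta> by auto
          from D[OF this] have "\<bar>f (\<gamma> \<tau> - w)\<bar> \<le> \<bar>D\<bar>" by simp
          then show ?thesis by (simp add: abs_mult mult_left_mono)
        qed (simp add: X_def)
      qed
    qed measurable
    have i1: "integrable lborel (\<lambda>w. X w * \<phi>1 (\<gamma> \<tau> - w))" by (rule b'[OF _ D1]) auto
    have i2: "integrable lborel (\<lambda>w. X w * \<phi>2 (\<gamma> \<tau> - w))" by (rule b'[OF _ D2]) auto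
    have "(\<integral>w. X w * \<psi> \<tau> w \<partial>lborel) = (\<integral>w. fst (\<gamma>' \<tau>) * (X w * \<phi>1 (\<gamma> \<tau> - w)) + snd (\<gamma>' \<tau>) * (X w * \<phi>2 (\<gamma> \<tau> - w)) \<partial>lborel)"
      by (intro Bochner_Integration.integral_cong) (auto simp: \<psi>_def algebra_simps)
    also have "\<dots> = fst (\<gamma>' \<tau>) * (\<integral>w. X w * \<phi>1 (\<gamma> \<tau> - w) \<partial>lborel) + snd (\<gamma>' \<tau>) * (\<integral>w. X w * \<phi>2 (\<gamma> \<tau> - w) \<partial>lborel)"
      using i1 i2 by simp
    also have "\<bar>\<dots>\<bar> \<le> N (\<gamma> \<tau>)"
      unfolding weak_grad_mollified[OF inside[OF \<tau>] d\<phi>] by (rule gradient_pairing_le_N[OF speed[OF \<tau>]])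
    finally show ?thesis .
  qed
  let ?h = "\<lambda>\<tau>. indicator {a..b} \<tau> * (\<integral>w. X w * \<psi> \<tau> w \<partial>lborel)"
  have "ennreal \<bar>integral\<^sup>L lborel ?h\<bar> \<le> (\<integral>\<^sup>+\<tau>. ennreal (norm (?h \<tau>)) \<partial>lborel)"
  proof (cases "integrable lborel ?h")
    case True
    then show ?thesis using integral_norm_bound_ennreal[OF True] by simp
  next
    \<comment> \<open>A Bochner integral without integrability is 0 by convention, so the bound is
      trivial.\<close>
    case False
    then show ?thesis by (simp add: not_integrable_integral_eq)
  qed
  also have "\<dots> \<le> (\<integral>\<^sup>+\<tau>\<in>{a..b}. ennreal (N (\<gamma> \<tau>)) \<partial>lborel)"
    using inner by (intro nn_integral_mono) (auto simp: indicator_def intro!: ennreal_leI)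
  finally show ?thesis unfolding eq .
qed

end

section \<open>Angular fluctuations\<close>

text \<open>The clockwise rotation is chosen so that the change of variables in \<open>rot_mean_pairing_0\<close>
  produces \<open>twist t (rot a x)\<close>.\<close>
definition rot_mean :: "(real \<times> real \<Rightarrow> real) \<Rightarrow> real \<times> real \<Rightarrow> real" where
  "rot_mean f x = (\<integral>a\<in>{0..<2*pi}. f (rot (- a) x) \<partial>lborel) / (2 * pi)"

lemma measurable_rot_mean [measurable]:
  assumes [measurable]: "f \<in> borel_measurable borel"
  shows "rot_mean f \<in> borel_measurable borel"
  unfolding rot_mean_def set_lebesgue_integral_def by measurable

lemma bounded_Ico: "bounded {a..<b::real}"
  by (rule bounded_subset[OF bounded_closed_interval[of a b]]) auto

text \<open>Two functions and two points serve two purposes: with a constant function it measures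
  the distance to the circle mean, with one function at \<open>c *\<^sub>R x\<close> and
  \<open>x\<close> the variation of the mean under dilation.\<close>

lemma rot_mean_diff_le:
  assumes [measurable]: "f \<in> borel_measurable borel" "h \<in> borel_measurable borel"
    and fb: "\<And>x. \<bar>f x\<bar> \<le> D" and hb: "\<And>x. \<bar>h x\<bar> \<le> D"
  shows "ennreal (2 * pi) * ennreal \<bar>rot_mean f x - rot_mean h y\<bar>
    \<le> (\<integral>\<^sup>+a\<in>{0..<2*pi}. ennreal \<bar>f (rot (- a) x) - h (rot (- a) y)\<bar> \<partial>lborel)"
proof -
  have i: "set_integrable lborel {0..<2*pi} (\<lambda>a. f (rot (- a) x))" "set_integrable lborel {0..<2*pi} (\<lambda>a. h (rot (- a) y))"
    by (rule integrable_bounded_on[where C=D]; simp add: fb hb bounded_Ico)+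
  then have j: "set_integrable lborel {0..<2*pi} (\<lambda>a. f (rot (- a) x) - h (rot (- a) y))"
    by (rule set_integral_diff)
  have "2 * pi * \<bar>P / (2 * pi) - Q / (2 * pi)\<bar> = \<bar>P - Q\<bar>" for P Q
  proof -
    have "2 * pi * \<bar>P / (2 * pi) - Q / (2 * pi)\<bar> = \<bar>2 * pi * ((P - Q) / (2 * pi))\<bar>"
      unfolding diff_divide_distrib abs_mult by simp
    then show ?thesis by simp
  qed
  then have "2 * pi * \<bar>rot_mean f x - rot_mean h y\<bar> = \<bar>\<integral>a\<in>{0..<2*pi}. f (rot (- a) x) - h (rot (- a) y) \<partial>lborel\<bar>"
    unfolding rot_mean_def set_integral_diff(2)[OF i] .
  then have "ennreal (2 * pi) * ennreal \<bar>rot_mean f x - rot_mean h y\<bar> = ennreal \<bar>\<integral>a\<in>{0..<2*pi}. f (rot (- a) x) - h (rot (- a) y) \<partial>lborel\<bar>"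
    by (subst ennreal_mult[symmetric]) auto
  also have "\<dots> \<le> (\<integral>\<^sup>+a. ennreal (norm (indicator {0..<2*pi} a *\<^sub>R (f (rot (- a) x) - h (rot (- a) y)))) \<partial>lborel)"
    using integral_norm_bound_ennreal[OF j[unfolded set_integrable_def]]
    unfolding set_lebesgue_integral_def real_norm_def .
  also have "\<dots> = (\<integral>\<^sup>+a\<in>{0..<2*pi}. ennreal \<bar>f (rot (- a) x) - h (rot (- a) y)\<bar> \<partial>lborel)"
    by (intro nn_integral_cong) (auto simp: indicator_def)
  finally show ?thesis .
qed

lemma rot_mean_bounded:
  assumes [measurable]: "f \<in> borel_measurable borel" and fb: "\<And>x. \<bar>f x\<bar> \<le> D"
  shows "\<bar>rot_mean f x\<bar> \<le> D"
proof -
  have "\<bar>\<integral>a\<in>{0..<2*pi}. f (rot (- a) x) \<partial>lborel\<bar> \<le> D * measure lborel {0..<2*pi}"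
    by (rule set_integral_bounded) (auto simp: fb bounded_Ico)
  then show ?thesis by (simp add: rot_mean_def field_simps)
qed

lemma rot_mean_const: "rot_mean (\<lambda>_. c) x = c"
  by (simp add: rot_mean_def set_integral_const)

text \<open>\<open>M\<close> plays the role of the size of the gradient. Square integral: the
  fluctuation is at most the integral of \<open>M\<close> over a full turn; Cauchy-Schwarz gives one
  factor \<open>2 * pi\<close>, integration over rotations another, and with the bound 4 on the
  square integral of \<open>M\<close> this is \<open>16 * pi\<^sup>2\<close>. Dilations:
  \<open>M\<close> has integral at most \<open>pi + 4\<close> over the disk, the radial substitution
  costs a factor 4, and the circle mean doubles the result to \<open>8 * (pi + 4)\<close>.\<close>

lemma angular_fluctuation_dilation_regular:
  fixes f M :: "real \<times> real \<Rightarrow> real"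
  assumes [measurable]: "f \<in> borel_measurable borel" "M \<in> borel_measurable borel"
    and fb: "\<And>x. \<bar>f x\<bar> \<le> D" and M0: "\<And>x. M x \<ge> 0"
    and M2: "(\<integral>\<^sup>+x. ennreal ((M x)\<^sup>2) \<partial>lborel) \<le> 4"
    and rot_le: "\<And>x a. norm x < 1 \<Longrightarrow> 0 \<le> a \<Longrightarrow> ennreal \<bar>f (rot (- a) x) - f x\<bar> \<le> (\<integral>\<^sup>+\<tau>\<in>{0..a}. ennreal (M (rot (- \<tau>) x)) \<partial>lborel)"
    and dil_le: "\<And>x c. norm x < 1 \<Longrightarrow> 1/2 \<le> c \<Longrightarrow> c \<le> 1 \<Longrightarrow> ennreal \<bar>f x - f (c *\<^sub>R x)\<bar> \<le> (\<integral>\<^sup>+\<tau>\<in>{c..1}. ennreal (M (\<tau> *\<^sub>R x)) \<partial>lborel)"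
  shows "dilation_regular (16 * pi\<^sup>2 + 8 * (pi + 4)) (\<lambda>x. indicator (ball 0 1) x * (f x - rot_mean f x))"
proof -
  let ?B = "ball (0::real \<times> real) 1"
  let ?I = "{0..<2*pi}"
  define \<zeta> where "\<zeta> x = indicator ?B x * (f x - rot_mean f x)" for x
  have [measurable]: "\<zeta> \<in> borel_measurable borel" unfolding \<zeta>_def by measurable
  have rmb: "\<bar>rot_mean f x\<bar> \<le> D" for x
    by (rule rot_mean_bounded[OF _ fb]) simp
  have \<zeta>b: "\<bar>\<zeta> x\<bar> \<le> 2 * D" for x
    using fb[of x] rmb[of x] by (auto simp: \<zeta>_def indicator_def)
  have \<zeta>0: "\<zeta> x = 0" if "norm x \<ge> 1" for x using that by (simp add: \<zeta>_def)
  have \<zeta>2b: "\<bar>(\<zeta> x)\<^sup>2\<bar> \<le> (2 * D)\<^sup>2" for x using power_mono[OF \<zeta>b[of x], of 2] by simp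
  have \<zeta>2i: "integrable lborel (\<lambda>x. (\<zeta> x)\<^sup>2)"
    by (rule integrable_bounded_support[where R=1, OF _ \<zeta>2b]) (auto simp: \<zeta>0)

  have pt: "ennreal ((\<zeta> x)\<^sup>2) \<le> ennreal (2 * pi) * (\<integral>\<^sup>+\<tau>\<in>?I. ennreal ((M (rot (- \<tau>) x))\<^sup>2) \<partial>lborel)" for x
  proof (cases "norm x < 1")
    case False
    then show ?thesis by (simp add: \<zeta>0)
  next
    case True
    define J where "J = (\<integral>\<^sup>+\<tau>\<in>?I. ennreal (M (rot (- \<tau>) x)) \<partial>lborel)"
    have "ennreal (2 * pi) * ennreal \<bar>f x - rot_mean f x\<bar> \<le> (\<integral>\<^sup>+a\<in>?I. ennreal \<bar>f (rot (- a) x) - f x\<bar> \<partial>lborel)"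
      using rot_mean_diff_le[of "\<lambda>_. f x" f D x x] fb by (simp add: rot_mean_const abs_minus_commute)
    also have "\<dots> \<le> (\<integral>\<^sup>+a\<in>?I. J \<partial>lborel)"
    proof (rule nn_integral_mono)
      fix a
      show "ennreal \<bar>f (rot (- a) x) - f x\<bar> * indicator ?I a \<le> J * indicator ?I a"
      proof (cases "a \<in> ?I")
        case a: True
        have "ennreal \<bar>f (rot (- a) x) - f x\<bar> \<le> (\<integral>\<^sup>+\<tau>\<in>{0..a}. ennreal (M (rot (- \<tau>) x)) \<partial>lborel)"
          using a by (intro rot_le[OF True]) auto
        also have "\<dots> \<le> J" unfolding J_def using a by (intro nn_integral_mono) (auto simp: indicator_def)
        finally show ?thesis using a by simp
      qed simp
    qed
    also have "\<dots> = ennreal (2 * pi) * J" by (simp add: nn_integral_cmult mult.commute)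
    finally have "ennreal \<bar>f x - rot_mean f x\<bar> \<le> J"
      by (subst (asm) ennreal_mult_le_mult_iff) auto
    then have "(ennreal \<bar>f x - rot_mean f x\<bar>)\<^sup>2 \<le> J\<^sup>2" by (intro power_mono) auto
    moreover have "ennreal ((\<zeta> x)\<^sup>2) = (ennreal \<bar>f x - rot_mean f x\<bar>)\<^sup>2"
      using True by (simp add: \<zeta>_def ennreal_power)
    moreover have "J\<^sup>2 \<le> ennreal (2 * pi) * (\<integral>\<^sup>+\<tau>\<in>?I. ennreal ((M (rot (- \<tau>) x))\<^sup>2) \<partial>lborel)"
    proof -
      have "J = (\<integral>\<^sup>+\<tau>. indicator ?I \<tau> * (ennreal (M (rot (- \<tau>) x)) * indicator ?I \<tau>) \<partial>lborel)"
        unfolding J_def by (intro nn_integral_cong) (auto simp: indicator_def)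
      then have "J\<^sup>2 \<le> (\<integral>\<^sup>+\<tau>. (indicator ?I \<tau>)\<^sup>2 \<partial>lborel) * (\<integral>\<^sup>+\<tau>. (ennreal (M (rot (- \<tau>) x)) * indicator ?I \<tau>)\<^sup>2 \<partial>lborel)"
        by (simp only:) (rule Cauchy_Schwarz_nn_integral; measurable)
      also have "(\<integral>\<^sup>+\<tau>. (indicator ?I \<tau>)\<^sup>2 \<partial>lborel) = (\<integral>\<^sup>+\<tau>. indicator ?I \<tau> \<partial>lborel)"
        by (intro nn_integral_cong) (auto simp: indicator_def)
      also have "\<dots> = ennreal (2 * pi)" by simp
      also have "(\<integral>\<^sup>+\<tau>. (ennreal (M (rot (- \<tau>) x)) * indicator ?I \<tau>)\<^sup>2 \<partial>lborel) = (\<integral>\<^sup>+\<tau>\<in>?I. ennreal ((M (rot (- \<tau>) x))\<^sup>2) \<partial>lborel)"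
        using M0 by (intro nn_integral_cong) (auto simp: indicator_def ennreal_power)
      finally show ?thesis .
    qed
    ultimately show ?thesis by simp
  qed
  have rot_avg: "(\<integral>\<^sup>+x. (\<integral>\<^sup>+a\<in>?I. F (rot (- a) x) \<partial>lborel) \<partial>lborel) = ennreal (2 * pi) * (\<integral>\<^sup>+x. F x \<partial>lborel)"
    if [measurable]: "F \<in> borel_measurable borel" for F :: "real \<times> real \<Rightarrow> ennreal"
  proof -
    have "(\<integral>\<^sup>+x. (\<integral>\<^sup>+a\<in>?I. F (rot (- a) x) \<partial>lborel) \<partial>lborel) = (\<integral>\<^sup>+a. (\<integral>\<^sup>+x. F (rot (- a) x) * indicator ?I a \<partial>lborel) \<partial>lborel)"
      by (rule pair_sigma_finite.Fubini') (unfold_locales, measurable)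
    also have "\<dots> = (\<integral>\<^sup>+a. (\<integral>\<^sup>+x. F x \<partial>lborel) * indicator ?I a \<partial>lborel)"
      by (simp add: nn_integral_multc nn_integral_rot)
    also have "\<dots> = ennreal (2 * pi) * (\<integral>\<^sup>+x. F x \<partial>lborel)"
      by (simp add: nn_integral_cmult mult.commute)
    finally show ?thesis .
  qed
  have "(\<integral>\<^sup>+x. ennreal ((\<zeta> x)\<^sup>2) \<partial>lborel) \<le> (\<integral>\<^sup>+x. ennreal (2 * pi) * (\<integral>\<^sup>+\<tau>\<in>?I. ennreal ((M (rot (- \<tau>) x))\<^sup>2) \<partial>lborel) \<partial>lborel)"
    by (intro nn_integral_mono pt)
  also have "\<dots> = ennreal (2 * pi) * (ennreal (2 * pi) * (\<integral>\<^sup>+x. ennreal ((M x)\<^sup>2) \<partial>lborel))"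
    using rot_avg[of "\<lambda>x. ennreal ((M x)\<^sup>2)"] by (simp add: nn_integral_cmult)
  also have "\<dots> \<le> ennreal (2 * pi) * (ennreal (2 * pi) * 4)"
    using M2 by (intro mult_left_mono) auto
  also have "\<dots> = ennreal (16 * pi\<^sup>2)"
    by (simp add: ennreal_mult'[symmetric] power2_eq_square flip: ennreal_numeral)
  finally have "ennreal (\<integral>x. (\<zeta> x)\<^sup>2 \<partial>lborel) \<le> ennreal (16 * pi\<^sup>2)"
    by (subst (asm) nn_integral_eq_integral[OF \<zeta>2i]) auto
  then have "(\<integral>x. (\<zeta> x)\<^sup>2 \<partial>lborel) \<le> 16 * pi\<^sup>2"
    by (subst (asm) ennreal_le_iff) auto
  then have P1: "(\<integral>x. (\<zeta> x)\<^sup>2 \<partial>lborel) \<le> 16 * pi\<^sup>2 + 8 * (pi + 4)"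
    using pi_gt_zero by argo

  \<comment> \<open>From \<open>M x \<le> 1 + (M x)\<^sup>2\<close>: the area \<open>pi\<close> of
    the disk plus the bound 4.\<close>
  have MB: "(\<integral>\<^sup>+x. indicator ?B x * ennreal (M x) \<partial>lborel) \<le> ennreal (pi + 4)"
  proof -
    have "(\<integral>\<^sup>+x. indicator ?B x * ennreal (M x) \<partial>lborel) \<le> (\<integral>\<^sup>+x. indicator ?B x + ennreal ((M x)\<^sup>2) \<partial>lborel)"
    proof (rule nn_integral_mono)
      fix x
      have "0 \<le> (M x - 1/2)\<^sup>2" by simp
      then have "M x \<le> 1 + (M x)\<^sup>2" by (simp add: power2_diff power_divide)
      then have "ennreal (M x) \<le> ennreal (1 + (M x)\<^sup>2)" by (rule ennreal_leI)
      then have "ennreal (M x) \<le> 1 + ennreal ((M x)\<^sup>2)" by (simp add: ennreal_plus)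
      then show "indicator ?B x * ennreal (M x) \<le> indicator ?B x + ennreal ((M x)\<^sup>2)" by (auto simp: indicator_def)
    qed
    also have "\<dots> = emeasure lborel ?B + (\<integral>\<^sup>+x. ennreal ((M x)\<^sup>2) \<partial>lborel)"
      by (subst nn_integral_add) auto
    also have "emeasure lborel ?B = ennreal pi"
      using emeasure_eq_ennreal_measure[of lborel ?B] emeasure_bounded_finite[of ?B] measure_disk[of 1 0] by simp
    also have "ennreal pi + (\<integral>\<^sup>+x. ennreal ((M x)\<^sup>2) \<partial>lborel) \<le> ennreal pi + 4"
      using M2 by (intro add_left_mono)
    also have "\<dots> = ennreal (pi + 4)" by (simp add: ennreal_plus)
    finally show ?thesis .
  qed
  have "(\<integral>x\<in>?B. \<bar>\<zeta> (c *\<^sub>R x) - \<zeta> x\<bar> \<partial>lborel) \<le> (16 * pi\<^sup>2 + 8 * (pi + 4)) * (1 - c)" if c: "1/2 \<le> c" "c \<le> 1" for c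
  proof -
    define h where "h x = indicator ?B x * ennreal \<bar>f (c *\<^sub>R x) - f x\<bar>" for x
    have [measurable]: "h \<in> borel_measurable borel" unfolding h_def by measurable
    have H: "(\<integral>\<^sup>+x. h x \<partial>lborel) \<le> ennreal (4 * (pi + 4) * (1 - c))"
    proof -
      have "(\<integral>\<^sup>+x. h x \<partial>lborel) \<le> (\<integral>\<^sup>+x. (\<integral>\<^sup>+\<tau>. (indicator ?B x * ennreal (M (\<tau> *\<^sub>R x))) * indicator {c..1} \<tau> \<partial>lborel) \<partial>lborel)"
      proof (rule nn_integral_mono)
        fix x
        show "h x \<le> (\<integral>\<^sup>+\<tau>. (indicator ?B x * ennreal (M (\<tau> *\<^sub>R x))) * indicator {c..1} \<tau> \<partial>lborel)"
        proof (cases "x \<in> ?B")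
          case True
          then show ?thesis using dil_le[OF _ c, of x] by (simp add: h_def abs_minus_commute)
        qed (simp add: h_def)
      qed
      also have "\<dots> = (\<integral>\<^sup>+\<tau>. (\<integral>\<^sup>+x. (indicator ?B x * ennreal (M (\<tau> *\<^sub>R x))) * indicator {c..1} \<tau> \<partial>lborel) \<partial>lborel)"
        by (rule pair_sigma_finite.Fubini') (unfold_locales, measurable)
      also have "\<dots> \<le> (\<integral>\<^sup>+\<tau>. ennreal (4 * (pi + 4)) * indicator {c..1} \<tau> \<partial>lborel)"
      proof (rule nn_integral_mono)
        fix \<tau> :: real
        show "(\<integral>\<^sup>+x. (indicator ?B x * ennreal (M (\<tau> *\<^sub>R x))) * indicator {c..1} \<tau> \<partial>lborel) \<le> ennreal (4 * (pi + 4)) * indicator {c..1} \<tau>"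
        proof (cases "\<tau> \<in> {c..1}")
          case True
          then have \<tau>: "1/2 \<le> \<tau>" "\<tau> \<le> 1" "\<tau> > 0" using c by auto
          have "(\<integral>\<^sup>+x. indicator ?B x * ennreal (M (\<tau> *\<^sub>R x)) \<partial>lborel) \<le> (\<integral>\<^sup>+x. indicator ?B (\<tau> *\<^sub>R x) * ennreal (M (\<tau> *\<^sub>R x)) \<partial>lborel)"
          proof (intro nn_integral_mono mult_right_mono)
            fix x :: "real \<times> real"
            have "norm (\<tau> *\<^sub>R x) \<le> norm x" using \<tau> by (simp add: mult_left_le_one_le)
            then show "(indicator ?B x :: ennreal) \<le> indicator ?B (\<tau> *\<^sub>R x)" by (auto simp: indicator_def)
          qed simp
          \<comment> \<open>Since \<open>\<tau> \<ge> 1/2\<close>, the factor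
            \<open>4 * \<tau>\<^sup>2\<close> is at least 1; inserting it supplies the Jacobian for
            the substitution \<open>\<tau> *\<^sub>R x\<close>.\<close>
          also have "\<dots> = ennreal (4 * \<tau>\<^sup>2 / (4 * \<tau>\<^sup>2)) * (\<integral>\<^sup>+x. indicator ?B (\<tau> *\<^sub>R x) * ennreal (M (\<tau> *\<^sub>R x)) \<partial>lborel)"
            using \<tau> by simp
          also have "\<dots> \<le> ennreal (4 * \<tau>\<^sup>2) * (\<integral>\<^sup>+x. indicator ?B (\<tau> *\<^sub>R x) * ennreal (M (\<tau> *\<^sub>R x)) \<partial>lborel)"
          proof (intro mult_right_mono ennreal_leI)
            have "(1/2)\<^sup>2 \<le> \<tau>\<^sup>2" using \<tau> by (intro power_mono) auto
            then show "4 * \<tau>\<^sup>2 / (4 * \<tau>\<^sup>2) \<le> 4 * \<tau>\<^sup>2" using \<tau> by (simp add: power2_eq_square)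
          qed simp
          also have "\<dots> = 4 * (\<integral>\<^sup>+x. indicator ?B x * ennreal (M x) \<partial>lborel)"
            using nn_integral_affine[of "\<lambda>x. indicator ?B x * ennreal (M x)" \<tau> 0] \<tau>(3)
            by (simp add: ennreal_mult mult.assoc)
          also have "\<dots> \<le> 4 * ennreal (pi + 4)" by (intro mult_left_mono MB) simp
          also have "\<dots> = ennreal (4 * (pi + 4))" by (subst ennreal_mult) auto
          finally show ?thesis using True by simp
        qed simp
      qed
      also have "\<dots> = ennreal (4 * (pi + 4)) * ennreal (1 - c)" using c by (simp add: nn_integral_cmult)
      also have "\<dots> = ennreal (4 * (pi + 4) * (1 - c))" using c by (intro ennreal_mult[symmetric]) auto
      finally show ?thesis .
    qed
    \<comment> \<open>Rotations commute with dilations and preserve the disk, so the variation of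
      the circle mean is at most the rotational average of \<open>h\<close>, whose total integral
      equals that of \<open>h\<close>.\<close>
    have pt: "ennreal (2 * pi) * (indicator ?B x * ennreal \<bar>\<zeta> (c *\<^sub>R x) - \<zeta> x\<bar>) \<le> ennreal (2 * pi) * h x + (\<integral>\<^sup>+a\<in>?I. h (rot (- a) x) \<partial>lborel)" for x
    proof (cases "x \<in> ?B")
      case True
      have "c * norm x \<le> 1 * norm x" using c by (intro mult_right_mono) auto
      then have cx: "c *\<^sub>R x \<in> ?B" using True c by auto
      have "\<bar>\<zeta> (c *\<^sub>R x) - \<zeta> x\<bar> \<le> \<bar>f (c *\<^sub>R x) - f x\<bar> + \<bar>rot_mean f (c *\<^sub>R x) - rot_mean f x\<bar>"
        using True cx by (auto simp: \<zeta>_def indicator_def)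
      then have "ennreal \<bar>\<zeta> (c *\<^sub>R x) - \<zeta> x\<bar> \<le> ennreal \<bar>f (c *\<^sub>R x) - f x\<bar> + ennreal \<bar>rot_mean f (c *\<^sub>R x) - rot_mean f x\<bar>"
        by (simp add: ennreal_leI flip: ennreal_plus)
      then have "ennreal (2 * pi) * ennreal \<bar>\<zeta> (c *\<^sub>R x) - \<zeta> x\<bar> \<le>
          ennreal (2 * pi) * (ennreal \<bar>f (c *\<^sub>R x) - f x\<bar> + ennreal \<bar>rot_mean f (c *\<^sub>R x) - rot_mean f x\<bar>)"
        by (intro mult_left_mono) auto
      also have "\<dots> = ennreal (2 * pi) * ennreal \<bar>f (c *\<^sub>R x) - f x\<bar> + ennreal (2 * pi) * ennreal \<bar>rot_mean f (c *\<^sub>R x) - rot_mean f x\<bar>"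
        by (simp add: distrib_left)
      also have "ennreal (2 * pi) * ennreal \<bar>rot_mean f (c *\<^sub>R x) - rot_mean f x\<bar> \<le> (\<integral>\<^sup>+a\<in>?I. ennreal \<bar>f (rot (- a) (c *\<^sub>R x)) - f (rot (- a) x)\<bar> \<partial>lborel)"
        using rot_mean_diff_le[of f f D "c *\<^sub>R x" x] fb by simp
      also have "\<dots> = (\<integral>\<^sup>+a\<in>?I. h (rot (- a) x) \<partial>lborel)"
        using True by (intro nn_integral_cong) (simp add: h_def rot_scaleR)
      finally show ?thesis using True by (simp add: h_def)
    qed simp
    have "ennreal (2 * pi) * (\<integral>\<^sup>+x. indicator ?B x * ennreal \<bar>\<zeta> (c *\<^sub>R x) - \<zeta> x\<bar> \<partial>lborel)
        = (\<integral>\<^sup>+x. ennreal (2 * pi) * (indicator ?B x * ennreal \<bar>\<zeta> (c *\<^sub>R x) - \<zeta> x\<bar>) \<partial>lborel)"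
      by (simp add: nn_integral_cmult)
    also have "\<dots> \<le> (\<integral>\<^sup>+x. ennreal (2 * pi) * h x + (\<integral>\<^sup>+a\<in>?I. h (rot (- a) x) \<partial>lborel) \<partial>lborel)"
      by (intro nn_integral_mono pt)
    also have "\<dots> = ennreal (2 * pi) * (\<integral>\<^sup>+x. h x \<partial>lborel) + ennreal (2 * pi) * (\<integral>\<^sup>+x. h x \<partial>lborel)"
      using rot_avg[of h] by (subst nn_integral_add) (auto simp: nn_integral_cmult)
    also have "\<dots> = ennreal (2 * pi) * ((\<integral>\<^sup>+x. h x \<partial>lborel) + (\<integral>\<^sup>+x. h x \<partial>lborel))"
      by (simp add: distrib_left)
    finally have "(\<integral>\<^sup>+x. indicator ?B x * ennreal \<bar>\<zeta> (c *\<^sub>R x) - \<zeta> x\<bar> \<partial>lborel) \<le> (\<integral>\<^sup>+x. h x \<partial>lborel) + (\<integral>\<^sup>+x. h x \<partial>lborel)"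
      by (subst (asm) ennreal_mult_le_mult_iff) auto
    also have "\<dots> \<le> ennreal (4 * (pi + 4) * (1 - c)) + ennreal (4 * (pi + 4) * (1 - c))"
      by (intro add_mono H)
    also have "\<dots> = ennreal (8 * (pi + 4) * (1 - c))"
      using c by (subst ennreal_plus[symmetric]) auto
    finally have 1: "(\<integral>\<^sup>+x. indicator ?B x * ennreal \<bar>\<zeta> (c *\<^sub>R x) - \<zeta> x\<bar> \<partial>lborel) \<le> ennreal (8 * (pi + 4) * (1 - c))" .
    have i: "set_integrable lborel ?B (\<lambda>x. \<bar>\<zeta> (c *\<^sub>R x) - \<zeta> x\<bar>)"
    proof (rule integrable_bounded_on)
      show "\<bar>\<bar>\<zeta> (c *\<^sub>R x) - \<zeta> x\<bar>\<bar> \<le> 2 * D + 2 * D" for x using \<zeta>b[of x] \<zeta>b[of "c *\<^sub>R x"] by linarith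
    qed auto
    have "ennreal (\<integral>x\<in>?B. \<bar>\<zeta> (c *\<^sub>R x) - \<zeta> x\<bar> \<partial>lborel) = (\<integral>\<^sup>+x. ennreal (indicator ?B x *\<^sub>R \<bar>\<zeta> (c *\<^sub>R x) - \<zeta> x\<bar>) \<partial>lborel)"
      using i unfolding set_lebesgue_integral_def set_integrable_def
      by (intro nn_integral_eq_integral[symmetric]) auto
    also have "\<dots> = (\<integral>\<^sup>+x. indicator ?B x * ennreal \<bar>\<zeta> (c *\<^sub>R x) - \<zeta> x\<bar> \<partial>lborel)"
      by (intro nn_integral_cong) (auto simp: indicator_def)
    finally have "ennreal (\<integral>x\<in>?B. \<bar>\<zeta> (c *\<^sub>R x) - \<zeta> x\<bar> \<partial>lborel) \<le> ennreal (8 * (pi + 4) * (1 - c))"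
      using 1 by simp
    then have "(\<integral>x\<in>?B. \<bar>\<zeta> (c *\<^sub>R x) - \<zeta> x\<bar> \<partial>lborel) \<le> 8 * (pi + 4) * (1 - c)"
      using c by (subst (asm) ennreal_le_iff) auto
    also have "\<dots> \<le> (16 * pi\<^sup>2 + 8 * (pi + 4)) * (1 - c)"
      using c by (intro mult_right_mono) auto
    finally show ?thesis .
  qed
  with P1 \<zeta>2i \<zeta>0 have "dilation_regular (16 * pi\<^sup>2 + 8 * (pi + 4)) \<zeta>"
    unfolding dilation_regular_def by simp
  then show ?thesis unfolding \<zeta>_def .
qed

text \<open>Averaging over rotations is symmetric under the pairing, and twists commute with
  rotations: the average can be moved from \<open>f\<close> onto \<open>\<rho>\<close>, where it
  vanishes.\<close>

lemma rot_mean_pairing_0: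
  fixes \<rho> f :: "real \<times> real \<Rightarrow> real"
  assumes [measurable]: "\<rho> \<in> borel_measurable borel" "f \<in> borel_measurable borel"
    and b: "\<And>x. \<bar>\<rho> x\<bar> \<le> C" and fb: "\<And>x. \<bar>f x\<bar> \<le> D"
    and mean: "AE x in lborel. (\<integral>a\<in>{0..<2*pi}. \<rho> (rot a x) \<partial>lborel) = 0"
  shows "(\<integral>x. \<rho> (twist t x) * (indicator (ball 0 1) x * rot_mean f x) \<partial>lborel) = 0"
proof -
  let ?B = "ball (0::real \<times> real) 1"
  let ?I = "{0..<2*pi}"
  have C: "C \<ge> 0" using b[of 0] by linarith
  have Ii: "integrable lborel (indicat_real ?I)" by (rule integrable_indicator_bounded) (auto simp: bounded_Ico)
  have Bi: "integrable lborel (\<lambda>x. (C * D) * indicat_real ?B x)" by (intro integrable_mult_right integrable_indicator_bounded) auto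
  have dom: "\<bar>indicator ?I a * (indicator ?B x * (\<rho> y * f z))\<bar> \<le> (C * D * indicat_real ?B x) * indicat_real ?I a" for a :: real and x y z
  proof -
    have "\<bar>\<rho> y * f z\<bar> \<le> C * D" unfolding abs_mult using b fb C by (intro mult_mono) auto
    then show ?thesis by (auto simp: indicator_def)
  qed
  have pull: "(\<integral>a. indicat_real ?I a * (u * (v * q a)) \<partial>lborel) = u * v * (\<integral>a. indicator ?I a * q a \<partial>lborel)"
    "(\<integral>a. indicat_real ?I a * (u * (q a * v)) \<partial>lborel) = u * v * (\<integral>a. indicator ?I a * q a \<partial>lborel)" for u v q
    unfolding integral_mult_right_zero[symmetric] by (simp_all add: mult_ac)
  have rm: "2 * pi * rot_mean f x = (\<integral>a. indicator ?I a * f (rot (- a) x) \<partial>lborel)" for x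
    by (simp add: rot_mean_def set_lebesgue_integral_def)
  have "2 * pi * (\<integral>x. \<rho> (twist t x) * (indicator ?B x * rot_mean f x) \<partial>lborel)
     = (\<integral>x. (\<integral>a. indicator ?I a * (indicator ?B x * (\<rho> (twist t x) * f (rot (- a) x))) \<partial>lborel) \<partial>lborel)"
    unfolding pull rm[symmetric] integral_mult_right_zero[symmetric] by (simp add: mult_ac)
  also have "\<dots> = (\<integral>a. (\<integral>x. indicator ?I a * (indicator ?B x * (\<rho> (twist t x) * f (rot (- a) x))) \<partial>lborel) \<partial>lborel)"
    by (rule lborel_pair.Fubini_integral[symmetric], rule integrable_lborel_pair_dominated[OF _ Bi Ii]) (measurable, use dom in simp)
  also have "\<dots> = (\<integral>a. (\<integral>x. indicator ?I a * (indicator ?B x * (\<rho> (twist t (rot a x)) * f x)) \<partial>lborel) \<partial>lborel)"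
  proof (rule Bochner_Integration.integral_cong[OF refl])
    fix a :: real
    let ?F = "\<lambda>x. indicator ?I a * (indicator ?B x * (\<rho> (twist t x) * f (rot (- a) x)))"
    have "(\<integral>x. ?F x \<partial>lborel) = (\<integral>x. ?F x \<partial>distr lborel borel (rot a))" unfolding distr_rot ..
    also have "\<dots> = (\<integral>x. ?F (rot a x) \<partial>lborel)" by (rule integral_distr) measurable
    also have "\<dots> = (\<integral>x. indicator ?I a * (indicator ?B x * (\<rho> (twist t (rot a x)) * f x)) \<partial>lborel)"
      by (intro Bochner_Integration.integral_cong refl) (simp add: rot_rot indicator_def)
    finally show "(\<integral>x. ?F x \<partial>lborel) = (\<integral>x. indicator ?I a * (indicator ?B x * (\<rho> (twist t (rot a x)) * f x)) \<partial>lborel)" .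
  qed
  also have "\<dots> = (\<integral>x. (\<integral>a. indicator ?I a * (indicator ?B x * (\<rho> (twist t (rot a x)) * f x)) \<partial>lborel) \<partial>lborel)"
    by (rule lborel_pair.Fubini_integral, rule integrable_lborel_pair_dominated[OF _ Bi Ii]) (measurable, use dom in simp)
  also have "\<dots> = 0"
  proof (rule integral_eq_zero_AE)
    show "AE x in lborel. (\<integral>a. indicator ?I a * (indicator ?B x * (\<rho> (twist t (rot a x)) * f x)) \<partial>lborel) = 0"
      using mean
    proof eventually_elim
      case (elim x)
      \<comment> \<open>Along this circle the twist adds the constant phase \<open>?c\<close>, which
        does not change an integral over a period.\<close>
      let ?c = "2 * pi * t * norm x"
      have "(\<integral>a\<in>?I. \<rho> (twist t (rot a x)) \<partial>lborel) = (\<integral>a. indicator {?c..<?c+2*pi} (?c + 1 * a) *\<^sub>R \<rho> (rot (?c + 1 * a) x) \<partial>lborel)"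
        unfolding set_lebesgue_integral_def
        by (intro Bochner_Integration.integral_cong refl) (auto simp: twist_def rot_rot indicator_def)
      also have "\<dots> = (\<integral>a\<in>{?c..<?c+2*pi}. \<rho> (rot a x) \<partial>lborel)"
        unfolding set_lebesgue_integral_def by (subst lborel_integral_real_affine[where c=1 and t="?c"]) auto
      also have "\<dots> = (\<integral>a\<in>?I. \<rho> (rot a x) \<partial>lborel)"
        by (rule set_integral_periodic[where C=C]) (auto simp: rot_periodic b)
      finally have "(\<integral>a\<in>?I. \<rho> (twist t (rot a x)) \<partial>lborel) = 0" using elim by simp
      then have "(indicator ?B x * f x) * (\<integral>a. indicator ?I a * \<rho> (twist t (rot a x)) \<partial>lborel) = 0"
        by (simp add: set_lebesgue_integral_def)
      then show "(\<integral>a. indicator ?I a * (indicator ?B x * (\<rho> (twist t (rot a x)) * f x)) \<partial>lborel) = 0"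
        by (simp only: pull)
    qed
  qed
  finally show ?thesis by simp
qed

section \<open>Functional mixing\<close>

text \<open>Written as a further quarter turn, the derivative has norm \<open>norm y\<close> and
  depends continuously on \<open>\<tau>\<close> by facts about \<open>rot\<close> alone.\<close>

lemma has_vector_derivative_rot:
  "((\<lambda>\<tau>. rot (- \<tau>) y) has_vector_derivative rot (- \<tau> - pi / 2) y) (at \<tau>)"
proof -
  have "((\<lambda>\<tau>. (cos \<tau> * fst y + sin \<tau> * snd y, cos \<tau> * snd y - sin \<tau> * fst y)) has_vector_derivative
      (cos \<tau> * snd y - sin \<tau> * fst y, - (cos \<tau> * fst y) - sin \<tau> * snd y)) (at \<tau>)"
    by (intro has_vector_derivative_Pair; unfold has_real_derivative_iff_has_vector_derivative[symmetric])
       (auto intro!: derivative_eq_intros)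
  then show ?thesis
    by (simp add: rot_def sin_diff cos_diff)
qed

text \<open>The approximant, its bound \<open>D\<close> and the scale of mollification depend on
  \<open>\<xi>\<close>, but the regularity constant does not. This uniformity is what the supremum
  over \<open>H1_unit\<close> requires.\<close>

lemma H1_unit_approx:
  assumes \<xi>: "\<xi> \<in> H1_unit (ball 0 1)" and e: "e > 0"
  obtains f D where "f \<in> borel_measurable borel" "\<And>x. \<bar>f x\<bar> \<le> D"
    "dilation_regular (16 * pi\<^sup>2 + 8 * (pi + 4)) (\<lambda>x. indicator (ball 0 1) x * (f x - rot_mean f x))"
    "(\<integral>x. \<bar>indicator (ball 0 1) x * f x - indicator (ball 0 1) x * \<xi> x\<bar> \<partial>lborel) \<le> e"
    "integrable lborel (\<lambda>x. indicator (ball 0 1) x * \<xi> x)"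
proof -
  let ?B = "ball (0::real \<times> real) 1"
  from \<xi> have [measurable]: "\<xi> \<in> borel_measurable borel" and \<xi>2: "set_integrable lborel ?B (\<lambda>x. (\<xi> x)\<^sup>2)"
    by (auto simp: H1_unit_def)
  from \<xi> obtain g where g: "g \<in> borel_measurable lborel" "weak_grad ?B \<xi> g"
    "set_integrable lborel ?B (\<lambda>x. (norm (g x))\<^sup>2)" "(\<integral>x\<in>?B. (norm (g x))\<^sup>2 \<partial>lborel) \<le> 1"
    by (auto simp: H1_unit_def)
  have Xi: "integrable lborel (\<lambda>x. indicator ?B x * \<xi> x)"
  proof (rule square_integrable_on_disk)
    have "(\<lambda>x. (indicator ?B x * \<xi> x)\<^sup>2) = (\<lambda>x. indicator ?B x *\<^sub>R (\<xi> x)\<^sup>2)"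
      by (auto simp: fun_eq_iff indicator_def)
    then show "integrable lborel (\<lambda>x. (indicator ?B x * \<xi> x)\<^sup>2)" using \<xi>2 by (simp add: set_integrable_def)
  qed measurable
  obtain \<delta> where \<delta>: "\<delta> > 0" "\<delta> \<le> 1/2"
    and small: "\<And>c z. 1 - \<delta> \<le> c \<Longrightarrow> c \<le> 1 \<Longrightarrow> norm z \<le> \<delta> \<Longrightarrow>
      (\<integral>x. \<bar>indicator ?B (z + c *\<^sub>R x) * \<xi> (z + c *\<^sub>R x) - indicator ?B x * \<xi> x\<bar> \<partial>lborel) \<le> e"
    by (rule L1_continuous_affine[OF Xi _ e]) auto
  obtain \<phi> where \<phi>: "bump_algebra \<phi>" "\<And>z. \<phi> z \<ge> 0" "\<And>z. norm z \<ge> \<delta> \<Longrightarrow> \<phi> z = 0"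
    "integrable lborel \<phi>" "(\<integral>z. \<phi> z \<partial>lborel) = 1"
    using mollifier_exists[OF \<delta>(1)] by blast
  interpret m: mollified_H1 \<xi> g \<phi> \<delta>
    by unfold_locales (use \<xi>2 g \<phi> \<delta> in auto)
  let ?c = "1 - \<delta>"
  have c: "?c > 0" "?c \<le> 1" using \<delta> by auto
  \<comment> \<open>The same \<open>\<delta>\<close> is kernel radius and contraction: every
    \<open>x\<close> in the open disk is sent to a point \<open>p\<close> with
    \<open>norm p + \<delta> < 1\<close>, so arcs and radial segments in the disk become admissible
    curves for \<open>U\<close>.\<close>
  define f where "f x = m.U (?c *\<^sub>R x)" for x
  define M where "M x = m.N (?c *\<^sub>R x)" for x
  have [measurable]: "f \<in> borel_measurable borel" "M \<in> borel_measurable borel"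
    unfolding f_def M_def by measurable
  obtain D where "\<And>p. \<bar>m.U p\<bar> \<le> D" using m.U_bounded by blast
  then have fb: "\<bar>f x\<bar> \<le> D" for x by (simp add: f_def)
  have inside: "norm (?c *\<^sub>R x) + \<delta> < 1" if "norm x < 1" for x :: "real \<times> real"
  proof -
    have "norm (?c *\<^sub>R x) = ?c * norm x" using c by simp
    also have "\<dots> < ?c * 1" using that c by (intro mult_strict_left_mono) auto
    finally show ?thesis unfolding mult_1_right less_diff_eq .
  qed
  have "dilation_regular (16 * pi\<^sup>2 + 8 * (pi + 4)) (\<lambda>x. indicator ?B x * (f x - rot_mean f x))"
  proof (rule angular_fluctuation_dilation_regular[where M=M and D=D])
    show "M x \<ge> 0" for x by (simp add: M_def m.N_nonneg)
    show "(\<integral>\<^sup>+x. ennreal ((M x)\<^sup>2) \<partial>lborel) \<le> 4"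
    proof -
      \<comment> \<open>Undoing the contraction costs \<open>1 / ?c\<^sup>2\<close>, at most 4
        because \<open>\<delta> \<le> 1/2\<close>; this is the origin of the bound 4.\<close>
      have "1/4 \<le> ?c\<^sup>2" using power_mono[of "1/2" ?c 2] \<delta> by (simp add: power_divide)
      then have "ennreal 1 * (\<integral>\<^sup>+x. ennreal ((M x)\<^sup>2) \<partial>lborel) \<le> ennreal (4 * ?c\<^sup>2) * (\<integral>\<^sup>+x. ennreal ((M x)\<^sup>2) \<partial>lborel)"
        by (intro mult_right_mono ennreal_leI) auto
      also have "\<dots> = 4 * (ennreal (?c\<^sup>2) * (\<integral>\<^sup>+x. ennreal ((m.N (0 + ?c *\<^sub>R x))\<^sup>2) \<partial>lborel))"
        by (simp add: M_def ennreal_mult mult.assoc)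
      also have "\<dots> = 4 * (\<integral>\<^sup>+p. ennreal ((m.N p)\<^sup>2) \<partial>lborel)"
        by (subst nn_integral_affine[OF _ c(1), symmetric]) auto
      also have "\<dots> \<le> 4 * 1" by (intro mult_left_mono m.N_square) auto
      finally show ?thesis by simp
    qed
    show "ennreal \<bar>f (rot (- a) x) - f x\<bar> \<le> (\<integral>\<^sup>+\<tau>\<in>{0..a}. ennreal (M (rot (- \<tau>) x)) \<partial>lborel)"
      if x: "norm x < 1" and a: "0 \<le> a" for x a
    proof -
      have "ennreal \<bar>m.U (rot (- a) (?c *\<^sub>R x)) - m.U (rot (- 0) (?c *\<^sub>R x))\<bar> \<le> (\<integral>\<^sup>+\<tau>\<in>{0..a}. ennreal (m.N (rot (- \<tau>) (?c *\<^sub>R x))) \<partial>lborel)"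
      proof (rule m.U_path_diff[OF has_vector_derivative_rot _ a])
        show "continuous_on UNIV (\<lambda>\<tau>. rot (- \<tau> - pi / 2) (?c *\<^sub>R x))" by (intro continuous_intros)
      qed (use inside[OF x] c \<delta> in auto)
      then show ?thesis by (simp add: f_def M_def rot_scaleR)
    qed
    show "ennreal \<bar>f x - f (b *\<^sub>R x)\<bar> \<le> (\<integral>\<^sup>+\<tau>\<in>{b..1}. ennreal (M (\<tau> *\<^sub>R x)) \<partial>lborel)"
      if x: "norm x < 1" and b: "1/2 \<le> b" "b \<le> 1" for x b
    proof -
      have "ennreal \<bar>m.U (1 *\<^sub>R (?c *\<^sub>R x)) - m.U (b *\<^sub>R (?c *\<^sub>R x))\<bar> \<le> (\<integral>\<^sup>+\<tau>\<in>{b..1}. ennreal (m.N (\<tau> *\<^sub>R (?c *\<^sub>R x))) \<partial>lborel)"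
      proof (rule m.U_path_diff[where \<gamma>'="\<lambda>_. ?c *\<^sub>R x", OF _ _ b(2)])
        show "((\<lambda>\<tau>. \<tau> *\<^sub>R (?c *\<^sub>R x)) has_vector_derivative ?c *\<^sub>R x) (at \<tau>)" for \<tau>
          using has_vector_derivative_scaleR[OF DERIV_ident has_vector_derivative_const[of "?c *\<^sub>R x"]] by simp
        show "norm (\<tau> *\<^sub>R (?c *\<^sub>R x)) + \<delta> < 1" if "\<tau> \<in> {b..1}" for \<tau>
        proof -
          have "norm (\<tau> *\<^sub>R (?c *\<^sub>R x)) \<le> 1 * norm (?c *\<^sub>R x)"
            unfolding norm_scaleR[of \<tau>] using that b by (intro mult_right_mono) auto
          then show ?thesis using inside[OF x] by simp
        qed
      qed (use inside[OF x] \<delta> in auto)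
      then show ?thesis by (simp add: f_def M_def mult.commute)
    qed
  qed (auto simp: fb)
  moreover have "(\<integral>x. \<bar>indicator ?B x * f x - indicator ?B x * \<xi> x\<bar> \<partial>lborel) \<le> e"
  proof -
    have fi: "integrable lborel (\<lambda>x. indicator ?B x * f x)"
      using integrable_bounded_on[of f ?B D] fb by (simp add: set_integrable_def)
    have "ennreal (\<integral>x. \<bar>indicator ?B x * f x - indicator ?B x * \<xi> x\<bar> \<partial>lborel)
        = (\<integral>\<^sup>+x. ennreal \<bar>indicator ?B x * f x - indicator ?B x * \<xi> x\<bar> \<partial>lborel)"
      using fi Xi by (intro nn_integral_eq_integral[symmetric]) auto
    also have "\<dots> \<le> (\<integral>\<^sup>+x. ennreal \<bar>m.U (?c *\<^sub>R x) - m.X x\<bar> \<partial>lborel)"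
      by (intro nn_integral_mono ennreal_leI) (auto simp: f_def m.X_def indicator_def)
    also have "\<dots> \<le> ennreal e"
    proof (rule m.U_approx)
      show "(\<integral>x. \<bar>m.X (z + ?c *\<^sub>R x) - m.X x\<bar> \<partial>lborel) \<le> e" if "norm z \<le> \<delta>" for z
        unfolding m.X_def using small[of ?c z] that c by simp
    qed (use e in simp)
    finally show ?thesis using e by (simp add: ennreal_le_iff)
  qed
  ultimately show ?thesis using that[of f D] fb Xi by auto
qed

lemma zero_in_H1_unit: "(\<lambda>_. 0) \<in> H1_unit U"
  unfolding H1_unit_def weak_grad_def
  by (auto intro!: exI[of _ "\<lambda>_. 0"] simp: set_integrable_def set_lebesgue_integral_def zero_prod_def[symmetric])

text \<open>The time threshold comes from \<open>uniform_weak_mixing\<close> before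
  \<open>\<xi>\<close> is fixed; the approximation of \<open>\<xi>\<close> is chosen afterwards and
  may depend on \<open>\<xi>\<close> and on \<open>t\<close>.\<close>

lemma Hneg1_norm_transport_tendsto_0:
  assumes [measurable]: "\<rho>0 \<in> borel_measurable borel" "\<rho> \<in> borel_measurable borel"
    and eq: "AE x in lborel. \<rho>0 x = \<rho> x" and b: "\<And>x. \<bar>\<rho> x\<bar> \<le> C"
    and supp: "\<And>x. norm x > 1 \<Longrightarrow> \<rho> x = 0"
    and mean: "AE x in lborel. (\<integral>a\<in>{0..<2*pi}. \<rho> (rot a x) \<partial>lborel) = 0"
  shows "((\<lambda>t. Hneg1_norm (transport \<rho>0 t)) \<longlongrightarrow> 0) at_top"
proof (rule order_tendstoI)
  have nonneg: "Hneg1_norm f \<ge> 0" for f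
  proof -
    have "ereal (\<integral>x\<in>ball 0 1. f x * 0 \<partial>lborel) \<le> Hneg1_norm f"
      unfolding Hneg1_norm_def by (rule SUP_upper2[OF zero_in_H1_unit]) simp
    then show ?thesis by (simp add: set_lebesgue_integral_def zero_ereal_def)
  qed
  show "\<forall>\<^sub>F t in at_top. a < Hneg1_norm (transport \<rho>0 t)" if "a < 0" for a
    using less_le_trans[OF that nonneg] by simp
  fix u :: ereal assume "u > 0"
  then obtain e where e: "0 < ereal e" "ereal e < u" using ereal_dense2 by blast
  then have e0: "e > 0" by simp
  let ?B = "ball (0::real \<times> real) 1"
  have C: "C \<ge> 0" using b[of 0] by linarith
  \<comment> \<open>An \<open>L^1\<close> error of \<open>e'\<close> in the test function changes
    the pairing by at most \<open>C * e'\<close>, since the solution stays bounded by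
    \<open>C\<close>.\<close>
  define e' where "e' = e / (2 * (C + 1))"
  have e': "e' > 0" "C * e' \<le> e / 2"
  proof -
    show "e' > 0" using e0 C by (simp add: e'_def)
    then have "C * e' \<le> (C + 1) * e'" by (intro mult_right_mono) auto
    also have "\<dots> = e / 2" using C by (simp add: e'_def divide_simps)
    finally show "C * e' \<le> e / 2" .
  qed
  have "e / 2 > 0" using e0 by simp
  have "\<forall>\<^sub>F t in at_top. \<forall>\<zeta>. dilation_regular (16 * pi\<^sup>2 + 8 * (pi + 4)) \<zeta> \<longrightarrow> \<bar>\<integral>x. \<rho> (twist t x) * \<zeta> x \<partial>lborel\<bar> \<le> e / 2"
    by (rule uniform_weak_mixing[OF _ b supp mean \<open>e / 2 > 0\<close>]) auto
  then show "\<forall>\<^sub>F t in at_top. Hneg1_norm (transport \<rho>0 t) < u"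
  proof eventually_elim
    case (elim t)
    have "(\<integral>x\<in>?B. transport \<rho>0 t x * \<xi> x \<partial>lborel) \<le> e" if \<xi>: "\<xi> \<in> H1_unit ?B" for \<xi>
    proof -
      have [measurable]: "\<xi> \<in> borel_measurable borel" using \<xi> by (simp add: H1_unit_def)
      obtain f D where [measurable]: "f \<in> borel_measurable borel" and fb: "\<And>x. \<bar>f x\<bar> \<le> D"
        and reg: "dilation_regular (16 * pi\<^sup>2 + 8 * (pi + 4)) (\<lambda>x. indicator ?B x * (f x - rot_mean f x))"
        and close: "(\<integral>x. \<bar>indicator ?B x * f x - indicator ?B x * \<xi> x\<bar> \<partial>lborel) \<le> e'"
        and Xi: "integrable lborel (\<lambda>x. indicator ?B x * \<xi> x)"
        using H1_unit_approx[OF \<xi> e'(1)] by blast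
      let ?r = "\<lambda>x. \<rho> (twist t x)"
      let ?d = "\<lambda>x. indicator ?B x * f x - indicator ?B x * \<xi> x"
      have fi: "integrable lborel (\<lambda>x. indicator ?B x * f x)"
        using integrable_bounded_on[of f ?B D] fb by (simp add: set_integrable_def)
      then have di: "integrable lborel ?d" using Xi by simp
      have ri: "integrable lborel (\<lambda>x. ?r x * h x)" if h: "integrable lborel h" for h
      proof (rule Bochner_Integration.integrable_bound)
        have [measurable]: "h \<in> borel_measurable borel" using h by simp
        show "(\<lambda>x. ?r x * h x) \<in> borel_measurable lborel" by measurable
        show "integrable lborel (\<lambda>x. C * h x)" using h by simp
        show "AE x in lborel. norm (?r x * h x) \<le> norm (C * h x)"
        proof (rule AE_I2)
          fix x
          have "\<bar>?r x\<bar> * \<bar>h x\<bar> \<le> C * \<bar>h x\<bar>" by (rule mult_right_mono[OF b]) simp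
          then show "norm (?r x * h x) \<le> norm (C * h x)" using C by (simp add: abs_mult)
        qed
      qed
      have "(\<integral>x. \<bar>?r x * ?d x\<bar> \<partial>lborel) \<le> (\<integral>x. C * \<bar>?d x\<bar> \<partial>lborel)"
      proof (rule integral_mono)
        show "\<bar>?r x * ?d x\<bar> \<le> C * \<bar>?d x\<bar>" for x unfolding abs_mult using b by (intro mult_right_mono) auto
      qed (use di ri[OF di] in auto)
      also have "\<dots> \<le> C * e'" using close C by (simp add: mult_left_mono)
      finally have 1: "\<bar>\<integral>x. ?r x * ?d x \<partial>lborel\<bar> \<le> e / 2"
        using integral_abs_bound[of lborel "\<lambda>x. ?r x * ?d x"] e'(2) by linarith
      have rmb: "\<bar>rot_mean f x\<bar> \<le> D" for x
        by (rule rot_mean_bounded[OF _ fb]) simp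
      have rmi: "integrable lborel (\<lambda>x. indicator ?B x * rot_mean f x)"
        using integrable_bounded_on[of "rot_mean f" ?B D] rmb by (simp add: set_integrable_def)
      have zi: "integrable lborel (\<lambda>x. indicator ?B x * (f x - rot_mean f x))"
        using fi rmi by (simp add: right_diff_distrib)
      have 2: "\<bar>\<integral>x. ?r x * (indicator ?B x * (f x - rot_mean f x)) \<partial>lborel\<bar> \<le> e / 2"
        using elim reg by blast
      have 3: "(\<integral>x. ?r x * (indicator ?B x * rot_mean f x) \<partial>lborel) = 0"
        by (rule rot_mean_pairing_0[OF _ _ b fb mean]) auto
      have "(\<integral>x\<in>?B. transport \<rho>0 t x * \<xi> x \<partial>lborel) = (\<integral>x. ?r x * (indicator ?B x * \<xi> x) \<partial>lborel)"
        unfolding set_lebesgue_integral_def transport_eq_twist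
        by (rule integral_cong_AE, measurable) (use AE_twist[OF eq, of t] in \<open>eventually_elim, simp\<close>)
      \<comment> \<open>Three pieces: the angular fluctuation of \<open>f\<close>, controlled by
        uniform mixing; its circle mean, invisible to the solution; and the approximation
        error.\<close>
      also have "\<dots> = (\<integral>x. ?r x * (indicator ?B x * (f x - rot_mean f x)) + ?r x * (indicator ?B x * rot_mean f x) - ?r x * ?d x \<partial>lborel)"
        by (intro Bochner_Integration.integral_cong refl) (simp add: algebra_simps)
      also have "\<dots> = (\<integral>x. ?r x * (indicator ?B x * (f x - rot_mean f x)) \<partial>lborel) + (\<integral>x. ?r x * (indicator ?B x * rot_mean f x) \<partial>lborel) - (\<integral>x. ?r x * ?d x \<partial>lborel)"
        using ri[OF zi] ri[OF rmi] ri[OF di]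
        by (subst Bochner_Integration.integral_diff, simp_all only: Bochner_Integration.integrable_add)
           (subst Bochner_Integration.integral_add, simp_all)
      finally show ?thesis using 1 2 3 by linarith
    qed
    then have "Hneg1_norm (transport \<rho>0 t) \<le> ereal e"
      unfolding Hneg1_norm_def by (intro SUP_least) simp
    then show ?case using e(2) by (rule order_le_less_trans)
  qed
qed

theorem theorem1:
  fixes \<rho>0 :: "real \<times> real \<Rightarrow> real" and \<kappa> :: real
  assumes meas: "\<rho>0 \<in> borel_measurable lborel"
    and bdd: "\<exists>C. AE x in lborel. \<bar>\<rho>0 x\<bar> \<le> C"
    and supp: "\<forall>x. norm x > 1 \<longrightarrow> \<rho>0 x = 0"
    and circ: "AE r in lborel. r > 0 \<longrightarrow> circle_int \<rho>0 r = 0"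
    and kappa: "0 < \<kappa>" "\<kappa> < 1"
  shows "((\<lambda>t. mix_geo \<kappa> (transport \<rho>0 t)) \<longlongrightarrow> 0) at_top
       \<and> ((\<lambda>t. Hneg1_norm (transport \<rho>0 t)) \<longlongrightarrow> 0) at_top"
proof -
  have [measurable]: "\<rho>0 \<in> borel_measurable borel" using meas by simp
  obtain C where C: "AE x in lborel. \<bar>\<rho>0 x\<bar> \<le> C" using bdd by blast
  \<comment> \<open>\<open>\<rho>0\<close> is bounded only almost everywhere. This representative is
    bounded at every point, which integrals over individual circles and orbits require.\<close>
  define \<rho> where "\<rho> x = (if \<bar>\<rho>0 x\<bar> \<le> C then \<rho>0 x else 0)" for x
  have m: "\<rho> \<in> borel_measurable borel" unfolding \<rho>_def by measurable
  have b: "\<bar>\<rho> x\<bar> \<le> \<bar>C\<bar>" for x by (auto simp: \<rho>_def)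
  have eq: "AE x in lborel. \<rho>0 x = \<rho> x" using C by eventually_elim (simp add: \<rho>_def)
  have s: "\<rho> x = 0" if "norm x > 1" for x using supp[rule_format, OF that] by (simp add: \<rho>_def)
  have mean: "AE x in lborel. (\<integral>a\<in>{0..<2*pi}. \<rho> (rot a x) \<partial>lborel) = 0"
    by (rule AE_rotation_mean_zero[OF _ m b eq circ]) simp
  have "((\<lambda>t. mix_geo \<kappa> (transport \<rho>0 t)) \<longlongrightarrow> 0) at_top"
    by (rule mix_geo_transport_tendsto_0[OF _ m eq b s mean kappa(1)]) auto
  moreover have "((\<lambda>t. Hneg1_norm (transport \<rho>0 t)) \<longlongrightarrow> 0) at_top"
    by (rule Hneg1_norm_transport_tendsto_0[OF _ m eq b s mean]) auto
  ultimately show ?thesis ..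
qed

end
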